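(* Let $\Omega$ be a Banach space of functions with Schauder basis $\{\Phi_i\}_{i=1}^\infty$, and let $m\in\mathbb{N}_+$. For any functional $f\in\mathcal{B}[L_{\text{bound}}(\Omega)]$ there is an $f_m\in\mathcal{G}_{\text{ReLU},m,f}$ such that $$\|f-f_m\|_{\mathcal{H}}\le\frac{4\sqrt5\,\|f\|_{\mathcal{B}}}{\sqrt m},$$ where $\mathcal{G}_{\text{ReLU},m,f}$ is the set of functionals of the form $$g(v)=c+\sum_{j=1}^m\gamma_j\,\text{ReLU}\Big(\sum_{i\in\mathbb{S}_{\boldsymbol{k}_j}}w_{ij}b_i-t_j\Big),\qquad v=\sum_{i=1}^\infty b_i\Phi_i,$$ with $\boldsymbol{k}_j\in\mathbb{K}_f$, $|c|\le2\|f\|_{\mathcal{B}}$, $\sum_{j=1}^m|\gamma_j|\le4\|f\|_{\mathcal{B}}$, $|\boldsymbol{w}_j|_1=\sum_{i\in\mathbb{S}_{\boldsymbol{k}_j}}|w_{ij}|=1$ and $|t_j|\le1$ for $j=1,\dots,m$. Here $\mathbb{K}_f:=\{\boldsymbol{k}\in\mathbb{K}:a_{\boldsymbol{k}}(f)\neq0\}$ and, for $\boldsymbol{k}_j=(k_{1j},k_{2j},\dots)\in\mathbb{K}_f$, $\mathbb{S}_{\boldsymbol{k}_j}:=\{i:k_{ij}\neq0\}$.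
   Context: $\text{ReLU}(x)=\max\{x,0\}$. Functionals are real-valued. $\Omega$ is a Banach space of functions with Schauder basis $\{\Phi_i\}_{i=1}^\infty$ (real scalars): every $v\in\Omega$ is uniquely $v=\sum_{i=1}^\infty b_i\Phi_i$ with $b_i\in\mathbb{R}$. Set $L_{\text{bound}}(\Omega):=\{v=\sum_{i=1}^\infty b_i\Phi_i\in\Omega:\ -\frac12<b_i<\frac12,\ i\in\mathbb{N}_+\}$. Index set: $\mathbb{K}$ is the set of integer sequences $\boldsymbol{k}=(k_1,k_2,\dots)\in\mathbb{Z}^\infty$ with finitely many nonzero entries (including the zero sequence); $|\boldsymbol{k}|_1=\sum_i|k_i|$. Fourier basis: for $\boldsymbol{k}\in\mathbb{K}$ and $v=\sum_i b_i\Phi_i\in L_{\text{bound}}(\Omega)$, $e_{\boldsymbol{k}}(v):=\exp\left(\sum_{i=1}^\infty2\pi \mathrm{i}\,k_ib_i\right)$ (where $\mathrm{i}$ in front of $k_i$ is the imaginary unit). Finite dimensional summation assumption on a functional $f$ on $L_{\text{bound}}(\Omega)$: for the basis $\{\Phi_i\}$ there is a unique sequence of sets $\{\mathbb{D}_j\}_{j=1}^\infty$, $\mathbb{D}_j\subset\mathbb{N}_+$, $|\mathbb{D}_j|<\infty$, such that $f\left(\sum_{i=1}^\infty b_i\Phi_i\right)=\sum_{j=1}^\infty f_j\left(\sum_{i\in\mathbb{D}_j}b_i\Phi_i\right)$ for all $v=\sum_i b_i\Phi_i\in L_{\text{bound}}(\Omega)$, where no $f_j\left(\sum_{i\in\mathbb{D}_j}b_i\Phi_i\right)$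 can be further divided into (written as a sum of) $f_j^{(1)}\left(\sum_{i\in\mathbb{D}_j^1}b_i\Phi_i\right)$ and $f_j^{(2)}\left(\sum_{i\in\mathbb{D}_j^2}b_i\Phi_i\right)$ with $|\mathbb{D}_j^1|,|\mathbb{D}_j^2|<|\mathbb{D}_j|$. The sets $\mathbb{D}_j$ need not be disjoint. Fourier coefficients: for $f$ satisfying this assumption, $$a_{\boldsymbol{k}}(f):=\sum_{j\in\mathbb{A}_{\boldsymbol{k}}}\int_{\left(-\frac12,\frac12\right)^{|\mathbb{D}_j|}}f_j\Big(\sum_{i\in\mathbb{D}_j}b_i\Phi_i\Big)\Big[\prod_{i\in\mathbb{D}_j}\exp(-2\pi \mathrm{i}\,k_ib_i)\,\mathrm{d}b_i\Big],$$ where $\mathbb{K}_{\mathbb{D}_j}:=\{\boldsymbol{k}\in\mathbb{K}:k_i=0\text{ for }i\notin\mathbb{D}_j\}$ and $\mathbb{A}_{\boldsymbol{k}}:=\{j\in\mathbb{N}_+:\boldsymbol{k}\in\mathbb{K}_{\mathbb{D}_j}\}$. Barron spectral space: $\mathcal{B}[L_{\text{bound}}(\Omega)]$ is the set of continuous functionals $f$ on $L_{\text{bound}}(\Omega)$ satisfying the finite dimensional summation assumption with $f(v)=\sum_{\boldsymbol{k}\in\mathbb{K}}a_{\boldsymbol{k}}(f)e_{\boldsymbol{k}}(v)$ and $\|f\|_{\mathcal{B}}:=\sum_{\boldsymbol{k}\in\mathbb{K}}(1+(2\pi)^2|\boldsymbol{k}|_1^2)|a_{\boldsymbol{k}}(f)|<\infty$.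 Hilbert space: $\mathcal{H}[L_{\text{bound}}(\Omega)]$ is the set of functionals $f$ on $L_{\text{bound}}(\Omega)$ satisfying the finite dimensional summation assumption with $f(v)=\sum_{\boldsymbol{k}\in\mathbb{K}}a_{\boldsymbol{k}}(f)e_{\boldsymbol{k}}(v)$ and $\sum_{\boldsymbol{k}\in\mathbb{K}}(1+(2\pi)^2|\boldsymbol{k}|_1^2)|a_{\boldsymbol{k}}(f)|^2<\infty$, with inner product $\langle f,g\rangle_{\mathcal{H}}=\sum_{\boldsymbol{k}\in\mathbb{K}}(1+(2\pi)^2|\boldsymbol{k}|_1^2)\overline{a_{\boldsymbol{k}}(f)}\,a_{\boldsymbol{k}}(g)$ and induced norm $\|\cdot\|_{\mathcal{H}}$.
   Formalization: Neurons with γ_j=0 are unconstrained (for constant f the stated class is empty); the sets D_j are unique only up to order and empty sets, among decompositions without nested sets, and "divided" allows finitely many parts (literal uniqueness never holds). *)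

theory Defs
  imports "HOL-Analysis.Analysis" "HOL-Library.Poly_Mapping"
begin

text \<open>
  Conventions. Basis vectors, coordinates and the sets \<open>D j\<close> are indexed by \<open>nat\<close> starting at \<open>0\<close>
  instead of \<open>1\<close>. The index set of integer sequences with finitely many nonzero entries is the
  type \<open>nat \<Rightarrow>\<^sub>0 int\<close>; \<open>Poly_Mapping.keys k\<close> is the support of \<open>k\<close>. A functional on the set
  \<open>L_bound \<Phi>\<close> is a function \<open>'a \<Rightarrow> real\<close> of which only the values on \<open>L_bound \<Phi>\<close> matter. Sums over
  all multi-indices are unordered (\<open>has_sum\<close>, \<open>infsum\<close>); sums over the terms of a decomposition are
  ordinary series.
\<close>

definition schauder_basis :: "(nat \<Rightarrow> 'a::banach) \<Rightarrow> bool" where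
  "schauder_basis \<Phi> \<longleftrightarrow> (\<forall>v. \<exists>!b::nat \<Rightarrow> real. (\<lambda>i. b i *\<^sub>R \<Phi> i) sums v)"

definition coord :: "(nat \<Rightarrow> 'a::banach) \<Rightarrow> 'a \<Rightarrow> nat \<Rightarrow> real" where
  "coord \<Phi> v = (THE b. (\<lambda>i. b i *\<^sub>R \<Phi> i) sums v)"

definition L_bound :: "(nat \<Rightarrow> 'a::banach) \<Rightarrow> 'a set" where
  "L_bound \<Phi> = {v. \<forall>i. - 1/2 < coord \<Phi> v i \<and> coord \<Phi> v i < 1/2}"

definition restrict_to :: "(nat \<Rightarrow> 'a::banach) \<Rightarrow> nat set \<Rightarrow> 'a \<Rightarrow> 'a" where
  "restrict_to \<Phi> D v = (\<Sum>i\<in>D. coord \<Phi> v i *\<^sub>R \<Phi> i)"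

definition norm1 :: "(nat \<Rightarrow>\<^sub>0 int) \<Rightarrow> real" where
  "norm1 k = (\<Sum>i\<in>Poly_Mapping.keys k. \<bar>real_of_int (Poly_Mapping.lookup k i)\<bar>)"

definition fourier_basis :: "(nat \<Rightarrow> 'a::banach) \<Rightarrow> (nat \<Rightarrow>\<^sub>0 int) \<Rightarrow> 'a \<Rightarrow> complex" where
  "fourier_basis \<Phi> k v =
     exp (\<Sum>i\<in>Poly_Mapping.keys k. 2 * of_real pi * \<i> * of_int (Poly_Mapping.lookup k i) * of_real (coord \<Phi> v i))"


subsection \<open>Finite dimensional summation\<close>

text \<open>
  Divisibility allows any positive finite number of summands, i.e. a division into two parts may be
  repeated. With exactly two summands the sets would not be unique: for
  \<open>b\<^sub>0 b\<^sub>1 + b\<^sub>1 b\<^sub>2 + b\<^sub>0 b\<^sub>2\<close> both the single set \<open>{0,1,2}\<close> and the three pairs would be admissible.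
\<close>

definition divisible :: "(nat \<Rightarrow> 'a::banach) \<Rightarrow> nat set \<Rightarrow> ('a \<Rightarrow> real) \<Rightarrow> bool" where
  "divisible \<Phi> D h \<longleftrightarrow>
     (\<exists>(n::nat) (E :: nat \<Rightarrow> nat set) (H :: nat \<Rightarrow> 'a \<Rightarrow> real).
        n > 0 \<and> (\<forall>l<n. finite (E l) \<and> card (E l) < card D) \<and>
        (\<forall>v\<in>L_bound \<Phi>. h (restrict_to \<Phi> D v) = (\<Sum>l<n. H l (restrict_to \<Phi> (E l) v))))"

text \<open>
  A term whose set is contained in another one can be absorbed by the latter, so uniqueness of the
  sets only makes sense for decompositions without nested sets; this is the last condition. The
  empty set is exempt: it pads finite decompositions to sequences and carries constants.
\<close>

definition finite_dim_decomp ::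
  "(nat \<Rightarrow> 'a::banach) \<Rightarrow> ('a \<Rightarrow> real) \<Rightarrow> (nat \<Rightarrow> nat set) \<Rightarrow> (nat \<Rightarrow> 'a \<Rightarrow> real) \<Rightarrow> bool" where
  "finite_dim_decomp \<Phi> f D F \<longleftrightarrow>
     (\<forall>j. finite (D j)) \<and>
     (\<forall>v\<in>L_bound \<Phi>. (\<lambda>j. F j (restrict_to \<Phi> (D j) v)) sums f v) \<and>
     (\<forall>j. \<not> divisible \<Phi> (D j) (F j)) \<and>
     (\<forall>i j. i \<noteq> j \<longrightarrow> D i \<noteq> {} \<longrightarrow> \<not> D i \<subseteq> D j)"

text \<open>The sequence of sets is unique up to its order and up to occurrences of the empty set.\<close>

definition finite_dim_summation :: "(nat \<Rightarrow> 'a::banach) \<Rightarrow> ('a \<Rightarrow> real) \<Rightarrow> bool" where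
  "finite_dim_summation \<Phi> f \<longleftrightarrow>
     (\<exists>!\<D>. \<exists>D F. finite_dim_decomp \<Phi> f D F \<and> \<D> = range D - {{}})"


subsection \<open>Fourier coefficients\<close>

definition K_set :: "nat set \<Rightarrow> (nat \<Rightarrow>\<^sub>0 int) set" where
  "K_set D = {k. \<forall>i. i \<notin> D \<longrightarrow> Poly_Mapping.lookup k i = 0}"

definition A_set :: "(nat \<Rightarrow> nat set) \<Rightarrow> (nat \<Rightarrow>\<^sub>0 int) \<Rightarrow> nat set" where
  "A_set D k = {j. k \<in> K_set (D j)}"

definition cube :: "nat set \<Rightarrow> (nat \<Rightarrow> real) set" where
  "cube D = (\<Pi>\<^sub>E i\<in>D. {- 1/2 <..< 1/2})"

text \<open>Lebesgue measure on the coordinates in \<open>D\<close>; the product of Borel measures is completed.\<close>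

definition leb :: "nat set \<Rightarrow> (nat \<Rightarrow> real) measure" where
  "leb D = completion (\<Pi>\<^sub>M i\<in>D. lborel)"

definition term_coeff ::
  "(nat \<Rightarrow> 'a::banach) \<Rightarrow> nat set \<Rightarrow> ('a \<Rightarrow> real) \<Rightarrow> (nat \<Rightarrow>\<^sub>0 int) \<Rightarrow> complex" where
  "term_coeff \<Phi> D h k =
     set_lebesgue_integral (leb D) (cube D)
       (\<lambda>b. of_real (h (\<Sum>i\<in>D. b i *\<^sub>R \<Phi> i)) *
            (\<Prod>i\<in>D. exp (- (2 * of_real pi * \<i> * of_int (Poly_Mapping.lookup k i) * of_real (b i)))))"

text \<open>
  \<open>coeffs_of \<Phi> f a\<close>: the family \<open>a\<close> arises from the defining formula of the Fourier coefficients,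
  applied to some decomposition of \<open>f\<close> for which all integrals and series in it exist.
\<close>

definition coeffs_of ::
  "(nat \<Rightarrow> 'a::banach) \<Rightarrow> ('a \<Rightarrow> real) \<Rightarrow> ((nat \<Rightarrow>\<^sub>0 int) \<Rightarrow> complex) \<Rightarrow> bool" where
  "coeffs_of \<Phi> f a \<longleftrightarrow>
     finite_dim_summation \<Phi> f \<and>
     (\<exists>D F. finite_dim_decomp \<Phi> f D F \<and>
        (\<forall>j. set_integrable (leb (D j)) (cube (D j)) (\<lambda>b. F j (\<Sum>i\<in>D j. b i *\<^sub>R \<Phi> i))) \<and>
        (\<forall>k. (\<lambda>j. if j \<in> A_set D k then term_coeff \<Phi> (D j) (F j) k else 0) sums a k))"

text \<open>
  The sets of a decomposition are determined by \<open>f\<close>, the functionals \<open>F j\<close> are not: parts depending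
  on common coordinates can be moved between them, and with infinitely many terms this may change
  the family \<open>a\<close>. The family is unique once it represents \<open>f\<close>, as the elements of both
  function spaces require (\<open>fourier_expansion_unique\<close> below), so the two conditions are combined
  before the coefficients are named.
\<close>

definition fourier_expansion ::
  "(nat \<Rightarrow> 'a::banach) \<Rightarrow> ('a \<Rightarrow> real) \<Rightarrow> ((nat \<Rightarrow>\<^sub>0 int) \<Rightarrow> complex) \<Rightarrow> bool" where
  "fourier_expansion \<Phi> f a \<longleftrightarrow>
     coeffs_of \<Phi> f a \<and>
     (\<forall>v\<in>L_bound \<Phi>. ((\<lambda>k. a k * fourier_basis \<Phi> k v) has_sum of_real (f v)) UNIV)"

definition fourier_coeff ::
  "(nat \<Rightarrow> 'a::banach) \<Rightarrow> ('a \<Rightarrow> real) \<Rightarrow> (nat \<Rightarrow>\<^sub>0 int) \<Rightarrow> complex" where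
  "fourier_coeff \<Phi> f = (THE a. fourier_expansion \<Phi> f a)"


subsection \<open>The function spaces\<close>

definition weight :: "(nat \<Rightarrow>\<^sub>0 int) \<Rightarrow> real" where
  "weight k = 1 + (2 * pi)\<^sup>2 * (norm1 k)\<^sup>2"

definition barron_space :: "(nat \<Rightarrow> 'a::banach) \<Rightarrow> ('a \<Rightarrow> real) set" where
  "barron_space \<Phi> =
     {f. continuous_on (L_bound \<Phi>) f \<and> (\<exists>a. fourier_expansion \<Phi> f a) \<and>
         (\<lambda>k. weight k * cmod (fourier_coeff \<Phi> f k)) summable_on UNIV}"

definition barron_norm :: "(nat \<Rightarrow> 'a::banach) \<Rightarrow> ('a \<Rightarrow> real) \<Rightarrow> real" where
  "barron_norm \<Phi> f = (\<Sum>\<^sub>\<infinity>k. weight k * cmod (fourier_coeff \<Phi> f k))"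

definition hilbert_space :: "(nat \<Rightarrow> 'a::banach) \<Rightarrow> ('a \<Rightarrow> real) set" where
  "hilbert_space \<Phi> =
     {f. (\<exists>a. fourier_expansion \<Phi> f a) \<and>
         (\<lambda>k. weight k * (cmod (fourier_coeff \<Phi> f k))\<^sup>2) summable_on UNIV}"

definition hilbert_inner ::
  "(nat \<Rightarrow> 'a::banach) \<Rightarrow> ('a \<Rightarrow> real) \<Rightarrow> ('a \<Rightarrow> real) \<Rightarrow> complex" where
  "hilbert_inner \<Phi> f g =
     (\<Sum>\<^sub>\<infinity>k. of_real (weight k) * cnj (fourier_coeff \<Phi> f k) * fourier_coeff \<Phi> g k)"

definition hilbert_norm :: "(nat \<Rightarrow> 'a::banach) \<Rightarrow> ('a \<Rightarrow> real) \<Rightarrow> real" where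
  "hilbert_norm \<Phi> f = sqrt (Re (hilbert_inner \<Phi> f f))"


subsection \<open>Shallow networks\<close>

definition relu :: "real \<Rightarrow> real" where
  "relu x = max x 0"

definition K_f :: "(nat \<Rightarrow> 'a::banach) \<Rightarrow> ('a \<Rightarrow> real) \<Rightarrow> (nat \<Rightarrow>\<^sub>0 int) set" where
  "K_f \<Phi> f = {k. fourier_coeff \<Phi> f k \<noteq> 0}"

text \<open>
  The parameters of a neuron with outer weight \<open>\<gamma> j = 0\<close> are left unconstrained. This matters only
  if \<open>f\<close> has no nonzero frequency: then no inner weights of \<open>\<ell>\<^sup>1\<close>-norm 1 exist, and the constant
  network remains. Otherwise the condition \<open>\<gamma> j \<noteq> 0\<close> can be dropped, see \<open>relu_nets_literal\<close> below.
\<close>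

definition relu_nets :: "(nat \<Rightarrow> 'a::banach) \<Rightarrow> nat \<Rightarrow> ('a \<Rightarrow> real) \<Rightarrow> ('a \<Rightarrow> real) set" where
  "relu_nets \<Phi> m f =
     {g. \<exists>(c::real) (\<gamma> :: nat \<Rightarrow> real) (k :: nat \<Rightarrow> nat \<Rightarrow>\<^sub>0 int)
            (w :: nat \<Rightarrow> nat \<Rightarrow> real) (t :: nat \<Rightarrow> real).
          \<bar>c\<bar> \<le> 2 * barron_norm \<Phi> f \<and>
          (\<Sum>j<m. \<bar>\<gamma> j\<bar>) \<le> 4 * barron_norm \<Phi> f \<and>
          (\<forall>j<m. \<gamma> j \<noteq> 0 \<longrightarrow>
             k j \<in> K_f \<Phi> f \<and> (\<Sum>i\<in>Poly_Mapping.keys (k j). \<bar>w j i\<bar>) = 1 \<and> \<bar>t j\<bar> \<le> 1) \<and>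
          (\<forall>v\<in>L_bound \<Phi>.
             g v = c + (\<Sum>j<m. \<gamma> j * relu ((\<Sum>i\<in>Poly_Mapping.keys (k j). w j i * coord \<Phi> v i) - t j)))}"

lemma relu_nets_literal:
  assumes "\<exists>k\<in>K_f \<Phi> f. k \<noteq> 0"
  shows "relu_nets \<Phi> m f =
     {g. \<exists>(c::real) (\<gamma> :: nat \<Rightarrow> real) (k :: nat \<Rightarrow> nat \<Rightarrow>\<^sub>0 int)
            (w :: nat \<Rightarrow> nat \<Rightarrow> real) (t :: nat \<Rightarrow> real).
          \<bar>c\<bar> \<le> 2 * barron_norm \<Phi> f \<and>
          (\<Sum>j<m. \<bar>\<gamma> j\<bar>) \<le> 4 * barron_norm \<Phi> f \<and>
          (\<forall>j<m. k j \<in> K_f \<Phi> f \<and> (\<Sum>i\<in>Poly_Mapping.keys (k j). \<bar>w j i\<bar>) = 1 \<and> \<bar>t j\<bar> \<le> 1) \<and>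
          (\<forall>v\<in>L_bound \<Phi>.
             g v = c + (\<Sum>j<m. \<gamma> j * relu ((\<Sum>i\<in>Poly_Mapping.keys (k j). w j i * coord \<Phi> v i) - t j)))}"
    (is "_ = ?R")
proof
  show "?R \<subseteq> relu_nets \<Phi> m f"
    unfolding relu_nets_def by blast
  show "relu_nets \<Phi> m f \<subseteq> ?R"
  proof
    fix g assume "g \<in> relu_nets \<Phi> m f"
    then obtain c \<gamma> k w t where
      c: "\<bar>c\<bar> \<le> 2 * barron_norm \<Phi> f" and g: "(\<Sum>j<m. \<bar>\<gamma> j\<bar>) \<le> 4 * barron_norm \<Phi> f" and
      n: "\<forall>j<m. \<gamma> j \<noteq> 0 \<longrightarrow>
             k j \<in> K_f \<Phi> f \<and> (\<Sum>i\<in>Poly_Mapping.keys (k j). \<bar>w j i :: real\<bar>) = 1 \<and> \<bar>t j\<bar> \<le> 1" and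
      r: "\<forall>v\<in>L_bound \<Phi>.
             g v = c + (\<Sum>j<m. \<gamma> j * relu ((\<Sum>i\<in>Poly_Mapping.keys (k j). w j i * coord \<Phi> v i) - t j))"
      unfolding relu_nets_def by blast
    obtain k0 where k0: "k0 \<in> K_f \<Phi> f" "k0 \<noteq> 0" using assms by blast
    then obtain i0 where i0: "i0 \<in> Poly_Mapping.keys k0" by (metis keys_eq_empty ex_in_conv)
    define k' where "k' j = (if \<gamma> j = 0 then k0 else k j)" for j
    define w' where "w' j i = (if \<gamma> j = 0 then (if i = i0 then 1 else 0) else w j i)" for j i
    define t' where "t' j = (if \<gamma> j = 0 then 0 else t j)" for j
    have "(\<Sum>i\<in>Poly_Mapping.keys k0. \<bar>if i = i0 then 1 else 0 :: real\<bar>) = (\<Sum>i\<in>Poly_Mapping.keys k0. if i = i0 then 1 else 0)"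
      by (intro sum.cong) auto
    then have one: "(\<Sum>i\<in>Poly_Mapping.keys k0. \<bar>if i = i0 then 1 else 0 :: real\<bar>) = 1"
      using i0 by simp
    have n': "\<forall>j<m. k' j \<in> K_f \<Phi> f \<and> (\<Sum>i\<in>Poly_Mapping.keys (k' j). \<bar>w' j i\<bar>) = 1 \<and> \<bar>t' j\<bar> \<le> 1"
      using n k0 one by (auto simp: k'_def w'_def t'_def)
    have "g v = c + (\<Sum>j<m. \<gamma> j * relu ((\<Sum>i\<in>Poly_Mapping.keys (k' j). w' j i * coord \<Phi> v i) - t' j))"
      if "v \<in> L_bound \<Phi>" for v
    proof -
      have "(\<Sum>j<m. \<gamma> j * relu ((\<Sum>i\<in>Poly_Mapping.keys (k' j). w' j i * coord \<Phi> v i) - t' j)) =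
            (\<Sum>j<m. \<gamma> j * relu ((\<Sum>i\<in>Poly_Mapping.keys (k j). w j i * coord \<Phi> v i) - t j))"
        by (intro sum.cong) (auto simp: k'_def w'_def t'_def)
      then show ?thesis using r that by simp
    qed
    then show "g \<in> ?R" using c g n' by blast
  qed
qed


subsection \<open>Uniqueness of the Fourier coefficients\<close>

lemma coord_eqI:
  assumes "schauder_basis \<Phi>" "(\<lambda>i. b i *\<^sub>R \<Phi> i) sums v"
  shows "coord \<Phi> v = b"
  unfolding coord_def using assms unfolding schauder_basis_def by (intro the1_equality) auto

lemma coord_sum:
  assumes "schauder_basis \<Phi>" "finite A"
  shows "coord \<Phi> (\<Sum>i\<in>A. b i *\<^sub>R \<Phi> i) = (\<lambda>i. if i \<in> A then b i else 0)"
proof (rule coord_eqI[OF assms(1)])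
  have "(\<lambda>i. (if i \<in> A then b i else 0) *\<^sub>R \<Phi> i) sums
        (\<Sum>i\<in>A. (if i \<in> A then b i else 0) *\<^sub>R \<Phi> i)"
    using assms(2) by (intro sums_finite) auto
  then show "(\<lambda>i. (if i \<in> A then b i else 0) *\<^sub>R \<Phi> i) sums (\<Sum>i\<in>A. b i *\<^sub>R \<Phi> i)"
    by simp
qed

lemma grid_character_sum:
  fixes n :: nat and q :: int
  defines "N \<equiv> 2 * int n + 1"
  shows "(\<Sum>x\<in>{-int n..int n}. exp (2 * of_real pi * \<i> * of_int q * of_real (of_int x / of_int N)))
       = (if N dvd q then of_int N else (0::complex))"
proof -
  define z :: complex where "z = exp (2 * of_real pi * \<i> * of_int q / of_int N)"
  have N: "N > 0" by (simp add: N_def)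
  have e: "exp (2 * of_real pi * \<i> * of_int q * of_real (of_int x / of_int N)) = z powi x" for x
    by (simp add: z_def exp_power_int mult_ac)
  have zN: "z powi N = 1"
    using N exp_integer_2pi[of "of_int q"] by (simp add: z_def exp_power_int mult_ac)
  have sh: "(\<Sum>x\<in>{-int n..int n}. z powi x) = (\<Sum>j<nat N. z powi (int j - int n))"
    by (rule sum.reindex_bij_witness[of _ "\<lambda>j. int j - int n" "\<lambda>x. nat (x + int n)"])
       (auto simp: N_def)
  have z0: "z \<noteq> 0" by (simp add: z_def)
  have sh2: "(\<Sum>j<nat N. z powi (int j - int n)) = z powi (- int n) * (\<Sum>j<nat N. z ^ j)"
    unfolding sum_distrib_left
    by (intro sum.cong refl) (simp add: z0 power_int_diff power_int_minus field_simps)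
  have z1: "z = 1 \<longleftrightarrow> N dvd q"
  proof
    assume "z = 1"
    then obtain j :: int where "2 * pi * of_int q / of_int N = of_int (2 * j) * pi"
      unfolding z_def exp_eq_1 by auto
    then have "of_int q = (of_int (j * N) :: real)" using N by (simp add: field_simps)
    then show "N dvd q" by (simp only: of_int_eq_iff) simp
  next
    assume "N dvd q"
    then obtain j where "q = N * j" by auto
    then have "z = exp (2 * of_real pi * \<i> * of_int j)" using N by (simp add: z_def mult_ac)
    also have "\<dots> = 1" using exp_integer_2pi[of "of_int j"] by (simp add: mult_ac)
    finally show "z = 1" .
  qed
  show ?thesis
  proof (cases "N dvd q")
    case True
    then show ?thesis using z1 N unfolding e sh by simp
  next
    case False
    have "z ^ nat N = 1" using zN N by (simp add: power_int_def)
    then have "(\<Sum>j<nat N. z ^ j) = 0" using False z1 by (simp add: geometric_sum)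
    then show ?thesis using False unfolding e sh sh2 by simp
  qed
qed

lemma fourier_expansion_unique:
  assumes \<Phi>: "schauder_basis \<Phi>"
    and "fourier_expansion \<Phi> f a" "fourier_expansion \<Phi> f a'"
  shows "a = a'"
proof
  fix k0 :: "nat \<Rightarrow>\<^sub>0 int"
  define d where "d k = a k - a' k" for k
  have d: "((\<lambda>k. d k * fourier_basis \<Phi> k v) has_sum 0) UNIV" if "v \<in> L_bound \<Phi>" for v
  proof -
    have "((\<lambda>k. a k * fourier_basis \<Phi> k v) has_sum of_real (f v)) UNIV"
      "((\<lambda>k. a' k * fourier_basis \<Phi> k v) has_sum of_real (f v)) UNIV"
      using assms that by (auto simp: fourier_expansion_def)
    from has_sum_add[OF this(1) has_sum_cmult_right[OF this(2), of "- 1"]]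
    show ?thesis by (simp add: d_def algebra_simps)
  qed
  have c0: "coord \<Phi> 0 = (\<lambda>i. 0)"
    using coord_sum[OF \<Phi>, of "{}"] by simp
  have "((\<lambda>k. d k) has_sum 0) UNIV"
    using d[of 0] by (simp add: c0 L_bound_def fourier_basis_def)
  then have abs: "(\<lambda>k. norm (d k)) summable_on UNIV"
    using has_sum_imp_summable summable_on_iff_abs_summable_on_complex by blast
  have bound: "norm (d k0) \<le> \<epsilon>" if eps: "\<epsilon> > 0" for \<epsilon>
  proof -
    obtain T where T: "finite T" "(\<Sum>\<^sub>\<infinity>k\<in>-T. norm (d k)) \<le> \<epsilon>" "k0 \<in> T"
    proof -
      have "((\<lambda>k. norm (d k)) has_sum (\<Sum>\<^sub>\<infinity>k. norm (d k))) UNIV" using abs by simp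
      then have "\<forall>\<^sub>F F in finite_subsets_at_top UNIV.
          dist (\<Sum>k\<in>F. norm (d k)) (\<Sum>\<^sub>\<infinity>k. norm (d k)) < \<epsilon>"
        unfolding has_sum_def by (rule tendstoD[OF _ eps])
      then obtain T0 where T0: "finite T0"
        "\<And>F. finite F \<Longrightarrow> T0 \<subseteq> F \<Longrightarrow> dist (\<Sum>k\<in>F. norm (d k)) (\<Sum>\<^sub>\<infinity>k. norm (d k)) < \<epsilon>"
        unfolding eventually_finite_subsets_at_top by (metis subset_UNIV)
      let ?T = "insert k0 T0"
      have "(\<Sum>\<^sub>\<infinity>k\<in>-?T. norm (d k)) = (\<Sum>\<^sub>\<infinity>k. norm (d k)) - (\<Sum>k\<in>?T. norm (d k))"
        unfolding Compl_eq_Diff_UNIV using T0(1)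
        by (subst infsum_Diff[OF abs]) (auto intro: summable_on_finite)
      moreover have "dist (\<Sum>k\<in>?T. norm (d k)) (\<Sum>\<^sub>\<infinity>k. norm (d k)) < \<epsilon>"
        using T0(1) by (intro T0(2)) auto
      ultimately have "(\<Sum>\<^sub>\<infinity>k\<in>-?T. norm (d k)) \<le> \<epsilon>"
        unfolding dist_real_def by linarith
      then show thesis using T0(1) by (intro that[of ?T]) auto
    qed
    define J where "J = (\<Union>k\<in>T. Poly_Mapping.keys k)"
    define M where "M = (\<Sum>k\<in>T. \<Sum>i\<in>Poly_Mapping.keys k. \<bar>Poly_Mapping.lookup k i\<bar>)"
    define n where "n = nat (Max (insert 0 (int ` J)) + 1 + M)"
    define N where "N = 2 * int n + 1"
    define P where "P = (\<Pi>\<^sub>E i\<in>{..<n}. {-int n..int n})"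
    define v where "v x = (\<Sum>i<n. (of_int (x i) / of_int N) *\<^sub>R \<Phi> i)" for x :: "nat \<Rightarrow> int"
    define \<psi> where "\<psi> k = (\<Prod>i<n. (if N dvd (Poly_Mapping.lookup k i - Poly_Mapping.lookup k0 i) then 1 else (0 :: complex)))" for k
    have finJ: "finite J" using T(1) by (auto simp: J_def)
    have M0: "M \<ge> 0" by (auto simp: M_def intro!: sum_nonneg)
    have Mx: "Max (insert 0 (int ` J)) \<ge> 0" using finJ by simp
    have Jn: "i < n" if "i \<in> J" for i
    proof -
      have "int i \<le> Max (insert 0 (int ` J))" using finJ that by simp
      then show ?thesis using M0 by (simp add: n_def)
    qed
    have small: "\<bar>Poly_Mapping.lookup k i\<bar> < int n" if "k \<in> T" for k i
    proof (cases "i \<in> Poly_Mapping.keys k")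
      case True
      have "\<bar>Poly_Mapping.lookup k i\<bar> \<le> (\<Sum>i\<in>Poly_Mapping.keys k. \<bar>Poly_Mapping.lookup k i\<bar>)"
        using True by (intro member_le_sum) auto
      also have "\<dots> \<le> M" unfolding M_def
        using that T(1) by (intro member_le_sum[of k T "\<lambda>k. \<Sum>i\<in>Poly_Mapping.keys k. \<bar>Poly_Mapping.lookup k i\<bar>"])
          (auto intro!: sum_nonneg)
      finally show ?thesis using Mx M0 by (simp add: n_def)
    next
      case False
      then show ?thesis using Mx M0 by (simp add: n_def in_keys_iff)
    qed
    have Npos: "N > 0" by (simp add: N_def)
    have finP: "finite P" unfolding P_def by (intro finite_PiE) auto
    have cv: "coord \<Phi> (v x) = (\<lambda>i. if i < n then of_int (x i) / of_int N else 0)" for x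
      unfolding v_def by (subst coord_sum[OF \<Phi>]) auto
    have vL: "v x \<in> L_bound \<Phi>" if "x \<in> P" for x
    proof -
      have "- 1/2 < of_int (x i) / (of_int N :: real) \<and> of_int (x i) / (of_int N :: real) < 1/2"
        if i: "i < n" for i
      proof -
        have "x i \<in> {-int n..int n}"
          using \<open>x \<in> P\<close> i unfolding P_def by (intro PiE_mem[of x "{..<n}"]) auto
        then have "- N < 2 * x i" "2 * x i < N" unfolding N_def atLeastAtMost_iff by linarith+
        then have "real_of_int (- N) < real_of_int (2 * x i)" "real_of_int (2 * x i) < real_of_int N"
          unfolding of_int_less_iff .
        moreover have "real_of_int N > 0" using Npos by simp
        ultimately show ?thesis
          unfolding of_int_mult of_int_minus by (simp add: pos_divide_less_eq pos_less_divide_eq)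
      qed
      then show ?thesis by (auto simp: L_bound_def cv)
    qed
    have eb: "fourier_basis \<Phi> k (v x) =
        (\<Prod>i<n. exp (2 * of_real pi * \<i> * of_int (Poly_Mapping.lookup k i) * of_real (of_int (x i) / of_int N)))"
      for k x
    proof -
      have "(\<Sum>i\<in>Poly_Mapping.keys k. 2 * of_real pi * \<i> * of_int (Poly_Mapping.lookup k i) * of_real (coord \<Phi> (v x) i)) =
          (\<Sum>i<n. 2 * of_real pi * \<i> * of_int (Poly_Mapping.lookup k i) * complex_of_real (of_int (x i) / of_int N))"
        by (rule sum.mono_neutral_cong) (auto simp: cv in_keys_iff)
      then show ?thesis by (simp add: fourier_basis_def exp_sum)
    qed
    define u where "u x = (\<Prod>i<n. exp (- (2 * of_real pi * \<i> * of_int (Poly_Mapping.lookup k0 i) *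
        complex_of_real (of_int (x i) / of_int N))))" for x :: "nat \<Rightarrow> int"
    have avg: "(\<Sum>x\<in>P. fourier_basis \<Phi> k (v x) * u x) = of_int N ^ n * \<psi> k" for k
    proof -
      have "(\<Sum>x\<in>P. fourier_basis \<Phi> k (v x) * u x) =
          (\<Sum>x\<in>P. \<Prod>i<n. exp (2 * of_real pi * \<i> * of_int (Poly_Mapping.lookup k i - Poly_Mapping.lookup k0 i) *
             of_real (of_int (x i) / of_int N)))"
        unfolding eb u_def prod.distrib[symmetric] exp_add[symmetric]
        by (intro sum.cong prod.cong refl arg_cong[where f = exp]) (simp add: algebra_simps)
      also have "\<dots> = (\<Prod>i<n. \<Sum>x\<in>{-int n..int n}.
          exp (2 * of_real pi * \<i> * of_int (Poly_Mapping.lookup k i - Poly_Mapping.lookup k0 i) *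
             of_real (of_int x / of_int N)))"
        unfolding P_def by (subst prod_sum_PiE) auto
      also have "\<dots> = (\<Prod>i<n. of_int N * (if N dvd (Poly_Mapping.lookup k i - Poly_Mapping.lookup k0 i) then 1 else 0))"
        unfolding N_def grid_character_sum by (intro prod.cong) auto
      finally show ?thesis by (simp add: prod.distrib \<psi>_def)
    qed
    have "((\<lambda>k. \<Sum>x\<in>P. d k * fourier_basis \<Phi> k (v x) * u x) has_sum (\<Sum>x\<in>P. 0 * u x)) UNIV"
    proof -
      have "((\<lambda>k. \<Sum>x\<in>Q. d k * fourier_basis \<Phi> k (v x) * u x) has_sum (\<Sum>x\<in>Q. 0 * u x)) UNIV"
        if "finite Q" "Q \<subseteq> P" for Q
        using that
      proof (induction rule: finite_induct)
        case (insert x Q)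
        then show ?case
          using has_sum_add[OF has_sum_cmult_left[OF d[OF vL], of x "u x"] insert.IH] by simp
      qed simp
      then show ?thesis using finP by blast
    qed
    then have "((\<lambda>k. of_int N ^ n * (d k * \<psi> k)) has_sum 0) UNIV"
      by (simp add: mult.assoc avg mult.left_commute flip: sum_distrib_left)
    then have hs: "((\<lambda>k. d k * \<psi> k) has_sum 0) UNIV"
      using Npos by (simp add: has_sum_cmult_right_iff)
    have \<psi>0: "\<psi> k0 = 1" by (simp add: \<psi>_def)
    have \<psi>1: "norm (\<psi> k) \<le> 1" for k
      unfolding \<psi>_def prod_norm[symmetric] by (intro prod_le_1) auto
    have \<psi>T: "\<psi> k = 0" if kT: "k \<in> T" and k: "k \<noteq> k0" for k
    proof -
      obtain i where i: "Poly_Mapping.lookup k i \<noteq> Poly_Mapping.lookup k0 i"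
        using k by (metis poly_mapping_eqI)
      then have "i \<in> J"
        using kT T(3) unfolding J_def UN_iff in_keys_iff by metis
      then have "i < n" by (rule Jn)
      moreover have "\<not> N dvd (Poly_Mapping.lookup k i - Poly_Mapping.lookup k0 i)"
      proof
        assume "N dvd (Poly_Mapping.lookup k i - Poly_Mapping.lookup k0 i)"
        then have "N \<le> \<bar>Poly_Mapping.lookup k i - Poly_Mapping.lookup k0 i\<bar>"
          using i dvd_imp_le_int[of "Poly_Mapping.lookup k i - Poly_Mapping.lookup k0 i" N] Npos by simp
        then show False
          using small[OF kT, of i] small[OF T(3), of i] unfolding N_def by linarith
      qed
      ultimately show ?thesis by (auto simp: \<psi>_def)
    qed
    have hT: "((\<lambda>k. d k * \<psi> k) has_sum d k0) T"
    proof -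
      have "(\<Sum>k\<in>T. d k * \<psi> k) = (\<Sum>k\<in>T. if k = k0 then d k0 else 0)"
        using \<psi>0 \<psi>T by (intro sum.cong) auto
      also have "\<dots> = d k0" using T by simp
      finally show ?thesis using T(1) by (metis has_sum_finite)
    qed
    have "((\<lambda>k. d k * \<psi> k) has_sum (0 - d k0)) (UNIV - T)"
      using has_sum_Diff[OF hs hT] by simp
    then have hs': "((\<lambda>k. d k * \<psi> k) has_sum (- d k0)) (- T)"
      by (simp add: Compl_eq_Diff_UNIV)
    have absT: "(\<lambda>k. norm (d k)) summable_on (- T)"
      using abs by (rule summable_on_subset_banach) simp
    have "norm (d k * \<psi> k) \<le> norm (d k)" for k
      using mult_left_mono[OF \<psi>1[of k], of "norm (d k)"] by (simp add: norm_mult)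
    then have "norm (- d k0) \<le> (\<Sum>\<^sub>\<infinity>k\<in>-T. norm (d k))"
      by (intro norm_infsum_le[OF hs' has_sum_infsum[OF absT]])
    then show ?thesis using T(2) by simp
  qed
  have "norm (d k0) \<le> 0"
  proof (rule field_le_epsilon)
    fix \<epsilon> :: real assume "\<epsilon> > 0"
    then show "norm (d k0) \<le> 0 + \<epsilon>" using bound[of \<epsilon>] by linarith
  qed
  then have "d k0 = 0" by simp
  then show "a k0 = a' k0" unfolding d_def by simp
qed

lemma fourier_coeff_eq:
  assumes "schauder_basis \<Phi>" "fourier_expansion \<Phi> f a"
  shows "fourier_coeff \<Phi> f = a"
  unfolding fourier_coeff_def
proof (rule the_equality[where P = "fourier_expansion \<Phi> f"])
  show "fourier_expansion \<Phi> f a" by (rule assms(2))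
  show "a' = a" if "fourier_expansion \<Phi> f a'" for a'
    by (rule fourier_expansion_unique[OF assms(1) that assms(2)])
qed

end

theory Submission
  imports Defs
begin

text \<open>
  The difference \<open>f - f\<^sub>m\<close> must have an absolutely convergent Fourier series, so the network has to be
  periodic on the cube. It is assembled from triangle waves \<open>tri (ridge \<Phi> k v - \<theta>)\<close>, each of which
  costs \<open>2 * norm1 k + 1\<close> neurons. A cosine of frequency \<open>k\<close> is a mean of shifted triangle waves, so
  Maurey's sampling argument applies to a finite discretization of \<open>f\<close>; the frequencies are sampled
  with probabilities that balance the number of neurons against the variance, and the outer weights
  are controlled by a penalty term. Membership of \<open>f - f\<^sub>m\<close> in the Hilbert space needs the
  decomposition of the difference into indivisible terms: its sets are the maximal supports of the
  frequencies of the difference, and subtracting finitely many waves keeps every support below a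
  maximal one.
\<close>

subsection \<open>The triangle wave\<close>

text \<open>A single ReLU unit cannot serve as a sampling atom: an unordered complex series that
  converges at the origin converges absolutely, so its sum extends to a continuous function of
  period 1 in each coordinate, whereas a ReLU of a ridge function in general does not match on
  opposite faces of the cube. The triangle wave is piecewise linear and periodic, and its
  coefficients of order \<open>1 / q\<^sup>2\<close>, once squared, beat the weight, which grows
  like \<open>q\<^sup>2\<close>. The price is that the number of neurons per sample varies with the
  frequency, while the budget \<open>m\<close> is fixed for the total. Three quantities must
  therefore be small for the same sample: the squared error, the number of neurons and the sum of
  the outer weights. They are normalized and added, and a mean below 1 bounds all three at once. If
  \<open>m\<close> is too small for even one sample under this normalization, the constant network
  is already close enough. The squared error to reach is \<open>80 * B\<^sup>2 / m\<close>, since 80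
  is the square of \<open>4 * sqrt 5\<close>.\<close>

lemma summable_inverse_odd_squares: "summable (\<lambda>n. 1 / (2 * real n + 1)\<^sup>2)"
proof (rule summable_comparison_test')
  show "summable (\<lambda>n. inverse ((real (Suc n))\<^sup>2))"
    by (subst summable_Suc_iff) (rule inverse_power_summable, simp)
  show "norm (1 / (2 * real n + 1)\<^sup>2) \<le> inverse ((real (Suc n))\<^sup>2)" if "n \<ge> 0" for n
    by (simp add: field_simps power_mono)
qed

text \<open>The series is the imaginary part of the inverse hyperbolic tangent
  \<open>Ln ((1 + z) / (1 - z)) / 2\<close> at \<open>z = r * cis x\<close>: the square wave series,
  damped by powers of \<open>r\<close> so that it converges absolutely.\<close>

lemma arctan_odd_sine_series:
  assumes "0 \<le> r" "r < 1"
  shows "(\<lambda>n. r ^ (2*n+1) * sin ((2 * real n + 1) * x) / (2 * real n + 1)) sums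
           (arctan (2 * r * sin x / (1 - r\<^sup>2)) / 2)"
proof -
  define z where "z = complex_of_real r * cis x"
  have nz: "cmod z < 1" using assms by (simp add: z_def norm_mult)
  have z1: "1 - z \<noteq> 0" "1 + z \<noteq> 0" using nz by (auto simp: add_eq_0_iff)
  have r2: "1 - r\<^sup>2 > 0" using assms by (simp add: power_less_one_iff abs_square_less_1)
  have "cmod (\<i> * z) < 1" using nz by (simp add: norm_mult)
  from sums_mult[OF Arctan_series(2)[OF this], of "- \<i>"]
  have "(\<lambda>n. - \<i> * ((-1) ^ n / of_nat (2*n+1) * (\<i> * z) ^ (2*n+1))) sums (- \<i> * Arctan (\<i> * z))" .
  also have "(\<lambda>n. - \<i> * ((-1) ^ n / of_nat (2*n+1) * (\<i> * z) ^ (2*n+1))) = (\<lambda>n. z ^ (2*n+1) / of_nat (2*n+1))"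
    by (auto simp: fun_eq_iff power_mult_distrib power_mult power_add)
       (simp add: field_simps flip: power_mult_distrib)
  also have "- \<i> * Arctan (\<i> * z) = Ln ((1 + z) / (1 - z)) / 2"
    by (simp add: Arctan_def)
  finally have "(\<lambda>n. Im (z ^ (2*n+1) / of_nat (2*n+1))) sums Im (Ln ((1 + z) / (1 - z)) / 2)"
    by (rule sums_Im)
  also have "(\<lambda>n. Im (z ^ (2*n+1) / of_nat (2*n+1))) =
      (\<lambda>n. r ^ (2*n+1) * sin ((2 * real n + 1) * x) / (2 * real n + 1))"
  proof
    fix n
    have "z ^ (2*n+1) = of_real (r ^ (2*n+1)) * cis ((2 * real n + 1) * x)"
      unfolding z_def power_mult_distrib Complex.DeMoivre by (simp add: add.commute)
    moreover have "of_nat (2*n+1) = complex_of_real (2 * real n + 1)" by simp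
    ultimately have "z ^ (2*n+1) / of_nat (2*n+1) = of_real (r ^ (2*n+1) / (2 * real n + 1)) * cis ((2 * real n + 1) * x)"
      by (simp only: of_real_divide times_divide_eq_left)
    then show "Im (z ^ (2*n+1) / of_nat (2*n+1)) = r ^ (2*n+1) * sin ((2 * real n + 1) * x) / (2 * real n + 1)"
      by (simp only: Im_complex_of_real Re_complex_of_real times_complex.sel cis.sel mult_zero_left add_0_right times_divide_eq_left)
  qed
  also have "Im (Ln ((1 + z) / (1 - z)) / 2) = arctan (2 * r * sin x / (1 - r\<^sup>2)) / 2"
  proof -
    define w where "w = (1 + z) / (1 - z)"
    define N where "N = (cmod (1 - z))\<^sup>2"
    have N: "N > 0" using z1 by (simp add: N_def)
    have w: "w = ((1 + z) * cnj (1 - z)) / of_real N"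
      unfolding w_def N_def by (metis complex_div_cnj)
    have "r\<^sup>2 * ((cos x)\<^sup>2 + (sin x)\<^sup>2) = r\<^sup>2" by simp
    then have e: "r * r * (cos x * cos x) + r * r * (sin x * sin x) = r * r"
      unfolding power2_eq_square distrib_left .
    have "(1 + z) * cnj (1 - z) = Complex (1 - r\<^sup>2) (2 * r * sin x)"
      using e by (simp add: z_def complex_eq_iff power2_eq_square algebra_simps)
    then have "Re w = (1 - r\<^sup>2) / N" "Im w = 2 * r * sin x / N"
      by (simp_all add: w)
    moreover have "w \<noteq> 0" using z1 by (simp add: w_def)
    \<comment> \<open>\<open>w\<close> has positive real part, so the imaginary part of
      \<open>Ln w\<close> is the arctangent of a quotient in which \<open>N\<close> cancels.\<close>
    ultimately show ?thesis
      using N r2 unfolding w_def[symmetric] by (simp add: Im_Ln_eq)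
  qed
  finally show ?thesis .
qed

text \<open>Termwise differentiation would give a square wave series that converges only
  conditionally. The terms are therefore damped by \<open>r ^ (2*n+1)\<close>, the mean value
  theorem is applied between \<open>x\<close> and \<open>pi / 2\<close>, where every term vanishes,
  and \<open>r\<close> tends to 1 from below.\<close>

lemma odd_cosine_series_lower_half:
  assumes "0 \<le> x" "x \<le> pi / 2"
  shows "(suminf (\<lambda>n. cos ((2 * real n + 1) * x) / (2 * real n + 1)\<^sup>2)) = pi / 4 * (pi / 2 - x)"
proof -
  \<comment> \<open>Damping parameter and angle form one pair, so a single uniform limit gives
    continuity in \<open>r\<close> up to 1 and in \<open>x\<close> up to the endpoints.\<close>
  define h where "h p n = fst p ^ (2*n+1) * (cos ((2 * real n + 1) * snd p) / (2 * real n + 1)\<^sup>2)"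
    for p :: "real \<times> real" and n
  define H where "H p = (suminf (\<lambda>n. h p n))" for p
  have hb: "norm (h p n) \<le> 1 / (2 * real n + 1)\<^sup>2" if "p \<in> {0..1} \<times> UNIV" for p n
  proof -
    have "\<bar>fst p\<bar> \<le> 1" using that by (auto simp: mem_Times_iff)
    then have "\<bar>fst p ^ (2*n+1)\<bar> \<le> 1" unfolding power_abs by (intro power_le_one) auto
    then have "\<bar>fst p ^ (2*n+1)\<bar> * \<bar>cos ((2 * real n + 1) * snd p) / (2 * real n + 1)\<^sup>2\<bar> \<le> 1 * (1 / (2 * real n + 1)\<^sup>2)"
      by (intro mult_mono) (auto simp: divide_simps)
    then show ?thesis by (simp add: h_def abs_mult)
  qed
  have ul: "uniform_limit ({0..1} \<times> UNIV) (\<lambda>N p. \<Sum>n<N. h p n) H sequentially"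
    unfolding H_def by (rule Weierstrass_m_test[OF hb summable_inverse_odd_squares])
  have H_cont: "continuous_on ({0..1} \<times> UNIV) H"
    by (rule uniform_limit_theorem[OF _ ul]) (auto intro!: always_eventually continuous_intros simp: h_def)
  have hsum: "summable (h p)" if "p \<in> {0..1} \<times> UNIV" for p
    by (rule summable_comparison_test'[OF summable_inverse_odd_squares hb[OF that]])
  have Hder: "((\<lambda>x. H (r, x)) has_field_derivative - (arctan (2 * r * sin x / (1 - r\<^sup>2)) / 2)) (at x)"
    if r: "0 \<le> r" "r < 1" for r x
  proof -
    define h' where "h' n x = - (r ^ (2*n+1) * sin ((2 * real n + 1) * x) / (2 * real n + 1))" for n x
    have "((\<lambda>x. suminf (h (r, x))) has_field_derivative (suminf (\<lambda>n. h' n x))) (at x)"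
    proof (rule has_field_derivative_series'(2)[where S = UNIV and ?x0.0 = 0])
      show "((\<lambda>x. h (r, x) n) has_field_derivative h' n x) (at x within UNIV)" for n x
        unfolding h_def h'_def
        by (auto intro!: derivative_eq_intros simp: power2_eq_square)
      show "uniformly_convergent_on UNIV (\<lambda>n x. \<Sum>i<n. h' i x)"
      proof (rule Weierstrass_m_test')
        show "summable (\<lambda>n. r ^ (2*n+1))"
          using r by (simp add: power_mult summable_mult summable_geometric abs_square_less_1)
        show "norm (h' n x) \<le> r ^ (2*n+1)" for n x
        proof -
          have "\<bar>sin ((2 * real n + 1) * x) / (2 * real n + 1)\<bar> \<le> 1"
            using order_trans[OF abs_sin_le_one[of "(2 * real n + 1) * x"], of "2 * real n + 1"] by (simp add: divide_simps)
          then have "r ^ (2*n+1) * \<bar>sin ((2 * real n + 1) * x) / (2 * real n + 1)\<bar> \<le> r ^ (2*n+1) * 1"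
            using r by (intro mult_left_mono) auto
          then show ?thesis using r by (simp add: h'_def abs_mult)
        qed
      qed
      show "summable (h (r, 0))" using r by (intro hsum) auto
    qed auto
    moreover have "(suminf (\<lambda>n. h' n x)) = - (arctan (2 * r * sin x / (1 - r\<^sup>2)) / 2)"
      unfolding h'_def using sums_minus[OF arctan_odd_sine_series[OF r, of x]] by (simp add: sums_iff)
    ultimately show ?thesis by (simp add: H_def)
  qed
  have main: "H (1, x) = pi / 4 * (pi / 2 - x)" if x: "0 < x" "x < pi / 2" for x
  proof -
    have half0: "H (r, pi / 2) = 0" for r
    proof -
      have "cos ((2 * real n + 1) * (pi / 2)) = 0" for n
        by (intro iffD2[OF cos_zero_iff] disjI1 exI[of _ "2*n+1"]) simp
      then show ?thesis by (simp add: H_def h_def)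
    qed
    \<comment> \<open>The intermediate point depends on \<open>r\<close>. Monotonicity of
      \<open>sin\<close> up to \<open>pi / 2\<close> replaces it by \<open>x\<close> in the lower
      bound, and \<open>arctan < pi / 2\<close> gives the upper one; both bounds have the same
      limit.\<close>
    have lo: "arctan (2 * r * sin x / (1 - r\<^sup>2)) / 2 * (pi / 2 - x) \<le> H (r, x) \<and> H (r, x) \<le> pi / 4 * (pi / 2 - x)"
      if r: "0 \<le> r" "r < 1" for r
    proof -
      obtain \<xi> where \<xi>: "x < \<xi>" "\<xi> < pi / 2"
        "H (r, pi / 2) - H (r, x) = (pi / 2 - x) * - (arctan (2 * r * sin \<xi> / (1 - r\<^sup>2)) / 2)"
        using MVT2[OF x(2), of "\<lambda>x. H (r, x)" "\<lambda>x. - (arctan (2 * r * sin x / (1 - r\<^sup>2)) / 2)"] Hder[OF r] by blast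
      have r2: "1 - r\<^sup>2 > 0" using r by (simp add: power_less_one_iff abs_square_less_1)
      have "sin x \<le> sin \<xi>" using \<xi> x by (intro sin_monotone_2pi_le) auto
      then have "2 * r * sin x / (1 - r\<^sup>2) \<le> 2 * r * sin \<xi> / (1 - r\<^sup>2)"
        using r r2 by (intro divide_right_mono mult_left_mono) auto
      then have a: "arctan (2 * r * sin x / (1 - r\<^sup>2)) \<le> arctan (2 * r * sin \<xi> / (1 - r\<^sup>2))"
        by (rule arctan_monotone')
      have "H (r, x) = arctan (2 * r * sin \<xi> / (1 - r\<^sup>2)) / 2 * (pi / 2 - x)"
        using \<xi>(3) half0[of r] by (simp add: algebra_simps)
      moreover have "arctan (2 * r * sin \<xi> / (1 - r\<^sup>2)) / 2 \<le> pi / 4"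
        using arctan_ubound[of "2 * r * sin \<xi> / (1 - r\<^sup>2)"] by simp
      moreover have "arctan (2 * r * sin x / (1 - r\<^sup>2)) / 2 \<le> arctan (2 * r * sin \<xi> / (1 - r\<^sup>2)) / 2"
        using a by simp
      ultimately show ?thesis
        using x by (metis diff_ge_0_iff_ge less_imp_le mult_right_mono)
    qed
    have ev: "\<forall>\<^sub>F r in at_left (1::real). 0 \<le> r \<and> r < 1"
      using eventually_at_left_real[of 0 "1::real"] by (auto elim: eventually_mono)
    have sx: "sin x > 0" using x by (intro sin_gt_zero) auto
    have "filterlim (\<lambda>r. 2 * r * sin x / (1 - r\<^sup>2)) at_top (at_left 1)"
    proof -
      have n: "((\<lambda>r. 2 * r * sin x) \<longlongrightarrow> 2 * 1 * sin x) (at_left 1)"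
        by (intro tendsto_intros)
      have d: "((\<lambda>r::real. 1 - r\<^sup>2) \<longlongrightarrow> 1 - 1\<^sup>2) (at_left 1)"
        by (intro tendsto_intros)
      show ?thesis
      proof (rule LIM_at_top_divide[OF n])
        show "2 * 1 * sin x > 0" using sx by simp
        show "((\<lambda>r::real. 1 - r\<^sup>2) \<longlongrightarrow> 0) (at_left 1)" using d by simp
        show "\<forall>\<^sub>F r in at_left (1::real). 0 < 1 - r\<^sup>2"
          using ev by eventually_elim (simp add: power_less_one_iff abs_square_less_1)
      qed
    qed
    from filterlim_compose[OF tendsto_arctan_at_top this]
    have "((\<lambda>r. arctan (2 * r * sin x / (1 - r\<^sup>2)) / 2 * (pi / 2 - x)) \<longlongrightarrow> pi / 2 / 2 * (pi / 2 - x)) (at_left 1)"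
      by (intro tendsto_intros) auto
    then have l: "((\<lambda>r. arctan (2 * r * sin x / (1 - r\<^sup>2)) / 2 * (pi / 2 - x)) \<longlongrightarrow> pi / 4 * (pi / 2 - x)) (at_left 1)"
      by simp
    have e1: "\<forall>\<^sub>F r in at_left 1. arctan (2 * r * sin x / (1 - r\<^sup>2)) / 2 * (pi / 2 - x) \<le> H (r, x)"
      using ev by eventually_elim (use lo in blast)
    have e2: "\<forall>\<^sub>F r in at_left 1. H (r, x) \<le> pi / 4 * (pi / 2 - x)"
      using ev by eventually_elim (use lo in blast)
    have L: "((\<lambda>r. H (r, x)) \<longlongrightarrow> pi / 4 * (pi / 2 - x)) (at_left 1)"
      by (rule tendsto_sandwich[OF e1 e2 l tendsto_const])
    have "continuous_on {0..1} (\<lambda>r. H (r, x))"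
      by (rule continuous_on_compose2[OF H_cont]) (auto intro!: continuous_intros)
    then have "((\<lambda>r. H (r, x)) \<longlongrightarrow> H (1, x)) (at 1 within {0..1})"
      by (auto simp: continuous_on_def)
    then have "((\<lambda>r. H (r, x)) \<longlongrightarrow> H (1, x)) (at_left 1)"
      by (simp add: at_within_Icc_at_left)
    then show ?thesis using L by (intro tendsto_unique[of "at_left (1::real)"]) auto
  qed
  have c1: "continuous_on {0..pi/2} (\<lambda>x. H (1, x) - pi / 4 * (pi / 2 - x))"
    by (intro continuous_intros continuous_on_compose2[OF H_cont]) auto
  \<comment> \<open>The sandwich was carried out in the open interval; continuity adds the two
    endpoints.\<close>
  have "H (1, x) - pi / 4 * (pi / 2 - x) = 0"
  proof (rule continuous_constant_on_closure[of "{0<..<pi/2}" "\<lambda>x. H (1, x) - pi / 4 * (pi / 2 - x)"])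
    show "x \<in> closure {0<..<pi/2}" using assms by (subst closure_greaterThanLessThan) auto
    show "continuous_on (closure {0<..<pi/2}) (\<lambda>x. H (1, x) - pi / 4 * (pi / 2 - x))"
      using c1 by (subst closure_greaterThanLessThan) auto
  qed (use main in auto)
  then show ?thesis by (simp add: H_def h_def)
qed

text \<open>Replacing \<open>x\<close> by \<open>pi - x\<close> negates every odd cosine and also
  the right-hand side, which carries the identity from the lower half to the upper one.\<close>

lemma odd_cosine_series:
  assumes "0 \<le> x" "x \<le> pi"
  shows "(\<lambda>n. cos ((2 * real n + 1) * x) / (2 * real n + 1)\<^sup>2) sums (pi / 4 * (pi / 2 - x))"
proof -
  have s: "summable (\<lambda>n. cos ((2 * real n + 1) * x) / (2 * real n + 1)\<^sup>2)" for x
    by (rule summable_comparison_test'[OF summable_inverse_odd_squares]) (auto simp: divide_simps)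
  show ?thesis
  proof (cases "x \<le> pi / 2")
    case True
    then show ?thesis using odd_cosine_series_lower_half[OF assms(1)] s[of x] by (simp add: sums_iff)
  next
    case False
    have c: "cos ((2 * real n + 1) * (pi - x)) = - cos ((2 * real n + 1) * x)" for n
    proof -
      have "(2 * real n + 1) * (pi - x) = real (2*n+1) * pi - (2 * real n + 1) * x" by (simp add: algebra_simps)
      moreover have "sin (real (2*n+1) * pi) = 0" by (rule sin_npi)
      moreover have "cos (real (2*n+1) * pi) = -1" unfolding cos_npi by simp
      ultimately show ?thesis by (simp only: cos_diff mult_zero_left add_0_right mult_minus1)
    qed
    have "(suminf (\<lambda>n. cos ((2 * real n + 1) * (pi - x)) / (2 * real n + 1)\<^sup>2)) = pi / 4 * (pi / 2 - (pi - x))"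
      using False assms by (intro odd_cosine_series_lower_half) auto
    with s[of "pi - x"] have "(\<lambda>n. - (cos ((2 * real n + 1) * x) / (2 * real n + 1)\<^sup>2)) sums (pi / 4 * (pi / 2 - (pi - x)))"
      by (simp add: sums_iff c)
    from sums_minus[OF this] show ?thesis by (simp add: algebra_simps)
  qed
qed

text \<open>The triangle wave of period 1, linear between the value 1 at the integers and -1 midway
  between them. \<open>\<lfloor>2 * y\<rfloor>\<close> numbers the half-periods, and its parity
  selects the falling or the rising piece.\<close>

definition tri :: "real \<Rightarrow> real" where
  "tri y = (if even \<lfloor>2 * y\<rfloor> then 1 else - 1) * (1 - 4 * (y - of_int \<lfloor>2 * y\<rfloor> / 2))"

definition tri_coeff :: "int \<Rightarrow> real" where
  "tri_coeff q = (if odd q then 4 / (pi\<^sup>2 * (of_int q)\<^sup>2) else 0)"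

lemma cis_integer_pi: "cis (of_int n * pi) = (if even n then 1 else - 1)"
proof -
  have "cis (of_int n * pi) = cis pi powi n" by (simp only: cis_power_int)
  then show ?thesis by (simp add: power_int_minus_left)
qed

text \<open>On \<open>[0, 1/2]\<close> this is the odd cosine series at \<open>2 * pi * r\<close>,
  with opposite frequencies paired. The other half-periods follow because a shift by 1/2 changes the
  sign of every odd character, as it does for the wave.\<close>

lemma tri_fourier: "((\<lambda>q. of_real (tri_coeff q) * cis (2 * pi * of_int q * y)) has_sum of_real (tri y)) UNIV"
proof -
  have base: "((\<lambda>q. of_real (tri_coeff q) * cis (2 * pi * of_int q * r)) has_sum of_real (1 - 4 * r)) UNIV"
    if r: "0 \<le> r" "r \<le> 1/2" for r
  proof -
    define F where "F q = complex_of_real (tri_coeff q) * cis (2 * pi * of_int q * r)" for q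
    define pos where "pos n = 2 * int n + 1" for n
    define neg where "neg n = - (2 * int n + 1)" for n
    define c where "c n = 4 / pi\<^sup>2 * (1 / (2 * real n + 1)\<^sup>2)" for n
    have t: "tri_coeff (pos n) = c n" "tri_coeff (neg n) = c n" for n
      by (simp_all add: tri_coeff_def pos_def neg_def c_def power2_eq_square algebra_simps)
    have sc: "summable c" unfolding c_def by (intro summable_mult summable_inverse_odd_squares)
    have c0: "c n \<ge> 0" for n by (simp add: c_def)
    have ap: "(\<lambda>n. F (pos n)) summable_on UNIV" "(\<lambda>n. F (neg n)) summable_on UNIV"
      using sc c0 by (auto intro!: norm_summable_imp_summable_on simp: F_def t norm_mult)
    have inj: "inj pos" "inj neg" by (auto simp: inj_def pos_def neg_def)
    have disj: "range pos \<inter> range neg = {}" by (auto simp: pos_def neg_def)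
    have odd: "range pos \<union> range neg = {q. odd q}"
    proof (intro equalityI subsetI)
      fix q :: int assume "q \<in> {q. odd q}"
      then obtain m where m: "q = 2 * m + 1" by (auto elim: oddE)
      show "q \<in> range pos \<union> range neg"
      proof (cases "m \<ge> 0")
        case True then have "q = pos (nat m)" using m by (simp add: pos_def)
        then show ?thesis by blast
      next
        case False then have "q = neg (nat (- m - 1))" using m by (simp add: neg_def)
        then show ?thesis by blast
      qed
    qed (auto simp: pos_def neg_def)
    have "((\<lambda>n. F (pos n) + F (neg n)) has_sum (infsum (\<lambda>n. F (pos n)) UNIV + infsum (\<lambda>n. F (neg n)) UNIV)) UNIV"
      using ap by (intro has_sum_add) auto
    then have "(\<lambda>n. F (pos n) + F (neg n)) sums (infsum (\<lambda>n. F (pos n)) UNIV + infsum (\<lambda>n. F (neg n)) UNIV)"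
      by (rule has_sum_imp_sums)
    moreover have "(\<lambda>n. F (pos n) + F (neg n)) sums of_real (8 / pi\<^sup>2 * (pi / 4 * (pi / 2 - 2 * pi * r)))"
    proof -
      have "F (pos n) + F (neg n) = of_real (8 / pi\<^sup>2 * (cos ((2 * real n + 1) * (2 * pi * r)) / (2 * real n + 1)\<^sup>2))" for n
      proof -
        have "F (neg n) = cnj (F (pos n))"
          unfolding F_def t by (simp add: cis_cnj pos_def neg_def algebra_simps)
        then have "F (pos n) + F (neg n) = of_real (2 * Re (F (pos n)))"
          by (simp add: complex_add_cnj)
        also have "Re (F (pos n)) = c n * cos ((2 * real n + 1) * (2 * pi * r))"
          unfolding F_def t by (simp add: pos_def mult_ac)
        finally show ?thesis by (simp add: c_def)
      qed
      then show ?thesis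
        using sums_of_real[OF sums_mult[OF odd_cosine_series[of "2 * pi * r"], of "8 / pi\<^sup>2"], where 'a = complex] r
        by simp
    qed
    ultimately have e: "infsum (\<lambda>n. F (pos n)) UNIV + infsum (\<lambda>n. F (neg n)) UNIV = of_real (8 / pi\<^sup>2 * (pi / 4 * (pi / 2 - 2 * pi * r)))"
      by (rule sums_unique2)
    have "(F has_sum infsum (\<lambda>n. F (pos n)) UNIV) (range pos)" "(F has_sum infsum (\<lambda>n. F (neg n)) UNIV) (range neg)"
      using ap by (auto simp: has_sum_reindex inj o_def)
    then have "(F has_sum (infsum (\<lambda>n. F (pos n)) UNIV + infsum (\<lambda>n. F (neg n)) UNIV)) (range pos \<union> range neg)"
      using disj by (intro has_sum_Un_disjoint)
    then have "(F has_sum of_real (8 / pi\<^sup>2 * (pi / 4 * (pi / 2 - 2 * pi * r)))) {q. odd q}"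
      unfolding odd e .
    moreover have "8 / pi\<^sup>2 * (pi / 4 * (pi / 2 - 2 * pi * r)) = 1 - 4 * r"
      by (simp add: field_simps power2_eq_square)
    ultimately have "(F has_sum of_real (1 - 4 * r)) {q. odd q}" by (simp only:)
    then show ?thesis unfolding F_def
      by (rule has_sum_cong_neutral[THEN iffD1, rotated -1]) (auto simp: tri_coeff_def)
  qed
  define n where "n = \<lfloor>2 * y\<rfloor>"
  define r where "r = y - of_int n / 2"
  have r: "0 \<le> r" "r \<le> 1/2" unfolding r_def n_def by linarith+
  define s :: complex where "s = (if even n then 1 else - 1)"
  have "((\<lambda>q. s * (of_real (tri_coeff q) * cis (2 * pi * of_int q * r))) has_sum (s * of_real (1 - 4 * r))) UNIV"
    by (intro has_sum_cmult_right base r)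
  moreover have "s * of_real (1 - 4 * r) = of_real (tri y)"
    by (simp add: s_def tri_def r_def n_def)
  moreover have "s * (of_real (tri_coeff q) * cis (2 * pi * of_int q * r)) = of_real (tri_coeff q) * cis (2 * pi * of_int q * y)" for q
  proof (cases "odd q")
    case True
    have "2 * pi * of_int q * y = of_int (q * n) * pi + 2 * pi * of_int q * r"
      by (simp add: r_def algebra_simps)
    then have "cis (2 * pi * of_int q * y) = s * cis (2 * pi * of_int q * r)"
      using True by (simp only: cis_mult[symmetric] cis_integer_pi) (simp add: s_def)
    then show ?thesis by simp
  qed (simp add: tri_coeff_def)
  ultimately show ?thesis by simp
qed

lemma tri_on_interval:
  assumes "of_int n \<le> 2 * y" "2 * y \<le> of_int n + 1"
  shows "tri y = (if even n then 1 else - 1) * (1 - 4 * (y - of_int n / 2))"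
proof (cases "2 * y = of_int n + 1")
  case True
  then have y: "y = (of_int n + 1) / 2" by simp
  have "\<lfloor>2 * y\<rfloor> = n + 1" using True by linarith
  then show ?thesis unfolding tri_def by (auto simp: y field_simps)
next
  case False
  then have "\<lfloor>2 * y\<rfloor> = n" using assms by linarith
  then show ?thesis unfolding tri_def by simp
qed

lemma tri_bound: "\<bar>tri y\<bar> \<le> 1"
proof -
  have "0 \<le> y - of_int \<lfloor>2 * y\<rfloor> / 2" "y - of_int \<lfloor>2 * y\<rfloor> / 2 \<le> 1/2" by linarith+
  then show ?thesis unfolding tri_def by (auto simp: abs_if)
qed

section \<open>The triangle wave as a sum of ReLU functions\<close>

definition tri_sign :: "int \<Rightarrow> real" where
  "tri_sign n = (if even n then 1 else - 1)"

text \<open>The slope of \<open>tri\<close> flips between \<open>-4\<close> and \<open>4\<close> at every half-integer.\<close>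

definition tri_relu :: "real \<Rightarrow> nat \<Rightarrow> real \<Rightarrow> real" where
  "tri_relu y0 N y = tri y0 - 4 * tri_sign \<lfloor>2 * y0\<rfloor> * (y - y0)
     - (\<Sum>n<N. 8 * tri_sign (\<lfloor>2 * y0\<rfloor> + 1 + int n) * relu (y - of_int (\<lfloor>2 * y0\<rfloor> + 1 + int n) / 2))"

text \<open>Beyond its kinks \<open>tri_relu\<close> stays on the line of the half-period entered
  last: each ReLU changes the slope by 8 in size, from one of -4 and 4 to the other.\<close>

lemma tri_relu_affine:
  assumes "of_int (\<lfloor>2 * y0\<rfloor> + int N) / 2 \<le> y"
  shows "tri_relu y0 N y = tri_sign (\<lfloor>2 * y0\<rfloor> + int N) * (1 - 4 * (y - of_int (\<lfloor>2 * y0\<rfloor> + int N) / 2))"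
  using assms
proof (induction N)
  case 0
  show ?case by (simp add: tri_relu_def tri_def tri_sign_def algebra_simps)
next
  case (Suc N)
  define n where "n = \<lfloor>2 * y0\<rfloor> + int N"
  have n: "\<lfloor>2 * y0\<rfloor> + int (Suc N) = n + 1" "\<lfloor>2 * y0\<rfloor> + 1 + int N = n + 1" by (simp_all add: n_def)
  have y: "of_int (n + 1) / 2 \<le> y" using Suc.prems unfolding n .
  have IH: "tri_relu y0 N y = tri_sign n * (1 - 4 * (y - of_int n / 2))"
    using Suc.IH y by (simp add: n_def)
  have r: "relu (y - of_int (n + 1) / 2) = y - of_int (n + 1) / 2" using y by (simp add: relu_def)
  have sg: "tri_sign (n + 1) = - tri_sign n" by (simp add: tri_sign_def)
  have "tri_relu y0 (Suc N) y = tri_relu y0 N y - 8 * tri_sign (n + 1) * relu (y - of_int (n + 1) / 2)"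
    unfolding tri_relu_def sum.lessThan_Suc n by simp
  also have "\<dots> = tri_sign (n + 1) * (1 - 4 * (y - of_int (n + 1) / 2))"
    unfolding IH r sg by (simp add: field_simps)
  finally show ?case unfolding n .
qed

text \<open>On the half-periods before the last one the newest ReLU vanishes; on the last one both
  sides are the line of that half-period.\<close>

lemma tri_eq_tri_relu:
  assumes "y0 \<le> y" "2 * y \<le> of_int \<lfloor>2 * y0\<rfloor> + 1 + real N"
  shows "tri y = tri_relu y0 N y"
  using assms(2)
proof (induction N)
  case 0
  then have "tri y = tri_sign \<lfloor>2 * y0\<rfloor> * (1 - 4 * (y - of_int \<lfloor>2 * y0\<rfloor> / 2))"
    unfolding tri_sign_def using assms(1) by (intro tri_on_interval) linarith+
  moreover have "of_int (\<lfloor>2 * y0\<rfloor> + int 0) / 2 \<le> y" using assms(1) by simp linarith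
  ultimately show ?case using tri_relu_affine[of y0 0 y] by simp
next
  case (Suc N)
  define n where "n = \<lfloor>2 * y0\<rfloor> + int (Suc N)"
  show ?case
  proof (cases "2 * y \<le> of_int n")
    case True
    then have "relu (y - of_int n / 2) = 0" by (simp add: relu_def)
    then have "tri_relu y0 (Suc N) y = tri_relu y0 N y" by (simp add: tri_relu_def n_def algebra_simps)
    then show ?thesis using Suc.IH True by (simp add: n_def)
  next
    case False
    then have "tri y = tri_sign n * (1 - 4 * (y - of_int n / 2))"
      unfolding tri_sign_def using Suc.prems by (intro tri_on_interval) (simp_all add: n_def)
    then show ?thesis using tri_relu_affine[of y0 "Suc N" y] False by (simp add: n_def)
  qed
qed

definition ridge :: "(nat \<Rightarrow> 'a::banach) \<Rightarrow> (nat \<Rightarrow>\<^sub>0 int) \<Rightarrow> 'a \<Rightarrow> real" where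
  "ridge \<Phi> k v = (\<Sum>i\<in>Poly_Mapping.keys k. of_int (Poly_Mapping.lookup k i) * coord \<Phi> v i)"

text \<open>A neuron is stored as outer weight, frequency and threshold. Its inner weights are
  always \<open>k / norm1 k\<close>, of l1-norm 1 for \<open>k \<noteq> 0\<close>, so networks are
  added by concatenating lists.\<close>

definition neuron :: "(nat \<Rightarrow> 'a::banach) \<Rightarrow> 'a \<Rightarrow> real \<times> (nat \<Rightarrow>\<^sub>0 int) \<times> real \<Rightarrow> real" where
  "neuron \<Phi> v = (\<lambda>(\<gamma>, k, t). \<gamma> * relu (ridge \<Phi> k v / norm1 k - t))"

lemma norm1_ge_1: "k \<noteq> 0 \<Longrightarrow> norm1 k \<ge> 1"
proof -
  assume "k \<noteq> 0"
  then obtain i where i: "i \<in> Poly_Mapping.keys k" by (metis keys_eq_empty ex_in_conv)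
  then have "1 \<le> \<bar>real_of_int (Poly_Mapping.lookup k i)\<bar>" by (simp add: in_keys_iff flip: of_int_abs)
  also have "\<dots> \<le> norm1 k" unfolding norm1_def using i by (intro member_le_sum) auto
  finally show ?thesis .
qed

lemma norm1_nat: "\<exists>n. norm1 k = real n"
proof -
  have "norm1 k = real (nat (\<Sum>i\<in>Poly_Mapping.keys k. \<bar>Poly_Mapping.lookup k i\<bar>))"
    by (simp add: norm1_def sum_nonneg)
  then show ?thesis by blast
qed

lemma abs_ridge_le:
  assumes "v \<in> L_bound \<Phi>"
  shows "\<bar>ridge \<Phi> k v\<bar> \<le> norm1 k / 2"
proof -
  have "\<bar>ridge \<Phi> k v\<bar> \<le> (\<Sum>i\<in>Poly_Mapping.keys k. \<bar>of_int (Poly_Mapping.lookup k i) * coord \<Phi> v i\<bar>)"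
    unfolding ridge_def by (rule sum_abs)
  also have "\<dots> \<le> (\<Sum>i\<in>Poly_Mapping.keys k. \<bar>of_int (Poly_Mapping.lookup k i)\<bar> * (1/2))"
  proof (intro sum_mono)
    fix i
    have "- 1/2 < coord \<Phi> v i" "coord \<Phi> v i < 1/2" using assms by (auto simp: L_bound_def)
    then have "\<bar>coord \<Phi> v i\<bar> \<le> 1/2" by linarith
    then show "\<bar>of_int (Poly_Mapping.lookup k i) * coord \<Phi> v i\<bar> \<le> \<bar>of_int (Poly_Mapping.lookup k i)\<bar> * (1/2)"
      unfolding abs_mult by (intro mult_left_mono) auto
  qed
  also have "\<dots> = norm1 k / 2" by (simp add: norm1_def sum_divide_distrib)
  finally show ?thesis .
qed

lemma relu_scale: "c \<ge> 0 \<Longrightarrow> relu (c * x) = c * relu x"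
  unfolding relu_def by (simp add: max_mult_distrib_left)

text \<open>A triangle wave of frequency \<open>k\<close> has \<open>2 * norm1 k\<close> kinks; one more neuron carries its initial slope.\<close>

lemma triangle_wave_network:
  assumes k: "k \<noteq> 0"
  shows "\<exists>c L. real (length L) = 2 * norm1 k + 1 \<and> \<bar>c\<bar> \<le> 1 \<and>
           (\<Sum>x\<leftarrow>L. \<bar>fst x\<bar>) \<le> 20 * (norm1 k)\<^sup>2 \<and>
           (\<forall>(\<gamma>, k', t)\<in>set L. k' = k \<and> \<bar>t\<bar> \<le> 1) \<and>
           (\<forall>v\<in>L_bound \<Phi>. tri (ridge \<Phi> k v - \<theta>) = c + (\<Sum>x\<leftarrow>L. neuron \<Phi> v x))"
proof -
  define K where "K = norm1 k"
  have K1: "K \<ge> 1" using norm1_ge_1[OF k] by (simp add: K_def)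
  obtain K' where K': "K = real K'" using norm1_nat[of k] by (auto simp: K_def)
  \<comment> \<open>A lower bound for \<open>ridge \<Phi> k v - \<theta>\<close> on
    \<open>L_bound \<Phi>\<close>; the values lie within distance \<open>K\<close> above it.\<close>
  define y0 where "y0 = - K / 2 - \<theta>"
  define n0 where "n0 = \<lfloor>2 * y0\<rfloor>"
  \<comment> \<open>The kinks of \<open>tri\<close> lie at multiples of 1/2; this is their position
    after undoing the shift by \<open>\<theta>\<close> and the scaling by \<open>K\<close>.\<close>
  define tt where "tt n = (of_int (n0 + 1 + int n) / 2 + \<theta>) / K" for n
  \<comment> \<open>With threshold \<open>- 1/2\<close> the leading neuron is active on all of
    \<open>L_bound \<Phi>\<close>, so it realizes a multiple of \<open>y - y0\<close>.\<close>
  define L where "L = (- 4 * tri_sign n0 * K, k, - 1/2) #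
    map (\<lambda>n. (- 8 * tri_sign (n0 + 1 + int n) * K, k, tt n)) [0..<2*K']"
  have sg: "\<bar>tri_sign n\<bar> = 1" for n by (simp add: tri_sign_def)
  have t: "\<bar>tt n\<bar> \<le> 1" if n: "n < 2*K'" for n
  proof -
    have f: "of_int n0 \<le> 2 * y0" "2 * y0 < of_int n0 + 1" unfolding n0_def by linarith+
    have "real n + 1 \<le> 2 * K" using n unfolding K' by simp
    then have "\<bar>of_int (n0 + 1 + int n) / 2 + \<theta>\<bar> \<le> K" using f K1 of_nat_0_le_iff[of n, where 'a = real] unfolding y0_def abs_le_iff
      by (auto simp: field_simps)
    then show ?thesis using K1 by (simp add: tt_def abs_divide)
  qed
  have "tri (ridge \<Phi> k v - \<theta>) = tri y0 + (\<Sum>x\<leftarrow>L. neuron \<Phi> v x)" if v: "v \<in> L_bound \<Phi>" for v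
  proof -
    define y where "y = ridge \<Phi> k v - \<theta>"
    have y: "y0 \<le> y" "y \<le> y0 + K" using abs_ridge_le[OF v, of k] unfolding y_def y0_def K_def by linarith+
    have "2 * y \<le> of_int n0 + 1 + real (2*K')" using y K' unfolding n0_def by simp linarith
    then have "tri y = tri_relu y0 (2*K') y"
      using y(1) unfolding n0_def by (intro tri_eq_tri_relu)
    also have "\<dots> = tri y0 + (\<Sum>x\<leftarrow>L. neuron \<Phi> v x)"
    proof -
      have "y - y0 = K * relu (ridge \<Phi> k v / K - (- 1/2))"
      proof -
        have "K * (ridge \<Phi> k v / K - (- 1/2)) = y - y0"
          using K1 by (simp add: y_def y0_def field_simps)
        then have "y - y0 = relu (K * (ridge \<Phi> k v / K - (- 1/2)))"
          using y(1) by (simp add: relu_def)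
        then show ?thesis using K1 by (simp only: relu_scale)
      qed
      moreover have "relu (y - of_int (n0 + 1 + int n) / 2) = K * relu (ridge \<Phi> k v / K - tt n)" for n
      proof -
        have "y - of_int (n0 + 1 + int n) / 2 = K * (ridge \<Phi> k v / K - tt n)"
          using K1 by (simp add: tt_def y_def field_simps)
        then show ?thesis using K1 by (simp only: relu_scale)
      qed
      ultimately show ?thesis
        unfolding tri_relu_def n0_def[symmetric] L_def neuron_def
        by (simp add: o_def interv_sum_list_conv_sum_set_nat atLeast0LessThan sum_negf K_def mult_ac)
    qed
    finally show ?thesis unfolding y_def .
  qed
  moreover have "(\<Sum>x\<leftarrow>L. \<bar>fst x\<bar>) \<le> 20 * K\<^sup>2"
  proof -
    \<comment> \<open>The factor 20 comes from here: an initial slope 4 and \<open>2 * K\<close>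
      slope changes of size 8, each multiplied by the scaling \<open>K\<close>, with
      \<open>K \<ge> 1\<close>.\<close>
    have "(\<Sum>x\<leftarrow>L. \<bar>fst x\<bar>) = 4 * K + 2 * K * (8 * K)"
      unfolding L_def using K1 sg by (simp add: o_def abs_mult interv_sum_list_conv_sum_set_nat K')
    also have "\<dots> \<le> 20 * K\<^sup>2" using K1 by (simp add: power2_eq_square)
    finally show ?thesis .
  qed
  moreover have "real (length L) = 2 * K + 1" by (simp add: L_def K')
  moreover have "\<forall>(\<gamma>, k', t)\<in>set L. k' = k \<and> \<bar>t\<bar> \<le> 1" using t by (auto simp: L_def)
  ultimately show ?thesis using tri_bound[of y0] unfolding K_def by blast
qed

subsection \<open>Sampling in a weighted sequence space\<close>

text \<open>Bias and variance separate: \<open>x i\<close> minus its mean has mean 0, so the cross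
  term with the fixed \<open>r\<close> vanishes.\<close>

lemma weighted_mean_variance_real:
  fixes x :: "'i \<Rightarrow> real"
  assumes "sum Q I = 1"
  shows "(\<Sum>i\<in>I. Q i * (r + x i - (\<Sum>i\<in>I. Q i * x i))\<^sup>2)
       = r\<^sup>2 + (\<Sum>i\<in>I. Q i * (x i)\<^sup>2) - (\<Sum>i\<in>I. Q i * x i)\<^sup>2"
proof -
  define \<mu> where "\<mu> = (\<Sum>i\<in>I. Q i * x i)"
  have "(\<Sum>i\<in>I. Q i * (r + x i - \<mu>)\<^sup>2)
      = (\<Sum>i\<in>I. Q i * (r - \<mu>)\<^sup>2 + 2 * (r - \<mu>) * (Q i * x i) + Q i * (x i)\<^sup>2)"
    by (intro sum.cong refl) (simp add: power2_eq_square algebra_simps)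
  also have "\<dots> = (r - \<mu>)\<^sup>2 + 2 * (r - \<mu>) * \<mu> + (\<Sum>i\<in>I. Q i * (x i)\<^sup>2)"
    unfolding sum.distrib sum_distrib_left[symmetric] sum_distrib_right[symmetric] assms \<mu>_def by simp
  also have "\<dots> = r\<^sup>2 + (\<Sum>i\<in>I. Q i * (x i)\<^sup>2) - \<mu>\<^sup>2"
    by (simp add: power2_eq_square algebra_simps)
  finally show ?thesis unfolding \<mu>_def .
qed

lemma weighted_mean_variance_complex:
  fixes x :: "'i \<Rightarrow> complex"
  assumes "sum Q I = 1"
  shows "(\<Sum>i\<in>I. Q i * (cmod (r + x i - (\<Sum>i\<in>I. of_real (Q i) * x i)))\<^sup>2)
       \<le> (cmod r)\<^sup>2 + (\<Sum>i\<in>I. Q i * (cmod (x i))\<^sup>2)"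
  using weighted_mean_variance_real[OF assms, of "Re r" "\<lambda>i. Re (x i)"]
    weighted_mean_variance_real[OF assms, of "Im r" "\<lambda>i. Im (x i)"]
    zero_le_power2[of "\<Sum>i\<in>I. Q i * Re (x i)"] zero_le_power2[of "\<Sum>i\<in>I. Q i * Im (x i)"]
  by (simp add: cmod_power2 distrib_left sum.distrib)

definition sq_summable :: "((nat \<Rightarrow>\<^sub>0 int) \<Rightarrow> complex) \<Rightarrow> bool" where
  "sq_summable u \<longleftrightarrow> (\<lambda>k. weight k * (cmod (u k))\<^sup>2) summable_on UNIV"

text \<open>The squared Hilbert norm on bare coefficient families, so that errors can be estimated
  before a functional with these coefficients is at hand. A family without a sum would get the value
  0; hence \<open>sq_summable\<close> is carried along.\<close>

definition sq_norm :: "((nat \<Rightarrow>\<^sub>0 int) \<Rightarrow> complex) \<Rightarrow> real" where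
  "sq_norm u = (\<Sum>\<^sub>\<infinity>k. weight k * (cmod (u k))\<^sup>2)"

lemma weight_ge_1: "weight k \<ge> 1"
  by (simp add: weight_def)

lemma sq_norm_nonneg: "sq_norm u \<ge> 0"
  unfolding sq_norm_def using weight_ge_1 by (intro infsum_nonneg mult_nonneg_nonneg) (auto intro: order_trans[of 0 1])

lemma sq_norm_mono:
  assumes "(g has_sum s) UNIV" "\<And>k. weight k * (cmod (u k))\<^sup>2 \<le> g k"
  shows "sq_summable u" "sq_norm u \<le> s"
proof -
  have g: "g summable_on UNIV" using assms(1) by (rule has_sum_imp_summable)
  show u: "sq_summable u" unfolding sq_summable_def
    by (rule summable_on_comparison_test[OF g])
       (use assms(2) weight_ge_1 in \<open>auto intro!: mult_nonneg_nonneg intro: order_trans[of 0 1]\<close>)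
  show "sq_norm u \<le> s"
    unfolding sq_norm_def infsumI[OF assms(1), symmetric]
    using u g assms(2) by (intro infsum_mono) (auto simp: sq_summable_def)
qed

lemma sq_summable_has_sum: "sq_summable u \<Longrightarrow> ((\<lambda>k. weight k * (cmod (u k))\<^sup>2) has_sum sq_norm u) UNIV"
  by (simp add: sq_summable_def sq_norm_def)

lemma has_sum_finite_sum:
  fixes f :: "'i \<Rightarrow> 'k \<Rightarrow> 'b::topological_comm_monoid_add"
  assumes "finite I" "\<And>i. i \<in> I \<Longrightarrow> (f i has_sum s i) A"
  shows "((\<lambda>k. \<Sum>i\<in>I. f i k) has_sum (\<Sum>i\<in>I. s i)) A"
  using assms by (induction rule: finite_induct) (auto intro: has_sum_add)

lemma has_sum_diff:
  fixes f g :: "'k \<Rightarrow> 'b::real_normed_algebra_1"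
  assumes "(f has_sum x) A" "(g has_sum y) A"
  shows "((\<lambda>k. f k - g k) has_sum (x - y)) A"
  using has_sum_add[OF assms(1) has_sum_cmult_right[OF assms(2), of "- 1"]] by simp

lemma norm_sum_squared_le:
  fixes x :: "'i \<Rightarrow> 'a::real_normed_vector"
  shows "(norm (\<Sum>i\<in>I. x i))\<^sup>2 \<le> card I * (\<Sum>i\<in>I. (norm (x i))\<^sup>2)"
proof -
  have "(norm (\<Sum>i\<in>I. x i))\<^sup>2 \<le> (\<Sum>i\<in>I. 1 * norm (x i))\<^sup>2"
    by (intro power_mono) (simp_all add: norm_sum)
  also have "\<dots> \<le> (\<Sum>i\<in>I. 1\<^sup>2) * (\<Sum>i\<in>I. (norm (x i))\<^sup>2)"
    by (rule Cauchy_Schwarz_ineq_sum)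
  finally show ?thesis by simp
qed

text \<open>Cauchy-Schwarz replaces the triangle inequality and costs the factor
  \<open>card I\<close>. The bound is applied to two summands, or to errors that can be made
  arbitrarily small.\<close>

lemma sq_norm_sum:
  assumes "finite I" "\<And>i. i \<in> I \<Longrightarrow> sq_summable (x i)"
  shows "sq_summable (\<lambda>k. \<Sum>i\<in>I. x i k)"
    and "sq_norm (\<lambda>k. \<Sum>i\<in>I. x i k) \<le> card I * (\<Sum>i\<in>I. sq_norm (x i))"
proof -
  have "((\<lambda>k. card I * (\<Sum>i\<in>I. weight k * (cmod (x i k))\<^sup>2)) has_sum card I * (\<Sum>i\<in>I. sq_norm (x i))) UNIV"
    using assms by (intro has_sum_cmult_right has_sum_finite_sum sq_summable_has_sum) auto
  moreover have "weight k * (cmod (\<Sum>i\<in>I. x i k))\<^sup>2 \<le> card I * (\<Sum>i\<in>I. weight k * (cmod (x i k))\<^sup>2)" for k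
    using mult_left_mono[OF norm_sum_squared_le[of "\<lambda>i. x i k" I], of "weight k"] weight_ge_1[of k]
    by (simp add: sum_distrib_left mult_ac)
  ultimately show "sq_summable (\<lambda>k. \<Sum>i\<in>I. x i k)"
    "sq_norm (\<lambda>k. \<Sum>i\<in>I. x i k) \<le> card I * (\<Sum>i\<in>I. sq_norm (x i))"
    by (rule sq_norm_mono)+
qed

lemma sq_norm_scale:
  assumes "sq_summable u"
  shows "sq_summable (\<lambda>k. c * u k)" "sq_norm (\<lambda>k. c * u k) = (cmod c)\<^sup>2 * sq_norm u"
proof -
  have "((\<lambda>k. (cmod c)\<^sup>2 * (weight k * (cmod (u k))\<^sup>2)) has_sum ((cmod c)\<^sup>2 * sq_norm u)) UNIV"
    by (intro has_sum_cmult_right sq_summable_has_sum assms)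
  then have h: "((\<lambda>k. weight k * (cmod (c * u k))\<^sup>2) has_sum ((cmod c)\<^sup>2 * sq_norm u)) UNIV"
    by (simp add: norm_mult power_mult_distrib mult_ac)
  then show "sq_summable (\<lambda>k. c * u k)" "sq_norm (\<lambda>k. c * u k) = (cmod c)\<^sup>2 * sq_norm u"
    unfolding sq_summable_def sq_norm_def by (auto simp: has_sum_imp_summable infsumI)
qed

lemma sq_norm_add:
  assumes "sq_summable u" "sq_summable v"
  shows "sq_summable (\<lambda>k. u k + v k)"
  using sq_norm_sum(1)[of "{True, False}" "\<lambda>b. if b then u else v"] assms by simp

lemma exists_le_weighted_mean:
  fixes v :: "'i \<Rightarrow> real"
  assumes "\<And>i. i \<in> I \<Longrightarrow> Q i \<ge> 0" "sum Q I = 1" "(\<Sum>i\<in>I. Q i * v i) \<le> B"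
  shows "\<exists>i\<in>I. v i \<le> B"
proof (rule ccontr)
  assume "\<not> ?thesis"
  then have v: "\<And>i. i \<in> I \<Longrightarrow> v i > B" by auto
  have fin: "finite I" using assms(2) by (metis sum.infinite zero_neq_one)
  obtain i where i: "i \<in> I" "Q i > 0"
    using assms(1,2) by (metis less_eq_real_def sum.neutral zero_neq_one)
  have "(\<Sum>i\<in>I. Q i * B) < (\<Sum>i\<in>I. Q i * v i)"
    using fin i v assms(1) by (intro sum_strict_mono_ex1) (auto intro!: mult_left_mono bexI[of _ i] intro: less_imp_le)
  then show False using assms(2,3) by (simp flip: sum_distrib_right)
qed

text \<open>
  Maurey's sampling lemma, derandomized: each new sample is chosen such that the squared error plus
  the accumulated penalty grows by no more than its mean.
\<close>

lemma maurey_penalized: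
  fixes X :: "'i \<Rightarrow> (nat \<Rightarrow>\<^sub>0 int) \<Rightarrow> complex" and pen :: "'i \<Rightarrow> real"
  assumes Q: "\<And>i. i \<in> I \<Longrightarrow> Q i \<ge> 0" "sum Q I = 1"
    and X: "\<And>i. i \<in> I \<Longrightarrow> sq_summable (X i)"
    and V: "(\<Sum>i\<in>I. Q i * sq_norm (X i)) \<le> V"
    and p: "(\<Sum>i\<in>I. Q i * pen i) \<le> p"
    and A: "A \<ge> 0"
  defines "\<mu> \<equiv> \<lambda>k. \<Sum>i\<in>I. of_real (Q i) * X i k"
  shows "\<exists>s. (\<forall>n<N. s n \<in> I) \<and>
           A * sq_norm (\<lambda>k. (\<Sum>n<N. X (s n) k) - of_nat N * \<mu> k) + (\<Sum>n<N. pen (s n))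
           \<le> real N * (A * V + p)"
proof (induction N)
  case 0
  then show ?case by (simp add: sq_norm_def)
next
  case (Suc N)
  then obtain s where s: "\<And>n. n < N \<Longrightarrow> s n \<in> I" and
    IH: "A * sq_norm (\<lambda>k. (\<Sum>n<N. X (s n) k) - of_nat N * \<mu> k) + (\<Sum>n<N. pen (s n)) \<le> real N * (A * V + p)"
    by blast
  have fin: "finite I" using Q(2) by (metis sum.infinite zero_neq_one)
  \<comment> \<open>The error is left unnormalized, a sum minus \<open>N\<close> times the mean, so
    that a new sample only adds \<open>X i - \<mu>\<close>.\<close>
  define R where "R k = (\<Sum>n<N. X (s n) k) - of_nat N * \<mu> k" for k
  have s\<mu>: "sq_summable \<mu>" unfolding \<mu>_def
    using X fin by (intro sq_norm_sum sq_norm_scale)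
  have sm: "sq_summable (\<lambda>k. - c * \<mu> k)" for c by (rule sq_norm_scale(1)[OF s\<mu>])
  have sR: "sq_summable R"
    using sq_norm_add[OF sq_norm_sum(1)[of "{..<N}" "\<lambda>n. X (s n)"] sm[of "of_nat N"]] s X
    by (simp add: R_def[abs_def])
  define Y where "Y i k = R k + X i k - \<mu> k" for i k
  have sY: "sq_summable (Y i)" if "i \<in> I" for i
    using sq_norm_add[OF sq_norm_add[OF sR X[OF that]] sm[of 1]] by (simp add: Y_def[abs_def])
  \<comment> \<open>The variance estimate is applied to each coefficient and then summed with the
    weights.\<close>
  have "(\<Sum>i\<in>I. Q i * sq_norm (Y i)) \<le> sq_norm R + (\<Sum>i\<in>I. Q i * sq_norm (X i))"
  proof (rule has_sum_mono)
    show "((\<lambda>k. \<Sum>i\<in>I. Q i * (weight k * (cmod (Y i k))\<^sup>2)) has_sum (\<Sum>i\<in>I. Q i * sq_norm (Y i))) UNIV"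
      by (intro has_sum_finite_sum has_sum_cmult_right sq_summable_has_sum sY fin)
    show "((\<lambda>k. weight k * (cmod (R k))\<^sup>2 + (\<Sum>i\<in>I. Q i * (weight k * (cmod (X i k))\<^sup>2)))
        has_sum (sq_norm R + (\<Sum>i\<in>I. Q i * sq_norm (X i)))) UNIV"
      by (intro has_sum_finite_sum has_sum_add has_sum_cmult_right sq_summable_has_sum sR X fin)
    show "(\<Sum>i\<in>I. Q i * (weight k * (cmod (Y i k))\<^sup>2)) \<le>
        weight k * (cmod (R k))\<^sup>2 + (\<Sum>i\<in>I. Q i * (weight k * (cmod (X i k))\<^sup>2))" for k
      using mult_left_mono[OF weighted_mean_variance_complex[OF Q(2), of "R k" "\<lambda>i. X i k"], of "weight k"] weight_ge_1[of k]
      by (simp add: Y_def \<mu>_def sum_distrib_left distrib_left mult_ac)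
  qed
  then have "(\<Sum>i\<in>I. Q i * sq_norm (Y i)) \<le> sq_norm R + V" using V by linarith
  then have "A * (\<Sum>i\<in>I. Q i * sq_norm (Y i)) + (\<Sum>i\<in>I. Q i * pen i) \<le> A * (sq_norm R + V) + p"
    using p A by (intro add_mono mult_left_mono)
  then have "(\<Sum>i\<in>I. Q i * (A * sq_norm (Y i) + pen i)) \<le> A * (sq_norm R + V) + p"
    by (simp add: distrib_left sum.distrib sum_distrib_left mult_ac)
  from exists_le_weighted_mean[OF Q this] obtain i where
    i: "i \<in> I" "A * sq_norm (Y i) + pen i \<le> A * (sq_norm R + V) + p" by auto
  let ?s = "s(N := i)"
  have "(\<lambda>k. (\<Sum>n<Suc N. X (?s n) k) - of_nat (Suc N) * \<mu> k) = Y i"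
    by (auto simp: fun_eq_iff Y_def R_def algebra_simps)
  moreover have "(\<Sum>n<Suc N. pen (?s n)) = (\<Sum>n<N. pen (s n)) + pen i" by simp
  moreover have "sq_norm R = sq_norm (\<lambda>k. (\<Sum>n<N. X (s n) k) - of_nat N * \<mu> k)"
    by (simp add: R_def[abs_def])
  ultimately have "A * sq_norm (\<lambda>k. (\<Sum>n<Suc N. X (?s n) k) - of_nat (Suc N) * \<mu> k) + (\<Sum>n<Suc N. pen (?s n))
      \<le> real (Suc N) * (A * V + p)"
    using i(2) IH by (simp add: algebra_simps)
  moreover have "\<forall>n<Suc N. ?s n \<in> I" using s i(1) by (auto simp: less_Suc_eq)
  ultimately show ?case by blast
qed

subsection \<open>Decompositions into indivisible terms\<close>

lemma has_sum_bounded_integral: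
  fixes a :: "'k \<Rightarrow> complex" and u :: "'k \<Rightarrow> 'b \<Rightarrow> complex"
  assumes A: "A \<in> sets M" "emeasure M A < \<infinity>"
    and u: "\<And>k. u k \<in> borel_measurable M" "\<And>k b. b \<in> A \<Longrightarrow> cmod (u k b) \<le> C"
    and a: "(\<lambda>k. cmod (a k)) summable_on UNIV"
    and G: "\<And>b. b \<in> A \<Longrightarrow> ((\<lambda>k. a k * u k b) has_sum G b) UNIV"
  shows "set_integrable M A G"
    and "((\<lambda>k. a k * (LINT b:A|M. u k b)) has_sum (LINT b:A|M. G b)) UNIV"
proof -
  \<comment> \<open>What remains of the absolute sum outside \<open>Y\<close>, times
    \<open>C\<close>, bounds the error of the partial sum over \<open>Y\<close> uniformly on
    \<open>A\<close>. On a set of finite measure such a bound allows sum and integral to be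
    exchanged.\<close>
  define tail where "tail Y = (\<Sum>\<^sub>\<infinity>k. cmod (a k)) - (\<Sum>k\<in>Y. cmod (a k))" for Y
  have tail: "cmod (G b - (\<Sum>k\<in>Y. a k * u k b)) \<le> C * tail Y" if Y: "finite Y" and b: "b \<in> A" for Y b
  proof -
    have h: "((\<lambda>k. C * cmod (a k)) has_sum (C * (\<Sum>\<^sub>\<infinity>k. cmod (a k)))) UNIV"
      using a by (intro has_sum_cmult_right) auto
    have 1: "((\<lambda>k. C * cmod (a k)) has_sum (C * (\<Sum>\<^sub>\<infinity>k. cmod (a k)) - (\<Sum>k\<in>Y. C * cmod (a k)))) (UNIV - Y)"
      by (rule has_sum_Diff[OF h has_sum_finite[OF Y]]) simp
    have 2: "((\<lambda>k. a k * u k b) has_sum (G b - (\<Sum>k\<in>Y. a k * u k b))) (UNIV - Y)"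
      by (rule has_sum_Diff[OF G[OF b] has_sum_finite[OF Y]]) simp
    have 3: "cmod (a k * u k b) \<le> C * cmod (a k)" for k
      using mult_left_mono[OF u(2)[OF b, of k], of "cmod (a k)"] by (simp add: norm_mult mult_ac)
    have "cmod (G b - (\<Sum>k\<in>Y. a k * u k b)) \<le> C * (\<Sum>\<^sub>\<infinity>k. cmod (a k)) - (\<Sum>k\<in>Y. C * cmod (a k))"
      by (rule norm_infsum_le[OF 2 1 3])
    then show ?thesis by (simp add: tail_def algebra_simps sum_distrib_left)
  qed
  have tail0: "(tail \<longlongrightarrow> 0) (finite_subsets_at_top UNIV)"
  proof -
    have "((\<lambda>Y. \<Sum>k\<in>Y. cmod (a k)) \<longlongrightarrow> (\<Sum>\<^sub>\<infinity>k. cmod (a k))) (finite_subsets_at_top UNIV)"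
      using has_sum_infsum[OF a] by (simp only: has_sum_def)
    from tendsto_diff[OF tendsto_const[of "\<Sum>\<^sub>\<infinity>k. cmod (a k)"] this] show ?thesis by (simp add: tail_def[abs_def])
  qed
  have fs: "\<forall>\<^sub>F Y in finite_subsets_at_top UNIV. finite Y"
    by (simp add: eventually_finite_subsets_at_top_weakI)
  have iu: "set_integrable M A (u k)" for k
    unfolding set_integrable_def using A u
    by (intro integrableI_bounded_set_indicator[where B = C]) auto
  have isum: "set_integrable M A (\<lambda>b. \<Sum>k\<in>Y. a k * u k b)" if "finite Y" for Y
    unfolding set_integrable_def scaleR_sum_right
    using set_integrable_mult_right[OF iu] by (intro Bochner_Integration.integrable_sum) (auto simp: set_integrable_def)
  have meas: "(\<lambda>b. indicat_real A b *\<^sub>R G b) \<in> borel_measurable M"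
  proof -
    \<comment> \<open>The sum is a limit along the filter of finite sets, whereas measurability is
      transferred along sequences; hence a sequence of finite sets with vanishing tails.\<close>
    have "\<exists>Y. finite Y \<and> \<bar>tail Y\<bar> < 1 / real (Suc n)" for n
    proof -
      have "\<forall>\<^sub>F Y in finite_subsets_at_top UNIV. \<bar>tail Y\<bar> < 1 / real (Suc n)"
        using tendstoD[OF tail0, of "1 / real (Suc n)"] by (simp add: dist_real_def)
      then have "\<forall>\<^sub>F Y in finite_subsets_at_top UNIV. finite Y \<and> \<bar>tail Y\<bar> < 1 / real (Suc n)"
        using fs by eventually_elim auto
      then show ?thesis using eventually_happens'[OF finite_subsets_at_top_neq_bot] by blast
    qed
    then obtain Y where Y: "\<And>n. finite (Y n)" "\<And>n. \<bar>tail (Y n)\<bar> < 1 / real (Suc n)" by metis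
    have t: "(\<lambda>n. tail (Y n)) \<longlonglongrightarrow> 0"
      by (rule Lim_null_comparison[OF _ LIMSEQ_inverse_real_of_nat])
         (use Y(2) in \<open>auto intro!: always_eventually less_imp_le simp: divide_inverse\<close>)
    show ?thesis
    proof (rule borel_measurable_LIMSEQ_metric)
      show "(\<lambda>b. indicat_real A b *\<^sub>R (\<Sum>k\<in>Y n. a k * u k b)) \<in> borel_measurable M" for n
        using A u by measurable
      show "(\<lambda>n. indicat_real A b *\<^sub>R (\<Sum>k\<in>Y n. a k * u k b)) \<longlonglongrightarrow> indicat_real A b *\<^sub>R G b" for b
      proof (cases "b \<in> A")
        case True
        have "(\<lambda>n. C * tail (Y n)) \<longlonglongrightarrow> 0" using tendsto_mult_right_zero[OF t] by simp
        then have "(\<lambda>n. G b - (\<Sum>k\<in>Y n. a k * u k b)) \<longlonglongrightarrow> 0"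
          by (rule Lim_null_comparison[rotated]) (use tail Y(1) True in auto)
        from tendsto_diff[OF tendsto_const[of "G b"] this] show ?thesis using True by simp
      qed simp
    qed
  qed
  show iG: "set_integrable M A G"
    unfolding set_integrable_def
  proof (rule integrableI_bounded_set[where A = A and B = "C * tail {}"])
    show "AE b in M. b \<in> A \<longrightarrow> norm (indicat_real A b *\<^sub>R G b) \<le> C * tail {}"
      using tail[of "{}"] by auto
  qed (use A meas in auto)
  have "((\<lambda>Y. (LINT b:A|M. G b) - (\<Sum>k\<in>Y. a k * (LINT b:A|M. u k b))) \<longlongrightarrow> 0) (finite_subsets_at_top UNIV)"
  proof (rule Lim_null_comparison)
    show "((\<lambda>Y. C * tail Y * measure M A) \<longlongrightarrow> 0) (finite_subsets_at_top UNIV)"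
      using tendsto_mult_left_zero[OF tendsto_mult_right_zero[OF tail0]] by simp
    show "\<forall>\<^sub>F Y in finite_subsets_at_top UNIV.
        norm ((LINT b:A|M. G b) - (\<Sum>k\<in>Y. a k * (LINT b:A|M. u k b))) \<le> C * tail Y * measure M A"
      using fs
    proof eventually_elim
      case (elim Y)
      have "(\<Sum>k\<in>Y. a k * (LINT b:A|M. u k b)) = (LINT b:A|M. (\<Sum>k\<in>Y. a k * u k b))"
        using set_integrable_mult_right[OF iu]
        unfolding set_lebesgue_integral_def scaleR_sum_right set_integrable_def
        by (subst Bochner_Integration.integral_sum) (auto simp flip: set_lebesgue_integral_def)
      then have "(LINT b:A|M. G b) - (\<Sum>k\<in>Y. a k * (LINT b:A|M. u k b)) = (LINT b:A|M. G b - (\<Sum>k\<in>Y. a k * u k b))"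
        using iG isum[OF elim] by simp
      also have "norm \<dots> \<le> (LINT b:A|M. norm (G b - (\<Sum>k\<in>Y. a k * u k b)))"
        using iG isum[OF elim] by (intro set_integral_norm_bound set_integral_diff)
      also have "\<dots> \<le> (LINT b:A|M. C * tail Y)"
        using iG isum[OF elim] tail[OF elim] A
        by (intro set_integral_mono set_integrable_norm set_integral_diff) (auto simp: set_integrable_def)
      also have "\<dots> = C * tail Y * measure M A"
        using A by (simp add: set_lebesgue_integral_def less_top mult_ac)
      finally show ?case .
    qed
  qed
  from tendsto_diff[OF tendsto_const[of "LINT b:A|M. G b"] this]
  show "((\<lambda>k. a k * (LINT b:A|M. u k b)) has_sum (LINT b:A|M. G b)) UNIV"
    unfolding has_sum_def by simp
qed

lemma borel_measurable_cis [measurable (raw)]: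
  "f \<in> borel_measurable M \<Longrightarrow> (\<lambda>x. cis (f x)) \<in> borel_measurable M"
  by (rule measurable_compose[OF _ borel_measurable_continuous_onI[of cis]]) (auto intro: continuous_on_cis continuous_on_id)

lemma integral_cis_unit_interval:
  "(LINT x:{- 1/2 <..< 1/2 :: real}|lborel. cis (2 * pi * of_int n * x)) = (if n = 0 then 1 else 0)"
proof (cases "n = 0")
  case True
  then show ?thesis by (simp add: set_lebesgue_integral_def)
next
  case False
  define c where "c = 2 * pi * of_int n"
  have c: "c \<noteq> 0" using False by (simp add: c_def)
  define F where "F x = cis (c * x) / (\<i> * of_real c)" for x
  have "(LBINT x=ereal (- 1/2)..ereal (1/2). cis (c * x)) = F (1/2) - F (- 1/2)"
  proof (rule interval_integral_FTC_finite)
    show "(F has_vector_derivative cis (c * x)) (at x within {min (- 1/2) (1/2)..max (- 1/2) (1/2)})" for x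
      unfolding F_def using c
      by (auto intro!: derivative_eq_intros simp: has_vector_derivative_def scaleR_conv_of_real fun_eq_iff mult_ac)
  qed (intro continuous_intros)
  moreover have "F (1/2) = F (- 1/2)"
  proof -
    have "cis (c * (1/2)) = cis (c * (- 1/2))"
      unfolding c_def using cis_integer_pi[of n] cis_integer_pi[of "- n"] by (simp add: mult_ac)
    then show ?thesis by (simp add: F_def)
  qed
  ultimately have "(LBINT x=ereal (- 1/2)..ereal (1/2). cis (c * x)) = 0" by simp
  then show ?thesis using False
    by (simp add: interval_lebesgue_integral_def c_def)
qed

lemma cube_measurable: "finite D \<Longrightarrow> cube D \<in> sets (\<Pi>\<^sub>M i\<in>D. lborel)"
  unfolding cube_def by (intro sets_PiM_I_finite) auto

lemma leb_cube: "finite D \<Longrightarrow> cube D \<in> sets (leb D)" "finite D \<Longrightarrow> emeasure (leb D) (cube D) < \<infinity>"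
proof -
  interpret product_sigma_finite "\<lambda>_::nat. lborel :: real measure" by standard
  assume D: "finite D"
  show "cube D \<in> sets (leb D)" unfolding leb_def using cube_measurable[OF D] by simp
  have "emeasure (leb D) (cube D) = emeasure (\<Pi>\<^sub>M i\<in>D. lborel) (cube D)"
    unfolding leb_def using cube_measurable[OF D] by simp
  also have "\<dots> = (\<Prod>i\<in>D. emeasure lborel {- 1/2 <..< 1/2 :: real})"
    unfolding cube_def by (rule emeasure_PiM) (use D in auto)
  finally show "emeasure (leb D) (cube D) < \<infinity>" by simp
qed

lemma character_measurable:
  "finite D \<Longrightarrow> (\<lambda>b. \<Prod>i\<in>D. cis (2 * pi * of_int (p i) * b i)) \<in> borel_measurable (leb D)"
  unfolding leb_def by (intro measurable_completion borel_measurable_prod) measurable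

text \<open>The integrand is Borel measurable, so the completion in \<open>leb\<close> does not
  change its integral, and Fubini reduces it to one coordinate at a time.\<close>

lemma integral_character_cube:
  assumes D: "finite D"
  shows "(LINT b:cube D|leb D. (\<Prod>i\<in>D. cis (2 * pi * of_int (p i) * b i)))
       = (if \<forall>i\<in>D. p i = 0 then 1 else 0)"
proof -
  interpret product_sigma_finite "\<lambda>_::nat. lborel :: real measure" by standard
  define f where "f i x = indicat_real {- 1/2 <..< 1/2} x *\<^sub>R cis (2 * pi * of_int (p i) * x)" for i x
  have m: "(\<lambda>b. indicat_real (cube D) b *\<^sub>R (\<Prod>i\<in>D. cis (2 * pi * of_int (p i) * b i))) \<in> borel_measurable (\<Pi>\<^sub>M i\<in>D. lborel)"
    using cube_measurable[OF D] by measurable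
  have "(LINT b:cube D|leb D. (\<Prod>i\<in>D. cis (2 * pi * of_int (p i) * b i)))
      = (LINT b|(\<Pi>\<^sub>M i\<in>D. lborel). indicat_real (cube D) b *\<^sub>R (\<Prod>i\<in>D. cis (2 * pi * of_int (p i) * b i)))"
    unfolding set_lebesgue_integral_def leb_def by (rule integral_completion[OF m])
  also have "\<dots> = (LINT b|(\<Pi>\<^sub>M i\<in>D. lborel). (\<Prod>i\<in>D. f i (b i)))"
  proof (rule Bochner_Integration.integral_cong[OF refl])
    fix b :: "nat \<Rightarrow> real" assume "b \<in> space (\<Pi>\<^sub>M i\<in>D. lborel)"
    \<comment> \<open>\<open>cube D\<close> consists of extensional functions, so the factorization
      of its indicator needs a point of the product space.\<close>
    then have "b \<in> extensional D" by (auto simp: space_PiM PiE_def)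
    then have "indicat_real (cube D) b = (\<Prod>i\<in>D. indicat_real {- 1/2 <..< 1/2} (b i))"
      using D by (cases "b \<in> cube D") (auto simp: cube_def indicator_def PiE_def Pi_def prod_zero_iff intro!: prod.neutral[symmetric])
    then show "indicat_real (cube D) b *\<^sub>R (\<Prod>i\<in>D. cis (2 * pi * of_int (p i) * b i)) = (\<Prod>i\<in>D. f i (b i))"
      by (simp add: f_def scaleR_conv_of_real prod.distrib)
  qed
  also have "\<dots> = (\<Prod>i\<in>D. integral\<^sup>L lborel (f i))"
  proof (rule product_integral_prod[OF D])
    show "integrable lborel (f i)" for i
      unfolding f_def by (rule integrableI_bounded_set_indicator[where B = 1]) auto
  qed
  also have "\<dots> = (\<Prod>i\<in>D. if p i = 0 then 1 else 0)"
    unfolding f_def using integral_cis_unit_interval by (simp add: set_lebesgue_integral_def)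
  also have "\<dots> = (if \<forall>i\<in>D. p i = 0 then 1 else 0)" using D by (auto simp: prod_zero_iff)
  finally show ?thesis .
qed

text \<open>The half of \<open>fourier_expansion\<close> that does not mention decompositions. It
  can be stated for a difference or for a single term whose decomposition is not yet known.\<close>

definition fourier_rep ::
  "(nat \<Rightarrow> 'a::banach) \<Rightarrow> ('a \<Rightarrow> real) \<Rightarrow> ((nat \<Rightarrow>\<^sub>0 int) \<Rightarrow> complex) \<Rightarrow> bool" where
  "fourier_rep \<Phi> g a \<longleftrightarrow>
     (\<forall>v\<in>L_bound \<Phi>. ((\<lambda>k. a k * fourier_basis \<Phi> k v) has_sum of_real (g v)) UNIV)"

section \<open>Characters under restriction to finitely many coordinates\<close>

lemma fourier_basis_cis: "fourier_basis \<Phi> k v = cis (2 * pi * ridge \<Phi> k v)"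
  unfolding fourier_basis_def ridge_def cis_conv_exp
  by (simp add: sum_distrib_left mult_ac)

lemma coord_restrict:
  assumes "schauder_basis \<Phi>" "finite D"
  shows "coord \<Phi> (restrict_to \<Phi> D v) = (\<lambda>i. if i \<in> D then coord \<Phi> v i else 0)"
  unfolding restrict_to_def by (rule coord_sum[OF assms])

lemma restrict_in_L_bound:
  assumes "schauder_basis \<Phi>" "finite D" "v \<in> L_bound \<Phi>"
  shows "restrict_to \<Phi> D v \<in> L_bound \<Phi>"
  using assms(3) unfolding L_bound_def mem_Collect_eq coord_restrict[OF assms(1,2)] by simp

lemma restrict_restrict:
  assumes "schauder_basis \<Phi>" "finite D" "finite T"
  shows "restrict_to \<Phi> D (restrict_to \<Phi> T v) = restrict_to \<Phi> (D \<inter> T) v"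
proof -
  have "restrict_to \<Phi> D (restrict_to \<Phi> T v) = (\<Sum>i\<in>D. if i \<in> T then coord \<Phi> v i *\<^sub>R \<Phi> i else 0)"
    unfolding restrict_to_def[of _ D] coord_restrict[OF assms(1,3)] by (intro sum.cong) auto
  then show ?thesis using assms(2) by (simp add: sum.inter_restrict restrict_to_def)
qed

lemma ridge_restrict:
  assumes "schauder_basis \<Phi>" "finite T"
  shows "ridge \<Phi> k (restrict_to \<Phi> T v) = (\<Sum>i\<in>T. of_int (Poly_Mapping.lookup k i) * coord \<Phi> v i)"
proof -
  have "ridge \<Phi> k (restrict_to \<Phi> T v) = (\<Sum>i\<in>Poly_Mapping.keys k. if i \<in> T then of_int (Poly_Mapping.lookup k i) * coord \<Phi> v i else 0)"
    unfolding ridge_def coord_restrict[OF assms] by (intro sum.cong) auto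
  also have "\<dots> = (\<Sum>i\<in>Poly_Mapping.keys k \<inter> T. of_int (Poly_Mapping.lookup k i) * coord \<Phi> v i)"
    by (simp add: sum.inter_restrict)
  also have "\<dots> = (\<Sum>i\<in>T. of_int (Poly_Mapping.lookup k i) * coord \<Phi> v i)"
    using assms(2) by (intro sum.mono_neutral_left) (auto simp: in_keys_iff)
  finally show ?thesis .
qed

lemma ridge_restrict_keys:
  assumes "schauder_basis \<Phi>" "finite T" "Poly_Mapping.keys k \<subseteq> T"
  shows "ridge \<Phi> k (restrict_to \<Phi> T v) = ridge \<Phi> k v"
  unfolding ridge_def coord_restrict[OF assms(1,2)] using assms(3) by (intro sum.cong) auto

section \<open>Mixed differences and divisibility\<close>

text \<open>
  The mixed difference of a functional in the directions \<open>S\<close>, anchored at the origin. It vanishes for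
  functionals that ignore one of these directions, and it detects indivisibility.
\<close>

definition mixed_diff :: "(nat \<Rightarrow> 'a::banach) \<Rightarrow> nat set \<Rightarrow> ('a \<Rightarrow> 'b::comm_ring_1) \<Rightarrow> 'a \<Rightarrow> 'b" where
  "mixed_diff \<Phi> S h v = (\<Sum>T\<in>Pow S. (- 1) ^ card T * h (restrict_to \<Phi> T v))"

text \<open>The terms for \<open>T\<close> and \<open>insert i T\<close> cancel in pairs.\<close>

lemma mixed_diff_eq_0:
  assumes "finite S" "i \<in> S"
    and "\<And>T. T \<subseteq> S \<Longrightarrow> i \<notin> T \<Longrightarrow> h (restrict_to \<Phi> (insert i T) v) = h (restrict_to \<Phi> T v)"
  shows "mixed_diff \<Phi> S h v = 0"
proof -
  define S' where "S' = S - {i}"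
  have S: "S = insert i S'" "i \<notin> S'" "finite S'" using assms(1,2) by (auto simp: S'_def)
  have inj: "inj_on (insert i) (Pow S')" using S(2) by (auto simp: inj_on_def)
  have "mixed_diff \<Phi> S h v = (\<Sum>T\<in>Pow S'. (- 1) ^ card T * h (restrict_to \<Phi> T v))
      + (\<Sum>T\<in>Pow S'. (- 1) ^ card (insert i T) * h (restrict_to \<Phi> (insert i T) v))"
    unfolding mixed_diff_def S(1) Pow_insert using S(2,3) inj
    by (subst sum.union_disjoint) (auto simp: sum.reindex)
  also have "(\<Sum>T\<in>Pow S'. (- 1) ^ card (insert i T) * h (restrict_to \<Phi> (insert i T) v))
      = (\<Sum>T\<in>Pow S'. - ((- 1) ^ card T * h (restrict_to \<Phi> T v)))"
  proof (intro sum.cong refl)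
    fix T assume "T \<in> Pow S'"
    then have T: "T \<subseteq> S" "i \<notin> T" "finite T" using S by (auto intro: finite_subset)
    then show "(- 1) ^ card (insert i T) * h (restrict_to \<Phi> (insert i T) v) = - ((- 1) ^ card T * h (restrict_to \<Phi> T v))"
      using assms(3)[of T] by simp
  qed
  finally show ?thesis by (simp add: sum_negf)
qed

lemma mixed_diff_restrict:
  assumes "schauder_basis \<Phi>" "finite S" "finite D" "\<not> S \<subseteq> D"
  shows "mixed_diff \<Phi> S (\<lambda>u. h (restrict_to \<Phi> D u)) v = 0"
proof -
  obtain i where i: "i \<in> S" "i \<notin> D" using assms(4) by auto
  show ?thesis
  proof (rule mixed_diff_eq_0[OF assms(2) i(1)])
    fix T assume "T \<subseteq> S" "i \<notin> T"
    then have "finite T" using assms(2) by (auto intro: finite_subset)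
    then show "h (restrict_to \<Phi> D (restrict_to \<Phi> (insert i T) v)) = h (restrict_to \<Phi> D (restrict_to \<Phi> T v))"
      using i by (simp add: restrict_restrict assms)
  qed
qed

lemma mixed_diff_fourier_basis:
  assumes "schauder_basis \<Phi>" "finite S" "\<not> S \<subseteq> Poly_Mapping.keys k"
  shows "mixed_diff \<Phi> S (fourier_basis \<Phi> k) v = 0"
proof -
  obtain i where i: "i \<in> S" "i \<notin> Poly_Mapping.keys k" using assms(3) by auto
  show ?thesis
  proof (rule mixed_diff_eq_0[OF assms(2) i(1)])
    fix T assume T: "T \<subseteq> S" "i \<notin> T"
    then have "finite T" using assms(2) by (auto intro: finite_subset)
    then show "fourier_basis \<Phi> k (restrict_to \<Phi> (insert i T) v) = fourier_basis \<Phi> k (restrict_to \<Phi> T v)"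
      using i T by (simp add: fourier_basis_cis ridge_restrict assms in_keys_iff)
  qed
qed

lemma mixed_diff_decomp:
  assumes "schauder_basis \<Phi>" "finite S" "v \<in> L_bound \<Phi>" "finite_dim_decomp \<Phi> g D F"
  shows "(\<lambda>j. mixed_diff \<Phi> S (\<lambda>u. F j (restrict_to \<Phi> (D j) u)) v) sums mixed_diff \<Phi> S g v"
  unfolding mixed_diff_def
proof (intro sums_sum sums_mult)
  fix T assume "T \<in> Pow S"
  then have "restrict_to \<Phi> T v \<in> L_bound \<Phi>"
    using assms by (intro restrict_in_L_bound) (auto intro: finite_subset)
  then show "(\<lambda>j. F j (restrict_to \<Phi> (D j) (restrict_to \<Phi> T v))) sums g (restrict_to \<Phi> T v)"
    using assms(4) by (auto simp: finite_dim_decomp_def)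
qed

lemma mixed_diff_fourier_rep:
  assumes "schauder_basis \<Phi>" "finite S" "v \<in> L_bound \<Phi>" "fourier_rep \<Phi> g a"
  shows "((\<lambda>k. a k * mixed_diff \<Phi> S (fourier_basis \<Phi> k) v) has_sum of_real (mixed_diff \<Phi> S g v)) UNIV"
proof -
  have "((\<lambda>k. \<Sum>T\<in>Pow S. (- 1) ^ card T * (a k * fourier_basis \<Phi> k (restrict_to \<Phi> T v))) has_sum
      (\<Sum>T\<in>Pow S. (- 1) ^ card T * of_real (g (restrict_to \<Phi> T v)))) UNIV"
  proof (intro has_sum_finite_sum has_sum_cmult_right)
    fix T assume "T \<in> Pow S"
    then have "restrict_to \<Phi> T v \<in> L_bound \<Phi>"
      using assms by (intro restrict_in_L_bound) (auto intro: finite_subset)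
    then show "((\<lambda>k. a k * fourier_basis \<Phi> k (restrict_to \<Phi> T v)) has_sum of_real (g (restrict_to \<Phi> T v))) UNIV"
      using assms(4) by (auto simp: fourier_rep_def)
  qed (use assms in auto)
  then show ?thesis by (simp add: mixed_diff_def sum_distrib_left mult_ac)
qed

text \<open>Each part of a division lives on a set with fewer elements than \<open>S\<close>, so it
  misses a direction of \<open>S\<close> and its mixed difference vanishes. Comparing cardinalities
  is enough, wherever these sets lie.\<close>

lemma divisible_mixed_diff_eq_0:
  assumes \<Phi>: "schauder_basis \<Phi>" and S: "finite S" and d: "divisible \<Phi> S h" and v: "v \<in> L_bound \<Phi>"
  shows "mixed_diff \<Phi> S (\<lambda>u. h (restrict_to \<Phi> S u)) v = 0"
proof -
  obtain n E H where E: "\<And>l. l < n \<Longrightarrow> finite (E l)" "\<And>l. l < (n::nat) \<Longrightarrow> card (E l) < card S" and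
    h: "\<And>u. u \<in> L_bound \<Phi> \<Longrightarrow> h (restrict_to \<Phi> S u) = (\<Sum>l<n. H l (restrict_to \<Phi> (E l) u))"
    using d unfolding divisible_def by blast
  have "mixed_diff \<Phi> S (\<lambda>u. h (restrict_to \<Phi> S u)) v
      = mixed_diff \<Phi> S (\<lambda>u. \<Sum>l<n. H l (restrict_to \<Phi> (E l) u)) v"
    unfolding mixed_diff_def
    by (intro sum.cong refl arg_cong2[where f = "(*)"] h restrict_in_L_bound[OF \<Phi> _ v]) (auto intro: finite_subset[OF _ S])
  also have "\<dots> = (\<Sum>l<n. mixed_diff \<Phi> S (\<lambda>u. H l (restrict_to \<Phi> (E l) u)) v)"
    unfolding mixed_diff_def by (simp only: sum_distrib_left) (rule sum.swap)
  also have "\<dots> = 0"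
  proof (intro sum.neutral ballI mixed_diff_restrict[OF \<Phi> S])
    fix l assume "l \<in> {..<n}"
    then show "finite (E l)" "\<not> S \<subseteq> E l" using E[of l] card_mono[of "E l" S] by auto
  qed
  finally show ?thesis .
qed

text \<open>Converse by inclusion-exclusion: the vanishing mixed difference is solved for the term
  \<open>T = S\<close>, which writes the functional as a signed sum of its restrictions to the
  proper subsets.\<close>

lemma divisible_if_mixed_diff_eq_0:
  assumes \<Phi>: "schauder_basis \<Phi>" and S: "finite S" "S \<noteq> {}"
    and z: "\<And>v. v \<in> L_bound \<Phi> \<Longrightarrow> mixed_diff \<Phi> S (\<lambda>u. h (restrict_to \<Phi> S u)) v = 0"
  shows "divisible \<Phi> S h"
proof -
  define P where "P = Pow S - {S}"
  have fP: "finite P" using S by (simp add: P_def)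
  obtain E where E: "bij_betw E {..<card P} P" using ex_bij_betw_nat_finite[OF fP] by (auto simp: atLeast0LessThan)
  have EP: "E l \<in> P" if "l < card P" for l using E that by (auto simp: bij_betw_def)
  define H where "H l u = - ((- 1) ^ card S * ((- 1) ^ card (E l) * h u))" for l u
  \<comment> \<open>The empty set is a proper subset of \<open>S\<close>, which makes the number of
    parts positive.\<close>
  have "{} \<in> P" using S by (auto simp: P_def)
  then have "card P > 0" using fP by (auto simp: card_gt_0_iff)
  moreover have "finite (E l) \<and> card (E l) < card S" if "l < card P" for l
    using EP[OF that] S by (auto simp: P_def intro: finite_subset psubset_card_mono)
  moreover have "h (restrict_to \<Phi> S v) = (\<Sum>l<card P. H l (restrict_to \<Phi> (E l) v))" if v: "v \<in> L_bound \<Phi>" for v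
  proof -
    have s: "(- 1 :: real) ^ card S * (- 1) ^ card S = 1" by (simp flip: power_mult_distrib)
    have "0 = (\<Sum>T\<in>Pow S. (- 1) ^ card T * h (restrict_to \<Phi> S (restrict_to \<Phi> T v)))"
      using z[OF v] by (simp add: mixed_diff_def)
    also have "\<dots> = (\<Sum>T\<in>Pow S. (- 1) ^ card T * h (restrict_to \<Phi> T v))"
    proof (intro sum.cong refl)
      fix T assume "T \<in> Pow S"
      then have "finite T" "S \<inter> T = T" using S by (auto intro: finite_subset)
      then show "(- 1) ^ card T * h (restrict_to \<Phi> S (restrict_to \<Phi> T v)) = (- 1) ^ card T * h (restrict_to \<Phi> T v)"
        by (simp add: restrict_restrict[OF \<Phi>] S)
    qed
    also have "\<dots> = (- 1) ^ card S * h (restrict_to \<Phi> S v) + (\<Sum>T\<in>P. (- 1) ^ card T * h (restrict_to \<Phi> T v))"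
      unfolding P_def using S by (subst sum.remove[of _ S]) auto
    finally have "(- 1) ^ card S * h (restrict_to \<Phi> S v) = - (\<Sum>T\<in>P. (- 1) ^ card T * h (restrict_to \<Phi> T v))" by linarith
    then have "h (restrict_to \<Phi> S v) = - ((- 1) ^ card S * (\<Sum>T\<in>P. (- 1) ^ card T * h (restrict_to \<Phi> T v)))"
      using s by (metis mult.assoc mult.left_neutral mult_minus_right)
    also have "(\<Sum>T\<in>P. (- 1) ^ card T * h (restrict_to \<Phi> T v)) = (\<Sum>l<card P. (- 1) ^ card (E l) * h (restrict_to \<Phi> (E l) v))"
      by (rule sum.reindex_bij_betw[OF E, symmetric])
    finally show ?thesis by (simp add: H_def sum_distrib_left sum_negf)
  qed
  ultimately show ?thesis unfolding divisible_def by blast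
qed

text \<open>If no frequency support contained \<open>D j\<close>, the mixed difference of
  \<open>g\<close> in the directions \<open>D j\<close> would vanish by the Fourier series. In the
  decomposition only the term \<open>j\<close> can contribute to it, as the sets are not nested, so
  \<open>F j\<close> would be divisible.\<close>

lemma decomp_set_below_frequency:
  assumes \<Phi>: "schauder_basis \<Phi>" and dec: "finite_dim_decomp \<Phi> g D F" and rep: "fourier_rep \<Phi> g a"
    and ne: "D j \<noteq> {}"
  shows "\<exists>k. a k \<noteq> 0 \<and> D j \<subseteq> Poly_Mapping.keys k"
proof (rule ccontr)
  assume neg: "\<not> ?thesis"
  have fin: "finite (D i)" for i using dec by (simp add: finite_dim_decomp_def)
  have "divisible \<Phi> (D j) (F j)"
  proof (rule divisible_if_mixed_diff_eq_0[OF \<Phi> fin ne])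
    fix v assume v: "v \<in> L_bound \<Phi>"
    have "a k * mixed_diff \<Phi> (D j) (fourier_basis \<Phi> k) v = 0" for k
      using neg mixed_diff_fourier_basis[OF \<Phi> fin, of j k v] by auto
    then have "((\<lambda>k::nat \<Rightarrow>\<^sub>0 int. 0) has_sum complex_of_real (mixed_diff \<Phi> (D j) g v)) UNIV"
      using mixed_diff_fourier_rep[OF \<Phi> fin v rep, of j] by (simp only:)
    then have g0: "mixed_diff \<Phi> (D j) g v = 0"
      using has_sum_unique[OF has_sum_0] by (metis of_real_eq_0_iff)
    have "mixed_diff \<Phi> (D j) (\<lambda>u. F i (restrict_to \<Phi> (D i) u)) v = 0" if "i \<noteq> j" for i
      using dec ne that by (intro mixed_diff_restrict[OF \<Phi> fin fin]) (auto simp: finite_dim_decomp_def)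
    then have e: "(\<lambda>i. mixed_diff \<Phi> (D j) (\<lambda>u. F i (restrict_to \<Phi> (D i) u)) v) =
        (\<lambda>i. if i = j then mixed_diff \<Phi> (D j) (\<lambda>u. F i (restrict_to \<Phi> (D i) u)) v else 0)"
      by auto
    have "(\<lambda>i. mixed_diff \<Phi> (D j) (\<lambda>u. F i (restrict_to \<Phi> (D i) u)) v) sums
        mixed_diff \<Phi> (D j) (\<lambda>u. F j (restrict_to \<Phi> (D j) u)) v"
      by (subst e) (rule sums_single)
    then show "mixed_diff \<Phi> (D j) (\<lambda>u. F j (restrict_to \<Phi> (D j) u)) v = 0"
      using mixed_diff_decomp[OF \<Phi> fin v dec, of j] g0 by (simp add: sums_iff)
  qed
  then show False using dec by (auto simp: finite_dim_decomp_def)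
qed

lemma cube_in_L_bound:
  assumes "schauder_basis \<Phi>" "finite D" "b \<in> cube D"
  shows "(\<Sum>i\<in>D. b i *\<^sub>R \<Phi> i) \<in> L_bound \<Phi>"
  using assms(3) unfolding L_bound_def mem_Collect_eq coord_sum[OF assms(1,2)] by (auto simp: cube_def dest: PiE_mem)

lemma cis_sum: "cis (sum f A) = (\<Prod>x\<in>A. cis (f x))"
  by (induction A rule: infinite_finite_induct) (auto simp flip: cis_mult)

lemma fourier_basis_cube:
  assumes "schauder_basis \<Phi>" "finite D" "T \<subseteq> D"
  shows "fourier_basis \<Phi> k (restrict_to \<Phi> T (\<Sum>i\<in>D. b i *\<^sub>R \<Phi> i))
           * (\<Prod>i\<in>D. cis (2 * pi * of_int (- Poly_Mapping.lookup k0 i) * b i))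
       = (\<Prod>i\<in>D. cis (2 * pi * of_int ((if i \<in> T then Poly_Mapping.lookup k i else 0) - Poly_Mapping.lookup k0 i) * b i))"
proof -
  have fT: "finite T" using assms finite_subset by blast
  define c where "c i = (if i \<in> T then Poly_Mapping.lookup k i else 0)" for i
  have "ridge \<Phi> k (restrict_to \<Phi> T (\<Sum>i\<in>D. b i *\<^sub>R \<Phi> i)) = (\<Sum>i\<in>D. of_int (c i) * b i)"
    unfolding ridge_restrict[OF assms(1) fT] coord_sum[OF assms(1,2)]
    using assms(2,3) by (intro sum.mono_neutral_cong_left) (auto simp: c_def)
  then have "fourier_basis \<Phi> k (restrict_to \<Phi> T (\<Sum>i\<in>D. b i *\<^sub>R \<Phi> i))
      = (\<Prod>i\<in>D. cis (2 * pi * of_int (c i) * b i))"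
    by (simp add: fourier_basis_cis sum_distrib_left cis_sum mult_ac)
  then show ?thesis
    unfolding c_def[symmetric] by (simp add: prod.distrib[symmetric] cis_mult algebra_simps)
qed

lemma norm_fourier_basis: "cmod (fourier_basis \<Phi> k v) = 1"
  by (simp add: fourier_basis_cis)

text \<open>At the origin all characters are 1, and unordered convergence in the complex numbers is
  absolute.\<close>

lemma fourier_rep_abs_summable:
  assumes "schauder_basis \<Phi>" "fourier_rep \<Phi> g a"
  shows "(\<lambda>k. cmod (a k)) summable_on UNIV"
proof -
  have c0: "coord \<Phi> 0 = (\<lambda>i. 0)"
    using coord_sum[OF assms(1), of "{}"] by simp
  then have "((\<lambda>k. a k * fourier_basis \<Phi> k 0) has_sum of_real (g 0)) UNIV"
    using assms(2) by (simp add: fourier_rep_def L_bound_def)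
  then have "a summable_on UNIV"
    using has_sum_imp_summable by (simp add: fourier_basis_cis ridge_def c0) blast
  then show ?thesis by (simp add: summable_on_iff_abs_summable_on_complex)
qed

lemma summable_fourier:
  assumes "(\<lambda>k. cmod (a k)) summable_on UNIV"
  shows "(\<lambda>k. a k * fourier_basis \<Phi> k v) summable_on UNIV"
  by (rule abs_summable_summable) (use assms in \<open>simp add: norm_mult norm_fourier_basis\<close>)

text \<open>Coefficient extraction: the mixed difference of a character is tested against the
  conjugate character of \<open>k0\<close>. The term \<open>T \<noteq> S\<close> leaves the latter
  alone in a direction outside \<open>T\<close>, where it integrates to 0; so only
  \<open>T = S\<close> contributes.\<close>

lemma mixed_diff_character_integral:
  fixes k0 :: "nat \<Rightarrow>\<^sub>0 int"
  assumes \<Phi>: "schauder_basis \<Phi>"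
  defines "S \<equiv> Poly_Mapping.keys k0"
  defines "u \<equiv> \<lambda>k b. mixed_diff \<Phi> S (fourier_basis \<Phi> k) (\<Sum>i\<in>S. b i *\<^sub>R \<Phi> i)
                 * (\<Prod>i\<in>S. cis (2 * pi * of_int (- Poly_Mapping.lookup k0 i) * b i))"
  shows "u k \<in> borel_measurable (leb S)" "cmod (u k b) \<le> 2 ^ card S"
    and "Poly_Mapping.keys k = S \<Longrightarrow> (LINT b:cube S|leb S. u k b) = (if k = k0 then (- 1) ^ card S else 0)"
proof -
  have S: "finite S" by (simp add: S_def)
  define p where "p k T i = (if i \<in> T then Poly_Mapping.lookup k i else 0) - Poly_Mapping.lookup k0 i" for k :: "nat \<Rightarrow>\<^sub>0 int" and T i
  define E where "E k T b = (\<Prod>i\<in>S. cis (2 * pi * of_int (p k T i) * b i))" for k T and b :: "nat \<Rightarrow> real"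
  have u: "u k b = (\<Sum>T\<in>Pow S. (- 1) ^ card T * E k T b)" for k b
    unfolding u_def mixed_diff_def sum_distrib_right
  proof (intro sum.cong refl)
    fix T assume "T \<in> Pow S"
    then have T: "T \<subseteq> S" by simp
    show "(- 1) ^ card T * fourier_basis \<Phi> k (restrict_to \<Phi> T (\<Sum>i\<in>S. b i *\<^sub>R \<Phi> i))
        * (\<Prod>i\<in>S. cis (2 * pi * of_int (- Poly_Mapping.lookup k0 i) * b i)) = (- 1) ^ card T * E k T b"
      by (subst mult.assoc) (simp only: fourier_basis_cube[OF \<Phi> S T] E_def p_def)
  qed
  have Em: "E k T \<in> borel_measurable (leb S)" for k T
    unfolding E_def by (rule character_measurable[OF S])
  have E1: "cmod (E k T b) = 1" for k T b
    by (simp add: E_def prod_norm[symmetric])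
  show "u k \<in> borel_measurable (leb S)"
    unfolding u using Em by measurable
  have "cmod (u k b) \<le> (\<Sum>T\<in>Pow S. cmod ((- 1) ^ card T * E k T b))" unfolding u by (rule norm_sum)
  also have "\<dots> = 2 ^ card S" using S by (simp add: norm_mult norm_power E1 card_Pow)
  finally show "cmod (u k b) \<le> 2 ^ card S" .
  assume k: "Poly_Mapping.keys k = S"
  have iE: "set_integrable (leb S) (cube S) (E k T)" for T
    unfolding set_integrable_def using leb_cube[OF S] Em E1
    by (intro integrableI_bounded_set_indicator[where B = 1]) auto
  have "(LINT b:cube S|leb S. u k b) = (\<Sum>T\<in>Pow S. (- 1) ^ card T * (LINT b:cube S|leb S. E k T b))"
    unfolding u using set_integrable_mult_right[OF iE]
    unfolding set_lebesgue_integral_def scaleR_sum_right set_integrable_def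
    by (subst Bochner_Integration.integral_sum) (auto simp flip: set_lebesgue_integral_def)
  also have "\<dots> = (\<Sum>T\<in>Pow S. if T = S then (if k = k0 then (- 1) ^ card S else 0) else 0)"
  proof (intro sum.cong refl)
    fix T assume T: "T \<in> Pow S"
    show "(- 1) ^ card T * (LINT b:cube S|leb S. E k T b) = (if T = S then (if k = k0 then (- 1) ^ card S else 0) else 0)"
    proof (cases "T = S")
      case True
      have "(\<forall>i\<in>S. p k S i = 0) \<longleftrightarrow> k = k0"
        using k by (auto simp: p_def S_def in_keys_iff intro!: poly_mapping_eqI)
      then show ?thesis using True integral_character_cube[OF S, of "p k S"] by (simp add: E_def)
    next
      case False
      then obtain i where i: "i \<in> S" "i \<notin> T" using T by auto
      then have "p k T i \<noteq> 0" by (simp add: p_def S_def in_keys_iff)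
      then show ?thesis using i False integral_character_cube[OF S, of "p k T"] by (auto simp: E_def)
    qed
  qed
  also have "\<dots> = (if k = k0 then (- 1) ^ card S else 0)" using S by simp
  finally show "(LINT b:cube S|leb S. u k b) = (if k = k0 then (- 1) ^ card S else 0)" .
qed

text \<open>If the mixed difference vanished identically, integrating it against the conjugate
  character of \<open>k0\<close> would give \<open>a k0 = 0\<close>. Frequencies whose support does
  not contain that of \<open>k0\<close> are removed by the mixed difference; by maximality the
  others have the same support, and the integral separates them.\<close>

lemma mixed_diff_at_maximal_frequency:
  assumes \<Phi>: "schauder_basis \<Phi>" and rep: "fourier_rep \<Phi> g a" and k0: "a k0 \<noteq> 0"
    and max: "\<And>k. a k \<noteq> 0 \<Longrightarrow> Poly_Mapping.keys k0 \<subseteq> Poly_Mapping.keys k \<Longrightarrow> Poly_Mapping.keys k = Poly_Mapping.keys k0"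
  shows "\<exists>v\<in>L_bound \<Phi>. mixed_diff \<Phi> (Poly_Mapping.keys k0) g v \<noteq> 0"
proof (rule ccontr)
  assume "\<not> ?thesis"
  then have z: "\<And>v. v \<in> L_bound \<Phi> \<Longrightarrow> mixed_diff \<Phi> (Poly_Mapping.keys k0) g v = 0" by auto
  define S where "S = Poly_Mapping.keys k0"
  have S: "finite S" by (simp add: S_def)
  define \<kappa> where "\<kappa> b = (\<Prod>i\<in>S. cis (2 * pi * of_int (- Poly_Mapping.lookup k0 i) * b i))" for b :: "nat \<Rightarrow> real"
  define u where "u k b = mixed_diff \<Phi> S (fourier_basis \<Phi> k) (\<Sum>i\<in>S. b i *\<^sub>R \<Phi> i) * \<kappa> b" for k b
  have "((\<lambda>k. a k * u k b) has_sum 0) UNIV" if b: "b \<in> cube S" for b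
    using has_sum_cmult_left[OF mixed_diff_fourier_rep[OF \<Phi> S cube_in_L_bound[OF \<Phi> S b] rep], of "\<kappa> b"]
      z[OF cube_in_L_bound[OF \<Phi> S b]]
    by (simp add: u_def S_def mult_ac)
  then have "((\<lambda>k. a k * (LINT b:cube S|leb S. u k b)) has_sum (LINT b:cube S|leb S. 0)) UNIV"
    using mixed_diff_character_integral(1,2)[OF \<Phi>, of k0]
    by (intro has_sum_bounded_integral(2)[OF leb_cube[OF S] _ _ fourier_rep_abs_summable[OF \<Phi> rep], where C = "2 ^ card S"])
       (auto simp: u_def \<kappa>_def S_def)
  moreover have "a k * (LINT b:cube S|leb S. u k b) = (if k = k0 then a k0 * (- 1) ^ card S else 0)" for k
  proof (cases "a k \<noteq> 0 \<and> S \<subseteq> Poly_Mapping.keys k")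
    case True
    then have "Poly_Mapping.keys k = S" using max by (simp add: S_def)
    then show ?thesis
      using mixed_diff_character_integral(3)[OF \<Phi>, of k k0] by (simp add: u_def \<kappa>_def S_def)
  next
    case False
    then have "k \<noteq> k0" using k0 by (auto simp: S_def)
    moreover have "a k = 0 \<or> u k = (\<lambda>b. 0)"
      using False mixed_diff_fourier_basis[OF \<Phi> S] by (auto simp: u_def fun_eq_iff)
    ultimately show ?thesis by (auto simp: set_lebesgue_integral_def)
  qed
  ultimately have "((\<lambda>k. if k = k0 then a k0 * (- 1) ^ card S else 0) has_sum 0) UNIV"
    by (simp add: set_lebesgue_integral_def)
  moreover have "((\<lambda>k. if k = k0 then a k0 * (- 1) ^ card S else 0) has_sum (a k0 * (- 1) ^ card S)) UNIV"
    by (rule has_sum_finite_neutralI[of "{k0}"]) auto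
  ultimately have "a k0 * (- 1) ^ card S = 0" using has_sum_unique by blast
  then show False using k0 by simp
qed

section \<open>Maximal frequency supports\<close>

definition top_sets :: "((nat \<Rightarrow>\<^sub>0 int) \<Rightarrow> complex) \<Rightarrow> nat set set" where
  "top_sets a = {S. S \<noteq> {} \<and> (\<exists>k. a k \<noteq> 0 \<and> Poly_Mapping.keys k = S) \<and>
                    (\<forall>k. a k \<noteq> 0 \<longrightarrow> S \<subseteq> Poly_Mapping.keys k \<longrightarrow> Poly_Mapping.keys k = S)}"

text \<open>Supports can form an infinite ascending chain with no maximal one above it. The
  condition rules this out; every expansion that comes from a decomposition satisfies it.\<close>

definition dominated :: "((nat \<Rightarrow>\<^sub>0 int) \<Rightarrow> complex) \<Rightarrow> bool" where
  "dominated a \<longleftrightarrow> (\<forall>k. a k \<noteq> 0 \<longrightarrow> k \<noteq> 0 \<longrightarrow> (\<exists>S\<in>top_sets a. Poly_Mapping.keys k \<subseteq> S))"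

text \<open>A maximal support lies in some \<open>D i\<close>, since the mixed difference of
  \<open>g\<close> over it is nonzero somewhere; a nonempty \<open>D j\<close> lies below a
  frequency, hence below a maximal support. As the sets are not nested, this circle of inclusions
  collapses to equalities, which makes the sets unique.\<close>

lemma decomp_sets_eq_top_sets:
  assumes \<Phi>: "schauder_basis \<Phi>" and rep: "fourier_rep \<Phi> g a" and dom: "dominated a"
    and dec: "finite_dim_decomp \<Phi> g D F"
  shows "range D - {{}} = top_sets a"
proof -
  have fin: "finite (D i)" for i using dec by (simp add: finite_dim_decomp_def)
  have anti: "i = j" if "D i \<noteq> {}" "D i \<subseteq> D j" for i j
    using dec that unfolding finite_dim_decomp_def by blast
  have below: "\<exists>i. S \<subseteq> D i" if S: "S \<in> top_sets a" for S
  proof (rule ccontr)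
    assume neg: "\<not> ?thesis"
    obtain k0 where k0: "a k0 \<noteq> 0" "Poly_Mapping.keys k0 = S" using S by (auto simp: top_sets_def)
    obtain v where v: "v \<in> L_bound \<Phi>" "mixed_diff \<Phi> S g v \<noteq> 0"
      using mixed_diff_at_maximal_frequency[OF \<Phi> rep k0(1)] S k0(2) by (auto simp: top_sets_def)
    have fS: "finite S" using k0(2) by auto
    have "(\<lambda>j. mixed_diff \<Phi> S (\<lambda>u. F j (restrict_to \<Phi> (D j) u)) v) = (\<lambda>j. 0)"
      using neg by (intro ext mixed_diff_restrict[OF \<Phi> fS fin]) auto
    then show False using mixed_diff_decomp[OF \<Phi> fS v(1) dec] v(2) by (simp add: sums_iff)
  qed
  have 1: "D j \<in> top_sets a" if ne: "D j \<noteq> {}" for j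
  proof -
    obtain k where k: "a k \<noteq> 0" "D j \<subseteq> Poly_Mapping.keys k"
      using decomp_set_below_frequency[OF \<Phi> dec rep ne] by blast
    have "k \<noteq> 0" using k ne by auto
    then obtain S where S: "S \<in> top_sets a" "Poly_Mapping.keys k \<subseteq> S" using dom k by (auto simp: dominated_def)
    obtain i where i: "S \<subseteq> D i" using below[OF S(1)] by blast
    have "i = j" using anti[of j i] ne k(2) S(2) i by auto
    then have "D j = S" using k(2) S(2) i by auto
    then show ?thesis using S(1) by simp
  qed
  have 2: "S \<in> range D" if S: "S \<in> top_sets a" for S
  proof -
    obtain i where i: "S \<subseteq> D i" using below[OF S] by blast
    have "D i \<noteq> {}" using i S by (auto simp: top_sets_def)
    then have "D i \<in> top_sets a" by (rule 1)
    then obtain k where "a k \<noteq> 0" "Poly_Mapping.keys k = D i" unfolding top_sets_def by blast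
    then have "D i = S" using i S unfolding top_sets_def by blast
    then show ?thesis by auto
  qed
  have "{} \<notin> top_sets a" by (simp add: top_sets_def)
  then show ?thesis using 1 2 by auto
qed

section \<open>From dominated coefficients to a decomposition\<close>

lemma coeff_series_real:
  fixes c :: "(nat \<Rightarrow>\<^sub>0 int) \<Rightarrow> complex"
  assumes herm: "\<And>k. c (- k) = cnj (c k)" and c: "(\<lambda>k. cmod (c k)) summable_on UNIV"
  shows "((\<lambda>k. c k * fourier_basis \<Phi> k v) has_sum
            of_real (Re (\<Sum>\<^sub>\<infinity>k. c k * fourier_basis \<Phi> k v))) UNIV"
proof -
  define s where "s = (\<Sum>\<^sub>\<infinity>k. c k * fourier_basis \<Phi> k v)"
  have h: "((\<lambda>k. c k * fourier_basis \<Phi> k v) has_sum s) UNIV"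
    unfolding s_def by (rule has_sum_infsum[OF summable_fourier[OF c]])
  have r: "ridge \<Phi> (- k) v = - ridge \<Phi> k v" for k by (simp add: ridge_def sum_negf)
  have n: "c (- k) * fourier_basis \<Phi> (- k) v = cnj (c k * fourier_basis \<Phi> k v)" for k
    by (simp add: herm fourier_basis_cis r cis_cnj)
  \<comment> \<open>Reindexing by negation turns the series into its conjugate, so the sum is
    real.\<close>
  have "bij (uminus :: (nat \<Rightarrow>\<^sub>0 int) \<Rightarrow> _)" by (rule bij_uminus)
  then have "((\<lambda>k. c (- k) * fourier_basis \<Phi> (- k) v) has_sum s) UNIV"
    using h by (subst (asm) has_sum_reindex_bij_betw[symmetric, of uminus UNIV UNIV]) auto
  then have "((\<lambda>k. cnj (c k * fourier_basis \<Phi> k v)) has_sum s) UNIV" by (simp only: n)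
  moreover have "((\<lambda>k. cnj (c k * fourier_basis \<Phi> k v)) has_sum cnj s) UNIV"
    using h by (simp only: has_sum_cnj_iff)
  ultimately have "cnj s = s" using has_sum_unique by blast
  then have "s = of_real (Re s)" by (metis Reals_cnj_iff complex_is_Real_iff of_real_Re)
  then show ?thesis using h unfolding s_def by simp
qed

text \<open>Orthogonality: the series is integrated termwise against the conjugate character of
  \<open>q\<close>. The choice \<open>q = 0\<close> gives integrability, \<open>q = k0\<close> the
  coefficient.\<close>

lemma fourier_coeff_integral:
  assumes \<Phi>: "schauder_basis \<Phi>" and D: "finite D" and rep: "fourier_rep \<Phi> h c"
    and sub: "\<And>k. c k \<noteq> 0 \<Longrightarrow> Poly_Mapping.keys k \<subseteq> D"
  shows "set_integrable (leb D) (cube D) (\<lambda>b. h (\<Sum>i\<in>D. b i *\<^sub>R \<Phi> i))"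
    and "Poly_Mapping.keys k0 \<subseteq> D \<Longrightarrow> term_coeff \<Phi> D h k0 = c k0"
proof -
  define V where "V b = (\<Sum>i\<in>D. b i *\<^sub>R \<Phi> i)" for b
  define \<kappa> where "\<kappa> q b = (\<Prod>i\<in>D. cis (2 * pi * of_int (- Poly_Mapping.lookup q i) * b i))" for q :: "nat \<Rightarrow>\<^sub>0 int" and b :: "nat \<Rightarrow> real"
  define u where "u q k b = (\<Prod>i\<in>D. cis (2 * pi * of_int (Poly_Mapping.lookup k i - Poly_Mapping.lookup q i) * b i))"
    for q k :: "nat \<Rightarrow>\<^sub>0 int" and b :: "nat \<Rightarrow> real"
  have RV: "restrict_to \<Phi> D (V b) = V b" for b
    unfolding restrict_to_def V_def coord_sum[OF \<Phi> D] by simp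
  have u: "fourier_basis \<Phi> k (V b) * \<kappa> q b = u q k b" for k q b
  proof -
    have "fourier_basis \<Phi> k (V b) * \<kappa> q b = (\<Prod>i\<in>D. cis (2 * pi * of_int ((if i \<in> D then Poly_Mapping.lookup k i else 0) - Poly_Mapping.lookup q i) * b i))"
      using fourier_basis_cube[OF \<Phi> D subset_refl, of k b q] unfolding V_def[symmetric] RV \<kappa>_def .
    also have "\<dots> = u q k b" unfolding u_def by (intro prod.cong) auto
    finally show ?thesis .
  qed
  have um: "u q k \<in> borel_measurable (leb D)" "cmod (u q k b) \<le> 1" for q k b
    unfolding u_def by (rule character_measurable[OF D]) (simp add: prod_norm[symmetric])
  have hs: "((\<lambda>k. c k * u q k b) has_sum (of_real (h (V b)) * \<kappa> q b)) UNIV" if b: "b \<in> cube D" for q b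
  proof -
    have "V b \<in> L_bound \<Phi>" using cube_in_L_bound[OF \<Phi> D b] by (simp add: V_def)
    then have "((\<lambda>k. c k * fourier_basis \<Phi> k (V b)) has_sum of_real (h (V b))) UNIV"
      using rep by (simp add: fourier_rep_def)
    from has_sum_cmult_left[OF this, of "\<kappa> q b"] show ?thesis by (simp add: mult.assoc u)
  qed
  note int = has_sum_bounded_integral[OF leb_cube[OF D] um fourier_rep_abs_summable[OF \<Phi> rep] hs]
  have "\<kappa> 0 b = 1" for b by (simp add: \<kappa>_def)
  then have "set_integrable (leb D) (cube D) (\<lambda>b. complex_of_real (h (V b)))"
    using int(1)[of 0] by simp
  then have "set_integrable (leb D) (cube D) (\<lambda>b. h (V b))"
    unfolding set_integrable_def
    by (simp add: scaleR_conv_of_real complex_of_real_integrable_eq flip: of_real_mult)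
  then show "set_integrable (leb D) (cube D) (\<lambda>b. h (\<Sum>i\<in>D. b i *\<^sub>R \<Phi> i))" by (simp add: V_def)
  assume k0: "Poly_Mapping.keys k0 \<subseteq> D"
  have "c k * (LINT b:cube D|leb D. u k0 k b) = (if k = k0 then c k0 else 0)" for k
  proof (cases "c k = 0")
    case False
    have "(\<forall>i\<in>D. Poly_Mapping.lookup k i - Poly_Mapping.lookup k0 i = 0) \<longleftrightarrow> k = k0"
    proof
      assume e: "\<forall>i\<in>D. Poly_Mapping.lookup k i - Poly_Mapping.lookup k0 i = 0"
      show "k = k0"
      proof (rule poly_mapping_eqI)
        fix i
        show "Poly_Mapping.lookup k i = Poly_Mapping.lookup k0 i"
          using e sub[OF False] k0 by (cases "i \<in> D") (auto simp: in_keys_iff subset_iff, metis)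
      qed
    qed auto
    then show ?thesis unfolding u_def integral_character_cube[OF D] by auto
  qed auto
  then have "((\<lambda>k. if k = k0 then c k0 else 0) has_sum (LINT b:cube D|leb D. of_real (h (V b)) * \<kappa> k0 b)) UNIV"
    using int(2)[of k0] by simp
  moreover have "((\<lambda>k. if k = k0 then c k0 else 0) has_sum c k0) UNIV"
    by (rule has_sum_finite_neutralI[of "{k0}"]) auto
  ultimately have "(LINT b:cube D|leb D. of_real (h (V b)) * \<kappa> k0 b) = c k0"
    by (rule has_sum_unique)
  moreover have "\<kappa> k0 b = (\<Prod>i\<in>D. exp (- (2 * of_real pi * \<i> * of_int (Poly_Mapping.lookup k0 i) * of_real (b i))))" for b
    unfolding \<kappa>_def cis_conv_exp by (intro prod.cong refl arg_cong[where f = exp]) (simp add: mult_ac)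
  ultimately show "term_coeff \<Phi> D h k0 = c k0"
    unfolding term_coeff_def V_def by simp
qed

text \<open>
  The maximal frequency supports, numbered by \<open>set_encode\<close>, serve as the sets of a decomposition;
  every frequency is assigned to one of them that contains its support.
\<close>

lemma fourier_expansion_if_dominated:
  assumes \<Phi>: "schauder_basis \<Phi>" and rep: "fourier_rep \<Phi> g a"
    and herm: "\<And>k. a (- k) = cnj (a k)" and dom: "dominated a"
  shows "fourier_expansion \<Phi> g a"
proof -
  have abs: "(\<lambda>k. cmod (a k)) summable_on UNIV" by (rule fourier_rep_abs_summable[OF \<Phi> rep])
  define M where "M = top_sets a"
  have Mfin: "finite S" if "S \<in> M" for S using that by (auto simp: M_def top_sets_def)
  \<comment> \<open>The zero frequency and vanishing coefficients are assigned to the empty set. For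
    the others the choice depends only on the support, so \<open>k\<close> and \<open>- k\<close>
    fall into the same term, and the series of every term is real.\<close>
  define \<sigma> where "\<sigma> k = (if a k = 0 \<or> k = 0 then {} else SOME S. S \<in> M \<and> Poly_Mapping.keys k \<subseteq> S)" for k
  have \<sigma>: "\<sigma> k \<in> M" "Poly_Mapping.keys k \<subseteq> \<sigma> k" if "a k \<noteq> 0" "k \<noteq> 0" for k
  proof -
    have "\<exists>S. S \<in> M \<and> Poly_Mapping.keys k \<subseteq> S" using dom that by (auto simp: dominated_def M_def)
    from someI_ex[OF this] show "\<sigma> k \<in> M" "Poly_Mapping.keys k \<subseteq> \<sigma> k" using that by (simp_all add: \<sigma>_def)
  qed
  have \<sigma>_neg: "\<sigma> (- k) = \<sigma> k" for k by (simp add: \<sigma>_def herm keys_minus)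
  define idx where "idx k = set_encode (\<sigma> k)" for k
  \<comment> \<open>Numbers that do not encode a maximal support give the empty set. In particular
    \<open>D 0\<close> is empty, and index 0 carries the constant.\<close>
  define D where "D j = (if set_decode j \<in> M then set_decode j else {})" for j
  define c where "c j k = (if idx k = j then a k else 0)" for j k
  define F where "F j u = Re (\<Sum>\<^sub>\<infinity>k. c j k * fourier_basis \<Phi> k u)" for j u
  have D: "finite (D j)" for j by (simp add: D_def)
  have keys_D: "Poly_Mapping.keys k \<subseteq> D (idx k)" if "a k \<noteq> 0" for k
    using \<sigma>[OF that] Mfin by (cases "k = 0") (auto simp: D_def idx_def set_encode_inverse)
  have c_keys: "Poly_Mapping.keys k \<subseteq> D j" if "c j k \<noteq> 0" for j k
    using that keys_D by (auto simp: c_def split: if_splits)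
  have c_abs: "(\<lambda>k. cmod (c j k)) summable_on UNIV" for j
    by (rule summable_on_comparison_test[OF abs]) (auto simp: c_def)
  have c_herm: "c j (- k) = cnj (c j k)" for j k
    by (simp add: c_def idx_def \<sigma>_neg herm)
  have repF: "((\<lambda>k. c j k * fourier_basis \<Phi> k v) has_sum of_real (F j v)) UNIV" for j v
    unfolding F_def by (rule coeff_series_real[OF c_herm c_abs])
  then have repF': "fourier_rep \<Phi> (F j) (c j)" for j by (simp add: fourier_rep_def)
  have F_restrict: "F j (restrict_to \<Phi> (D j) v) = F j v" for j v
  proof -
    have "c j k * fourier_basis \<Phi> k (restrict_to \<Phi> (D j) v) = c j k * fourier_basis \<Phi> k v" for k
      using c_keys[of j k] ridge_restrict_keys[OF \<Phi> D, of k j v] by (cases "c j k = 0") (auto simp: fourier_basis_cis)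
    then show ?thesis by (simp only: F_def)
  qed
  have sums: "(\<lambda>j. F j v) sums g v" if v: "v \<in> L_bound \<Phi>" for v
  proof -
    define h where "h k = a k * fourier_basis \<Phi> k v" for k
    have "(h has_sum of_real (g v)) UNIV" using rep v by (simp add: fourier_rep_def h_def[abs_def])
    \<comment> \<open>The series is regrouped along the fibres of \<open>idx\<close>.\<close>
    then have "((\<lambda>(j, k). h k) has_sum of_real (g v)) (SIGMA j:UNIV. {k. idx k = j})"
      by (subst has_sum_reindex_bij_betw[of "\<lambda>k. (idx k, k)" UNIV, symmetric])
         (auto simp: bij_betw_def inj_on_def)
    moreover have "((\<lambda>k. case (j, k) of (j, k) \<Rightarrow> h k) has_sum of_real (F j v)) {k. idx k = j}" for j
      using repF[of j v] by (rule has_sum_cong_neutral[THEN iffD1, rotated -1]) (auto simp: c_def h_def)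
    ultimately have "((\<lambda>j. complex_of_real (F j v)) has_sum of_real (g v)) UNIV"
      by (rule has_sum_SigmaD)
    then have "((\<lambda>j. F j v) has_sum g v) UNIV" by (simp only: has_sum_of_real_iff)
    then show ?thesis by (rule has_sum_imp_sums)
  qed
  have indiv: "\<not> divisible \<Phi> (D j) (F j)" for j
  proof (cases "D j = {}")
    case True
    \<comment> \<open>No set has fewer than 0 elements, and a division has at least one
      part.\<close>
    then show ?thesis by (auto simp: divisible_def)
  next
    case False
    then have j: "D j \<in> M" "set_decode j = D j" by (auto simp: D_def split: if_splits)
    then obtain k0 where k0: "a k0 \<noteq> 0" "Poly_Mapping.keys k0 = D j" by (auto simp: M_def top_sets_def)
    have max: "Poly_Mapping.keys k = D j" if "a k \<noteq> 0" "D j \<subseteq> Poly_Mapping.keys k" for k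
      using j(1) that unfolding M_def top_sets_def by blast
    have "k0 \<noteq> 0" using k0(2) False by auto
    then obtain k1 where "a k1 \<noteq> 0" "Poly_Mapping.keys k1 = \<sigma> k0"
      using \<sigma>(1)[OF k0(1)] by (auto simp: M_def top_sets_def)
    \<comment> \<open>The support of \<open>k0\<close> is the maximal set \<open>D j\<close> itself,
      so no other maximal support contains it and its coefficient stays in the term
      \<open>j\<close>.\<close>
    then have "\<sigma> k0 = D j" using max[of k1] \<sigma>(2)[OF k0(1) \<open>k0 \<noteq> 0\<close>] k0(2) by simp
    then have "idx k0 = j" using j(2) by (simp add: idx_def) (metis set_decode_inverse)
    then have "c j k0 \<noteq> 0" using k0 by (simp add: c_def)
    moreover have "Poly_Mapping.keys k = Poly_Mapping.keys k0" if "c j k \<noteq> 0" "Poly_Mapping.keys k0 \<subseteq> Poly_Mapping.keys k" for k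
      using max[of k] that k0(2) by (simp add: c_def split: if_splits)
    ultimately obtain v where v: "v \<in> L_bound \<Phi>" "mixed_diff \<Phi> (D j) (F j) v \<noteq> 0"
      using mixed_diff_at_maximal_frequency[OF \<Phi> repF', of j k0] k0(2) by auto
    then have "mixed_diff \<Phi> (D j) (\<lambda>u. F j (restrict_to \<Phi> (D j) u)) v \<noteq> 0"
      by (simp add: F_restrict)
    then show ?thesis using divisible_mixed_diff_eq_0[OF \<Phi> D _ v(1)] by blast
  qed
  have anti: "\<not> D i \<subseteq> D j" if ij: "i \<noteq> j" and ne: "D i \<noteq> {}" for i j
  proof
    assume sub: "D i \<subseteq> D j"
    then have "D j \<noteq> {}" using ne by auto
    with ne have i: "D i \<in> M" "set_decode i = D i" and j: "D j \<in> M" "set_decode j = D j"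
      by (auto simp: D_def split: if_splits)
    obtain k where "a k \<noteq> 0" "Poly_Mapping.keys k = D j" using j(1) by (auto simp: M_def top_sets_def)
    then have "D j = D i" using i(1) sub unfolding M_def top_sets_def by blast
    then show False using ij i j by (metis set_decode_inverse)
  qed
  have dec: "finite_dim_decomp \<Phi> g D F"
    unfolding finite_dim_decomp_def using D sums indiv anti F_restrict by simp
  have "finite_dim_summation \<Phi> g"
    unfolding finite_dim_summation_def
  proof (rule ex1I)
    show "\<exists>D F. finite_dim_decomp \<Phi> g D F \<and> top_sets a = range D - {{}}"
      using dec decomp_sets_eq_top_sets[OF \<Phi> rep dom dec] by metis
    show "\<D> = top_sets a" if "\<exists>D F. finite_dim_decomp \<Phi> g D F \<and> \<D> = range D - {{}}" for \<D>
      using that decomp_sets_eq_top_sets[OF \<Phi> rep dom] by metis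
  qed
  moreover have "(\<lambda>j. if j \<in> A_set D k then term_coeff \<Phi> (D j) (F j) k else 0) sums a k" for k
  proof -
    have K: "j \<in> A_set D k \<longleftrightarrow> Poly_Mapping.keys k \<subseteq> D j" for j
      by (auto simp: A_set_def K_set_def in_keys_iff)
    \<comment> \<open>Several sets may contain the support of \<open>k\<close>, but the coefficient
      was given to one of them only; the other integrals vanish.\<close>
    have "(if j \<in> A_set D k then term_coeff \<Phi> (D j) (F j) k else 0) = (if j = idx k then a k else 0)" for j
    proof (cases "j \<in> A_set D k")
      case True
      then show ?thesis using fourier_coeff_integral(2)[OF \<Phi> D[of j] repF'[of j] c_keys[of j], of k] by (simp add: K c_def)
    next
      case False
      then show ?thesis using keys_D[of k] by (auto simp: K)
    qed
    then show ?thesis using sums_single[of "idx k" "\<lambda>_. a k"] by simp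
  qed
  ultimately show ?thesis
    unfolding fourier_expansion_def coeffs_of_def
    using dec fourier_coeff_integral(1)[OF \<Phi> D repF' c_keys] rep unfolding fourier_rep_def by blast
qed

section \<open>Consequences of an expansion for its coefficients\<close>

lemma term_coeff_uminus: "term_coeff \<Phi> D h (- k) = cnj (term_coeff \<Phi> D h k)"
  unfolding term_coeff_def set_lebesgue_integral_def
  by (subst Bochner_Integration.integral_cnj[symmetric], intro Bochner_Integration.integral_cong refl)
     (simp add: exp_cnj scaleR_conv_of_real)

text \<open>The symmetry is read off from the coefficient formula: the functionals
  \<open>F j\<close> are real-valued, and \<open>A_set\<close> sees only the support of the
  frequency.\<close>

lemma fourier_expansion_uminus:
  assumes "fourier_expansion \<Phi> f a"
  shows "a (- k) = cnj (a k)"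
proof -
  obtain D F where
    s: "\<And>k. (\<lambda>j. if j \<in> A_set D k then term_coeff \<Phi> (D j) (F j) k else 0) sums a k"
    using assms by (auto simp: fourier_expansion_def coeffs_of_def)
  have "A_set D (- k) = A_set D k" by (auto simp: A_set_def K_set_def)
  then have "(\<lambda>j. if j \<in> A_set D (- k) then term_coeff \<Phi> (D j) (F j) (- k) else 0)
      = (\<lambda>j. cnj (if j \<in> A_set D k then term_coeff \<Phi> (D j) (F j) k else 0))"
    by (auto simp: term_coeff_uminus)
  then have "(\<lambda>j. cnj (if j \<in> A_set D k then term_coeff \<Phi> (D j) (F j) k else 0)) sums a (- k)"
    using s[of "- k"] by simp
  moreover have "(\<lambda>j. cnj (if j \<in> A_set D k then term_coeff \<Phi> (D j) (F j) k else 0)) sums cnj (a k)"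
    using s[of k] by (simp only: sums_cnj)
  ultimately show ?thesis by (rule sums_unique2)
qed

text \<open>A nonzero coefficient needs an integral in its formula, so the support lies in some
  \<open>D j\<close>. A nonempty \<open>D j\<close> is a maximal support: indivisibility puts it
  below a frequency, and every frequency above it lies in some set, which must be \<open>D j\<close>
  again as the sets are not nested.\<close>

lemma fourier_expansion_dominated:
  assumes \<Phi>: "schauder_basis \<Phi>" and exp: "fourier_expansion \<Phi> f a"
  shows "dominated a"
proof -
  obtain D F where dec: "finite_dim_decomp \<Phi> f D F" and
    s: "\<And>k. (\<lambda>j. if j \<in> A_set D k then term_coeff \<Phi> (D j) (F j) k else 0) sums a k"
    using exp unfolding fourier_expansion_def coeffs_of_def by blast
  have rep: "fourier_rep \<Phi> f a" using exp by (simp add: fourier_expansion_def fourier_rep_def)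
  have anti: "i = j" if "D i \<noteq> {}" "D i \<subseteq> D j" for i j
    using dec that unfolding finite_dim_decomp_def by blast
  have below: "\<exists>j. Poly_Mapping.keys k \<subseteq> D j" if k: "a k \<noteq> 0" for k
  proof (rule ccontr)
    assume "\<not> ?thesis"
    then have "A_set D k = {}" by (auto simp: A_set_def K_set_def in_keys_iff)
    then have "(\<lambda>j::nat. 0) sums a k" using s[of k] by simp
    then show False using k by (simp add: sums_iff)
  qed
  show ?thesis
    unfolding dominated_def
  proof (intro allI impI)
    fix k assume k: "a k \<noteq> 0" "k \<noteq> 0"
    obtain j where j: "Poly_Mapping.keys k \<subseteq> D j" using below[OF k(1)] by blast
    then have ne: "D j \<noteq> {}" using k(2) by auto
    have max: "Poly_Mapping.keys k' = D j" if k': "a k' \<noteq> 0" "D j \<subseteq> Poly_Mapping.keys k'" for k'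
    proof -
      obtain i where i: "Poly_Mapping.keys k' \<subseteq> D i" using below[OF k'(1)] by blast
      then have "j = i" using anti[OF ne] k'(2) by blast
      then show ?thesis using i k'(2) by blast
    qed
    obtain k1 where "a k1 \<noteq> 0" "D j \<subseteq> Poly_Mapping.keys k1"
      using decomp_set_below_frequency[OF \<Phi> dec rep ne] by blast
    then have "D j \<in> top_sets a" using ne max unfolding top_sets_def by blast
    then show "\<exists>S\<in>top_sets a. Poly_Mapping.keys k \<subseteq> S" using j by blast
  qed
qed

text \<open>
  If a support loses its dominating set, then all larger supports lie in one of the finitely many
  modified sets, so one of them is maximal.
\<close>

lemma dominated_finite_modification:
  assumes dom: "dominated a" and G: "finite G" "\<And>S. S \<in> G \<Longrightarrow> finite S"
    and b1: "\<And>k. b k \<noteq> 0 \<Longrightarrow> k \<noteq> 0 \<Longrightarrow> \<exists>k'. a k' \<noteq> 0 \<and> Poly_Mapping.keys k' = Poly_Mapping.keys k"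
    and b2: "\<And>k. a k \<noteq> 0 \<Longrightarrow> Poly_Mapping.keys k \<notin> G \<Longrightarrow> b k \<noteq> 0"
  shows "dominated b"
  unfolding dominated_def
proof (intro allI impI)
  fix k assume k: "b k \<noteq> 0" "k \<noteq> 0"
  then have kne: "Poly_Mapping.keys k \<noteq> {}" by simp
  define X where "X = {Poly_Mapping.keys k' | k'. b k' \<noteq> 0 \<and> Poly_Mapping.keys k \<subseteq> Poly_Mapping.keys k'}"
  have top: "\<exists>S'\<in>top_sets a. S \<subseteq> S'" if S: "S \<in> X" for S
  proof -
    obtain k' where k': "b k' \<noteq> 0" "Poly_Mapping.keys k \<subseteq> Poly_Mapping.keys k'" "S = Poly_Mapping.keys k'"
      using S by (auto simp: X_def)
    then have "k' \<noteq> 0" using kne by auto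
    then obtain k'' where k'': "a k'' \<noteq> 0" "Poly_Mapping.keys k'' = Poly_Mapping.keys k'" using b1[OF k'(1)] by blast
    moreover have "k'' \<noteq> 0" using k'' \<open>k' \<noteq> 0\<close> by (metis keys_eq_empty)
    ultimately show ?thesis using dom k'(3) unfolding dominated_def by metis
  qed
  have mem: "S \<in> top_sets b" if S: "S \<in> X" and max: "\<And>S'. S' \<in> X \<Longrightarrow> S \<subseteq> S' \<Longrightarrow> S' = S" for S
    using S max kne unfolding top_sets_def X_def by blast
  show "\<exists>S\<in>top_sets b. Poly_Mapping.keys k \<subseteq> S"
  proof (cases "\<exists>S\<in>X. S \<in> top_sets a")
    \<comment> \<open>A maximal support of \<open>a\<close> that is still a support of
      \<open>b\<close> is maximal for \<open>b\<close>, because larger supports of \<open>b\<close>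
      also lie below maximal ones of \<open>a\<close>.\<close>
    case True
    then obtain S where S: "S \<in> X" "S \<in> top_sets a" by blast
    have "S' = S" if S': "S' \<in> X" "S \<subseteq> S'" for S'
    proof -
      obtain S'' where S'': "S'' \<in> top_sets a" "S' \<subseteq> S''" using top[OF S'(1)] by blast
      then obtain k'' where "a k'' \<noteq> 0" "Poly_Mapping.keys k'' = S''" unfolding top_sets_def by blast
      then have "S'' = S" using S(2) S'(2) S''(2) unfolding top_sets_def by blast
      then show ?thesis using S'(2) S''(2) by blast
    qed
    then have "S \<in> top_sets b" using mem[OF S(1)] by blast
    then show ?thesis using S(1) unfolding X_def by blast
  next
    case False
    have "S \<in> Pow (\<Union>G)" if S: "S \<in> X" for S
    proof -
      obtain S' where S': "S' \<in> top_sets a" "S \<subseteq> S'" using top[OF S] by blast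
      then obtain k' where k': "a k' \<noteq> 0" "Poly_Mapping.keys k' = S'" unfolding top_sets_def by blast
      have "S' \<in> G"
      proof (rule ccontr)
        assume "S' \<notin> G"
        then have "b k' \<noteq> 0" using b2 k' by blast
        then have "S' \<in> X" using k'(2) S S'(2) unfolding X_def by blast
        then show False using False S'(1) by blast
      qed
      then show ?thesis using S'(2) by blast
    qed
    then have "X \<subseteq> Pow (\<Union>G)" by blast
    moreover have "finite (Pow (\<Union>G))" using G by blast
    ultimately have "finite X" by (rule finite_subset)
    moreover have "Poly_Mapping.keys k \<in> X" using k unfolding X_def by blast
    ultimately obtain S where S: "S \<in> X" "Poly_Mapping.keys k \<subseteq> S" "\<And>S'. S' \<in> X \<Longrightarrow> S \<subseteq> S' \<Longrightarrow> S' = S"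
      by (metis finite_has_maximal2)
    then show ?thesis using mem by blast
  qed
qed

subsection \<open>Approximation by triangle waves\<close>

lemma frag_cmul_inj: "k \<noteq> 0 \<Longrightarrow> frag_cmul q k = frag_cmul q' k \<longleftrightarrow> q = q'"
proof
  assume "k \<noteq> 0" and e: "frag_cmul q k = frag_cmul q' k"
  then obtain i where "Poly_Mapping.lookup k i \<noteq> 0" by (metis poly_mapping_eqI lookup_zero)
  then show "q = q'" using arg_cong[OF e, of "\<lambda>p. Poly_Mapping.lookup p i"] by simp
qed simp

lemma keys_frag_cmul_eq: "q \<noteq> 0 \<Longrightarrow> Poly_Mapping.keys (frag_cmul q k) = Poly_Mapping.keys k"
  by (auto simp: in_keys_iff)

lemma ridge_frag_cmul: "ridge \<Phi> (frag_cmul q k) v = of_int q * ridge \<Phi> k v"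
  by (cases "q = 0") (simp_all add: ridge_def keys_frag_cmul_eq sum_distrib_left mult.assoc)

lemma norm1_frag_cmul: "norm1 (frag_cmul q k) = \<bar>of_int q\<bar> * norm1 k"
  by (cases "q = 0") (simp_all add: norm1_def keys_frag_cmul_eq sum_distrib_left abs_mult)

lemma weight_frag_cmul: "q \<noteq> 0 \<Longrightarrow> weight (frag_cmul q k) \<le> (of_int q)\<^sup>2 * weight k"
proof -
  assume "q \<noteq> 0"
  then have "1 \<le> q\<^sup>2" by (simp add: power2_eq_square int_one_le_iff_zero_less zero_less_mult_iff) linarith
  then have "1 \<le> (of_int q :: real)\<^sup>2" by (metis of_int_1_le_iff of_int_power)
  then show ?thesis by (simp add: weight_def norm1_frag_cmul power_mult_distrib distrib_left)
qed

lemma has_sum_multiples: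
  assumes k: "k \<noteq> 0" and f: "((\<lambda>q. f (frag_cmul q k)) has_sum s) UNIV"
    and z: "\<And>k'. k' \<notin> range (\<lambda>q. frag_cmul q k) \<Longrightarrow> f k' = 0"
  shows "(f has_sum s) UNIV"
proof -
  have "inj (\<lambda>q. frag_cmul q k)" using frag_cmul_inj[OF k] by (auto simp: inj_def)
  then have "(f has_sum s) (range (\<lambda>q. frag_cmul q k))"
    using f by (simp add: has_sum_reindex o_def)
  then show ?thesis
    by (rule has_sum_cong_neutral[THEN iffD1, rotated -1]) (use z in auto)
qed

text \<open>
  Fourier coefficients of \<open>tri (ridge \<Phi> k v - \<theta>)\<close>; for \<open>k \<noteq> 0\<close> the sum has at most one term.
\<close>

definition wave_coeff :: "(nat \<Rightarrow>\<^sub>0 int) \<Rightarrow> real \<Rightarrow> (nat \<Rightarrow>\<^sub>0 int) \<Rightarrow> complex" where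
  "wave_coeff k \<theta> k' = (\<Sum>q | frag_cmul q k = k'. of_real (tri_coeff q) * cis (- (2 * pi * of_int q * \<theta>)))"

lemma wave_coeff_multiple:
  "k \<noteq> 0 \<Longrightarrow> wave_coeff k \<theta> (frag_cmul q k) = of_real (tri_coeff q) * cis (- (2 * pi * of_int q * \<theta>))"
  by (simp add: wave_coeff_def frag_cmul_inj)

lemma wave_coeff_other: "k' \<notin> range (\<lambda>q. frag_cmul q k) \<Longrightarrow> wave_coeff k \<theta> k' = 0"
  unfolding wave_coeff_def by (intro sum.neutral) auto

lemma wave_coeff_nonzero:
  assumes "k \<noteq> 0" "wave_coeff k \<theta> k' \<noteq> 0"
  shows "\<exists>q. q \<noteq> 0 \<and> k' = frag_cmul q k"
proof -
  obtain q where q: "k' = frag_cmul q k" using assms(2) wave_coeff_other by blast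
  have "q \<noteq> 0" using assms wave_coeff_multiple[OF assms(1), of \<theta> q] by (auto simp: q tri_coeff_def)
  then show ?thesis using q by blast
qed

lemma wave_coeff_keys: "k \<noteq> 0 \<Longrightarrow> wave_coeff k \<theta> k' \<noteq> 0 \<Longrightarrow> Poly_Mapping.keys k' = Poly_Mapping.keys k"
  using wave_coeff_nonzero keys_frag_cmul_eq by metis

lemma wave_coeff_uminus:
  assumes k: "k \<noteq> 0"
  shows "wave_coeff k \<theta> (- k') = cnj (wave_coeff k \<theta> k')"
proof (cases "k' \<in> range (\<lambda>q. frag_cmul q k)")
  case True
  then obtain q where q: "k' = frag_cmul q k" by blast
  have "- k' = frag_cmul (- q) k" by (rule poly_mapping_eqI) (simp add: q)
  then show ?thesis using k by (simp add: q wave_coeff_multiple cis_cnj tri_coeff_def)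
next
  case False
  have "- k' \<notin> range (\<lambda>q. frag_cmul q k)"
  proof
    assume "- k' \<in> range (\<lambda>q. frag_cmul q k)"
    then obtain q where q: "- k' = frag_cmul q k" by blast
    have "k' = - frag_cmul q k" using q by (metis minus_minus)
    also have "\<dots> = frag_cmul (- q) k" by (rule poly_mapping_eqI) simp
    finally have "k' = frag_cmul (- q) k" .
    then show False using False by blast
  qed
  then show ?thesis using False by (simp add: wave_coeff_other)
qed

lemma wave_coeff_has_sum:
  assumes k: "k \<noteq> 0"
  shows "((\<lambda>k'. wave_coeff k \<theta> k' * fourier_basis \<Phi> k' v) has_sum of_real (tri (ridge \<Phi> k v - \<theta>))) UNIV"
proof (rule has_sum_multiples[OF k])
  have "wave_coeff k \<theta> (frag_cmul q k) * fourier_basis \<Phi> (frag_cmul q k) v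
      = of_real (tri_coeff q) * cis (2 * pi * of_int q * (ridge \<Phi> k v - \<theta>))" for q
    by (simp add: wave_coeff_multiple[OF k] fourier_basis_cis ridge_frag_cmul mult.assoc cis_mult algebra_simps)
  then show "((\<lambda>q. wave_coeff k \<theta> (frag_cmul q k) * fourier_basis \<Phi> (frag_cmul q k) v) has_sum
      of_real (tri (ridge \<Phi> k v - \<theta>))) UNIV"
    using tri_fourier[of "ridge \<Phi> k v - \<theta>"] by simp
qed (simp add: wave_coeff_other)

text \<open>All characters are 1 at the argument 0, where the wave has the value 1.\<close>

lemma tri_coeff_sum: "(tri_coeff has_sum 1) UNIV"
proof -
  have "((\<lambda>q. complex_of_real (tri_coeff q)) has_sum of_real (tri 0)) UNIV"
    using tri_fourier[of 0] by simp
  then show ?thesis by (simp only: has_sum_of_real_iff) (simp add: tri_def)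
qed

lemma tri_coeff_nonneg: "tri_coeff q \<ge> 0"
  by (simp add: tri_coeff_def)

text \<open>The weight of a multiple grows at most like \<open>q\<^sup>2\<close>, which one factor
  \<open>tri_coeff q\<close> cancels up to \<open>4 / pi\<^sup>2\<close>. The other factor remains
  and is summable with sum 1.\<close>

lemma weight_tri_coeff_le: "weight (frag_cmul q k) * (tri_coeff q)\<^sup>2 \<le> 4 / pi\<^sup>2 * weight k * tri_coeff q"
proof (cases "even q")
  case False
  then have q: "q \<noteq> 0" by auto
  have "weight (frag_cmul q k) * (tri_coeff q)\<^sup>2 \<le> (of_int q)\<^sup>2 * weight k * (tri_coeff q)\<^sup>2"
    by (intro mult_right_mono weight_frag_cmul q) simp
  also have "(of_int q)\<^sup>2 * weight k * (tri_coeff q)\<^sup>2 = (of_int q)\<^sup>2 * tri_coeff q * (weight k * tri_coeff q)"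
    by (simp add: power2_eq_square)
  also have "(of_int q)\<^sup>2 * tri_coeff q = 4 / pi\<^sup>2" using False q by (simp add: tri_coeff_def)
  finally show ?thesis by (simp add: mult.assoc)
qed (simp add: tri_coeff_def)

lemma sq_norm_wave_coeff:
  assumes k: "k \<noteq> 0"
  shows "sq_summable (wave_coeff k \<theta>)" "sq_norm (wave_coeff k \<theta>) \<le> 4 / pi\<^sup>2 * weight k"
proof -
  \<comment> \<open>Summing over the at most one \<open>q\<close> with
    \<open>frag_cmul q k = k'\<close> defines a family on the multiples of \<open>k\<close> that is
    0 elsewhere.\<close>
  define g where "g k' = (\<Sum>q | frag_cmul q k = k'. 4 / pi\<^sup>2 * weight k * tri_coeff q)" for k'
  have g: "g (frag_cmul q k) = 4 / pi\<^sup>2 * weight k * tri_coeff q" for q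
    by (simp add: g_def frag_cmul_inj[OF k])
  have g0: "g k' = 0" if "k' \<notin> range (\<lambda>q. frag_cmul q k)" for k'
    unfolding g_def using that by (intro sum.neutral) auto
  have "(g has_sum (4 / pi\<^sup>2 * weight k * 1)) UNIV"
    by (rule has_sum_multiples[OF k]) (simp only: g has_sum_cmult_right[OF tri_coeff_sum], rule g0)
  moreover have "weight k' * (cmod (wave_coeff k \<theta> k'))\<^sup>2 \<le> g k'" for k'
  proof (cases "k' \<in> range (\<lambda>q. frag_cmul q k)")
    case True
    then obtain q where q: "k' = frag_cmul q k" by blast
    show ?thesis unfolding q wave_coeff_multiple[OF k] g
      using weight_tri_coeff_le[of q k] by (simp add: norm_mult power_mult_distrib)
  qed (simp add: g0 wave_coeff_other)
  ultimately show "sq_summable (wave_coeff k \<theta>)" "sq_norm (wave_coeff k \<theta>) \<le> 4 / pi\<^sup>2 * weight k"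
    using sq_norm_mono by fastforce+
qed

section \<open>Cosines as averages of shifted triangle waves\<close>

lemma root_of_unity_sum:
  fixes n :: nat and q :: int
  defines "N \<equiv> 2 * int n + 1"
  shows "(\<Sum>x\<in>{-int n..int n}. cis (2 * pi * of_int q * of_int x / of_int N))
       = (if N dvd q then of_int N else 0)"
proof -
  have "cis (2 * pi * of_int q * of_int x / of_int N) = exp (2 * of_real pi * \<i> * of_int q * of_real (of_int x / of_int N))" for x
    unfolding cis_conv_exp by (intro arg_cong[where f = exp]) (simp add: mult_ac)
  then show ?thesis using grid_character_sum[of q n] by (simp only: N_def)
qed

text \<open>A discrete convolution: with equidistant shifts and cosine weights, the sums over roots
  of unity leave only the multiples \<open>q\<close> congruent to 1 or -1 modulo \<open>N\<close>.
  The factor is chosen such that \<open>pi\<^sup>2 / 8 * tri_coeff 1 = 1 / 2\<close>.\<close>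

lemma wave_superposition:
  fixes n :: nat and z :: complex
  assumes k: "k \<noteq> 0"
  defines "N \<equiv> 2 * int n + 1"
  defines "\<mu> \<equiv> \<lambda>x::int. pi\<^sup>2 / (4 * of_int N) * Re (z * cis (2 * pi * of_int x / of_int N))"
  shows "(\<Sum>x\<in>{-int n..int n}. of_real (\<mu> x) * wave_coeff k (of_int x / of_int N) (frag_cmul q k))
       = of_real (pi\<^sup>2 / 8 * tri_coeff q) * ((if N dvd 1 - q then z else 0) + (if N dvd 1 + q then cnj z else 0))"
proof -
  have N: "N > 0" by (simp add: N_def)
  define e where "e p x = cis (2 * pi * of_int p * of_int x / of_int N)" for p x :: int
  have "of_real (\<mu> x) * wave_coeff k (of_int x / of_int N) (frag_cmul q k)
      = of_real (pi\<^sup>2 / 8 * tri_coeff q) / of_int N * (z * e (1 - q) x + cnj z * e (- (1 + q)) x)" for x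
  proof -
    have "2 * complex_of_real (Re (z * e 1 x)) = z * e 1 x + cnj z * e (- 1) x"
    proof -
      have "cnj z * e (- 1) x = cnj (z * e 1 x)" by (simp add: e_def cis_cnj)
      then show ?thesis by (simp only: complex_add_cnj) simp
    qed
    moreover have "e 1 x * e (- q) x = e (1 - q) x" "e (- 1) x * e (- q) x = e (- (1 + q)) x"
      unfolding e_def cis_mult by (intro arg_cong[where f = cis]; simp add: algebra_simps diff_divide_distrib add_divide_distrib)+
    ultimately have w1: "2 * complex_of_real (Re (z * e 1 x)) * e (- q) x = z * e (1 - q) x + cnj z * e (- (1 + q)) x"
      by (simp only: distrib_right mult.assoc)
    have w2: "wave_coeff k (of_int x / of_int N) (frag_cmul q k) = of_real (tri_coeff q) * e (- q) x"
      by (simp add: wave_coeff_multiple[OF k] e_def mult.assoc)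
    have w3: "complex_of_real (\<mu> x) = of_real (pi\<^sup>2 / 8) / of_int N * (2 * complex_of_real (Re (z * e 1 x)))"
    proof -
      define R where "R = Re (z * e 1 x)"
      have "\<mu> x = pi\<^sup>2 / (4 * of_int N) * R" unfolding R_def by (simp only: \<mu>_def e_def of_int_1 mult_1_right)
      then have "complex_of_real (\<mu> x) = of_real (pi\<^sup>2 / 8) / of_int N * (2 * complex_of_real R)" by simp
      then show ?thesis unfolding R_def .
    qed
    have "of_real (\<mu> x) * wave_coeff k (of_int x / of_int N) (frag_cmul q k)
        = of_real (pi\<^sup>2 / 8 * tri_coeff q) / of_int N * (2 * complex_of_real (Re (z * e 1 x)) * e (- q) x)"
      unfolding w2 w3 by (simp only: of_real_mult of_real_divide mult_ac times_divide_eq_left times_divide_eq_right)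
    then show ?thesis unfolding w1 .
  qed
  then have "(\<Sum>x\<in>{-int n..int n}. of_real (\<mu> x) * wave_coeff k (of_int x / of_int N) (frag_cmul q k))
      = of_real (pi\<^sup>2 / 8 * tri_coeff q) / of_int N *
        (z * (\<Sum>x\<in>{-int n..int n}. e (1 - q) x) + cnj z * (\<Sum>x\<in>{-int n..int n}. e (- (1 + q)) x))"
    by (simp only: sum_distrib_left[symmetric] sum.distrib)
  also have "(\<Sum>x\<in>{-int n..int n}. e (1 - q) x) = (if N dvd 1 - q then of_int N else 0)"
    unfolding e_def N_def by (rule root_of_unity_sum)
  also have "(\<Sum>x\<in>{-int n..int n}. e (- (1 + q)) x) = (if N dvd 1 + q then of_int N else 0)"
    unfolding e_def N_def by (subst root_of_unity_sum) (simp only: dvd_minus_iff)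
  also have "C / of_int N * (z * (if N dvd 1 - q then of_int N else 0) + cnj z * (if N dvd 1 + q then of_int N else 0))
      = C * ((if N dvd 1 - q then z else 0) + (if N dvd 1 + q then cnj z else 0))" for C
    using N by (cases "N dvd 1 - q"; cases "N dvd 1 + q") (simp_all add: field_simps)
  finally show ?thesis .
qed

text \<open>The target has the two coefficients of \<open>Re (z * fourier_basis \<Phi> k v)\<close>.
  The weighted waves reproduce them exactly; the error consists of the further \<open>q\<close>
  congruent to 1 or -1 modulo \<open>N\<close>, which for large \<open>N\<close> lie in the tail of
  the summable \<open>tri_coeff\<close>.\<close>

lemma wave_discretization:
  fixes z :: complex
  assumes k: "k \<noteq> 0" and \<epsilon>: "\<epsilon> > 0"
  shows "\<exists>(n::nat) \<mu>. (\<forall>x. \<bar>\<mu> x\<bar> \<le> pi\<^sup>2 * cmod z / (4 * real (2 * n + 1))) \<and>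
    sq_summable (\<lambda>k'. (if k' = k then z / 2 else 0) + (if k' = - k then cnj z / 2 else 0)
      - (\<Sum>x\<in>{-int n..int n}. of_real (\<mu> x) * wave_coeff k (of_int x / real (2 * n + 1)) k')) \<and>
    sq_norm (\<lambda>k'. (if k' = k then z / 2 else 0) + (if k' = - k then cnj z / 2 else 0)
      - (\<Sum>x\<in>{-int n..int n}. of_real (\<mu> x) * wave_coeff k (of_int x / real (2 * n + 1)) k')) \<le> \<epsilon>"
proof -
  \<comment> \<open>\<open>pi\<^sup>2 / 4\<close> is the square of the factor
    \<open>pi\<^sup>2 / 4\<close> in \<open>dle\<close>, times the \<open>4 / pi\<^sup>2\<close> of
    \<open>weight_tri_coeff_le\<close>.\<close>
  define C where "C = weight k * (cmod z)\<^sup>2 * (pi\<^sup>2 / 4)"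
  have C: "C \<ge> 0" using weight_ge_1[of k] by (simp add: C_def)
  define \<delta> where "\<delta> = \<epsilon> / (C + 1)"
  have \<delta>: "\<delta> > 0" "C * \<delta> \<le> \<epsilon>" using C \<epsilon> by (auto simp: \<delta>_def field_simps)
  obtain X where X: "finite X" "1 - \<delta> \<le> (\<Sum>q\<in>X. tri_coeff q)"
  proof -
    have "\<forall>\<^sub>F X in finite_subsets_at_top UNIV. dist (\<Sum>q\<in>X. tri_coeff q) 1 < \<delta>"
      using tri_coeff_sum \<delta>(1) unfolding has_sum_def by (rule tendstoD)
    then obtain X where "finite X" "dist (\<Sum>q\<in>X. tri_coeff q) 1 < \<delta>"
      unfolding eventually_finite_subsets_at_top by blast
    then show thesis using that[of X] by (auto simp: dist_real_def)
  qed
  \<comment> \<open>\<open>n \<ge> 1\<close> gives \<open>N \<ge> 3\<close>, so 1 and -1 are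
    distinct residues; \<open>\<bar>q\<bar> \<le> n\<close> on \<open>X\<close> excludes aliases
    there.\<close>
  define n where "n = nat (Max (insert 1 (abs ` X)))"
  have n1: "n \<ge> 1" and nX: "\<And>q. q \<in> X \<Longrightarrow> \<bar>q\<bar> \<le> int n"
  proof -
    have "1 \<le> Max (insert 1 (abs ` X))" using X(1) by simp
    then show "n \<ge> 1" by (simp add: n_def)
    show "\<bar>q\<bar> \<le> int n" if "q \<in> X" for q
    proof -
      have "\<bar>q\<bar> \<le> Max (insert 1 (abs ` X))" using X(1) that by (intro Max_ge) auto
      then show ?thesis unfolding n_def by linarith
    qed
  qed
  define N where "N = 2 * int n + 1"
  have Nr: "real (2 * n + 1) = of_int N" by (simp add: N_def)
  define \<mu> where "\<mu> x = pi\<^sup>2 / (4 * of_int N) * Re (z * cis (2 * pi * of_int x / of_int N))" for x :: int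
  define T where "T k' = (if k' = k then z / 2 else 0) + (if k' = - k then cnj z / 2 else 0)" for k'
  define d where "d k' = T k' - (\<Sum>x\<in>{-int n..int n}. of_real (\<mu> x) * wave_coeff k (of_int x / of_int N) k')" for k'
  have km: "frag_cmul 1 k = k" "frag_cmul (- 1) k = - k" by (rule poly_mapping_eqI, simp)+
  have Tq: "T (frag_cmul q k) = (if q = 1 then z / 2 else 0) + (if q = - 1 then cnj z / 2 else 0)" for q
  proof -
    have "frag_cmul q k = k \<longleftrightarrow> q = 1" "frag_cmul q k = - k \<longleftrightarrow> q = - 1"
      using frag_cmul_inj[OF k, of q 1] frag_cmul_inj[OF k, of q "- 1"] unfolding km by auto
    then show ?thesis by (simp add: T_def)
  qed
  have dq: "d (frag_cmul q k) = (if q = 1 then z / 2 else 0) + (if q = - 1 then cnj z / 2 else 0)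
      - of_real (pi\<^sup>2 / 8 * tri_coeff q) * ((if N dvd 1 - q then z else 0) + (if N dvd 1 + q then cnj z else 0))" for q
    unfolding d_def Tq \<mu>_def using wave_superposition[OF k, of n z q] by (simp add: N_def)
  have t1: "tri_coeff 1 = 4 / pi\<^sup>2" "tri_coeff (- 1) = 4 / pi\<^sup>2" by (simp_all add: tri_coeff_def)
  have N2: "\<not> N dvd 2" using n1 by (auto simp: N_def dest: zdvd_imp_le)
  have d1: "d (frag_cmul q k) = 0" if q: "q = 1 \<or> q = - 1" for q
  proof -
    have p: "complex_of_real (pi\<^sup>2 / 8 * (4 / pi\<^sup>2)) = 1 / 2" by simp
    show ?thesis using q
    proof
      assume "q = 1"
      then show ?thesis using N2 unfolding dq by (simp only: t1 p) simp
    next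
      assume "q = - 1"
      then show ?thesis using N2 unfolding dq by (simp only: t1 p) simp
    qed
  qed
  have dX: "d (frag_cmul q k) = 0" if q: "q \<in> X" for q
  proof (cases "q = 1 \<or> q = - 1")
    case False
    have "\<bar>q\<bar> \<le> int n" by (rule nX[OF q])
    then have "\<not> N dvd 1 - q" "\<not> N dvd 1 + q"
      using False n1 dvd_imp_le_int[of "1 - q" N] dvd_imp_le_int[of "1 + q" N] by (auto simp: N_def)
    then show ?thesis using False unfolding dq by simp
  qed (rule d1)
  have dle: "cmod (d (frag_cmul q k)) \<le> pi\<^sup>2 / 4 * cmod z * tri_coeff q" for q
  proof (cases "q = 1 \<or> q = - 1")
    case True
    then show ?thesis using tri_coeff_nonneg[of q] by (simp add: d1)
  next
    case False
    define w where "w = (if N dvd 1 - q then z else 0) + (if N dvd 1 + q then cnj z else 0)"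
    have "cmod w \<le> cmod z + cmod z"
      unfolding w_def by (rule order_trans[OF norm_triangle_ineq]) (intro add_mono; simp)
    from mult_left_mono[OF this, of "pi\<^sup>2 / 8 * tri_coeff q"] tri_coeff_nonneg[of q]
    have "pi\<^sup>2 / 8 * tri_coeff q * cmod w \<le> pi\<^sup>2 / 4 * cmod z * tri_coeff q" by (simp add: mult_ac)
    moreover have "d (frag_cmul q k) = - (of_real (pi\<^sup>2 / 8 * tri_coeff q) * w)"
      unfolding dq w_def[symmetric] using False by simp
    then have "cmod (d (frag_cmul q k)) = pi\<^sup>2 / 8 * tri_coeff q * cmod w"
      using tri_coeff_nonneg[of q] by (simp only: norm_minus_cancel norm_mult norm_of_real abs_mult) simp
    ultimately show ?thesis by linarith
  qed
  define g where "g k' = (\<Sum>q | frag_cmul q k = k'. if q \<in> X then 0 else C * tri_coeff q)" for k'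
  have g: "g (frag_cmul q k) = (if q \<in> X then 0 else C * tri_coeff q)" for q
    by (simp add: g_def frag_cmul_inj[OF k])
  have g0: "g k' = 0" if "k' \<notin> range (\<lambda>q. frag_cmul q k)" for k'
    unfolding g_def using that by (intro sum.neutral) auto
  have "((\<lambda>q. C * tri_coeff q) has_sum (C * 1 - (\<Sum>q\<in>X. C * tri_coeff q))) (UNIV - X)"
    by (intro has_sum_Diff has_sum_cmult_right tri_coeff_sum has_sum_finite X) simp
  then have "((\<lambda>q. if q \<in> X then 0 else C * tri_coeff q) has_sum (C * (1 - (\<Sum>q\<in>X. tri_coeff q)))) UNIV"
    unfolding sum_distrib_left[symmetric] right_diff_distrib[symmetric]
    by (rule has_sum_cong_neutral[THEN iffD1, rotated -1]) auto
  then have gs: "(g has_sum (C * (1 - (\<Sum>q\<in>X. tri_coeff q)))) UNIV"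
    by (intro has_sum_multiples[OF k]) (simp only: g, rule g0)
  have dg: "weight k' * (cmod (d k'))\<^sup>2 \<le> g k'" for k'
  proof (cases "k' \<in> range (\<lambda>q. frag_cmul q k)")
    case True
    then obtain q where q: "k' = frag_cmul q k" by blast
    show ?thesis
    proof (cases "q \<in> X")
      case False
      have w0: "weight (frag_cmul q k) \<ge> 0" using weight_ge_1[of "frag_cmul q k"] by linarith
      have "weight (frag_cmul q k) * (cmod (d (frag_cmul q k)))\<^sup>2
          \<le> weight (frag_cmul q k) * (pi\<^sup>2 / 4 * cmod z * tri_coeff q)\<^sup>2"
        by (intro mult_left_mono power_mono dle w0) simp
      also have "\<dots> = (pi\<^sup>2 / 4 * cmod z)\<^sup>2 * (weight (frag_cmul q k) * (tri_coeff q)\<^sup>2)"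
        by (simp add: power_mult_distrib power_divide)
      also have "\<dots> \<le> (pi\<^sup>2 / 4 * cmod z)\<^sup>2 * (4 / pi\<^sup>2 * weight k * tri_coeff q)"
        by (intro mult_left_mono weight_tri_coeff_le) simp
      also have "\<dots> = C * tri_coeff q"
        by (simp add: C_def power2_eq_square)
      finally show ?thesis using False by (simp add: q g)
    qed (simp add: q g dX)
  next
    case False
    then have "k' \<noteq> k" "k' \<noteq> - k" using km by (metis rangeI)+
    then have "d k' = 0" using False by (simp add: d_def T_def wave_coeff_other)
    then show ?thesis by (simp add: g0[OF False])
  qed
  have "C * (1 - (\<Sum>q\<in>X. tri_coeff q)) \<le> C * \<delta>" using X(2) C by (intro mult_left_mono) auto
  then have "sq_summable d" "sq_norm d \<le> \<epsilon>" using sq_norm_mono[OF gs dg] \<delta>(2) by auto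
  moreover have "\<bar>\<mu> x\<bar> \<le> pi\<^sup>2 * cmod z / (4 * of_int N)" for x
  proof -
    have "\<bar>Re (z * cis (2 * pi * of_int x / of_int N))\<bar> \<le> cmod (z * cis (2 * pi * of_int x / of_int N))"
      by (rule abs_Re_le_cmod)
    then have "\<bar>Re (z * cis (2 * pi * of_int x / of_int N))\<bar> \<le> cmod z" by (simp add: norm_mult)
    from mult_left_mono[OF this, of "pi\<^sup>2 / (4 * of_int N)"] show ?thesis by (simp add: \<mu>_def abs_mult N_def)
  qed
  ultimately show ?thesis
    unfolding d_def T_def Nr[symmetric] by blast
qed

section \<open>Truncation and sampling of the coefficient family\<close>

lemma sq_norm_add_le:
  assumes "sq_summable u" "sq_summable v"
  shows "sq_norm (\<lambda>k. u k + v k) \<le> 2 * (sq_norm u + sq_norm v)"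
  using sq_norm_sum(2)[of "{True, False}" "\<lambda>b. if b then u else v"] assms by simp

lemma four_pi_sq_norm1_le_weight: "4 * pi\<^sup>2 * (norm1 k)\<^sup>2 \<le> weight k"
  by (simp add: weight_def power_mult_distrib)

text \<open>Each frequency contributes half of its coefficient at \<open>k\<close> and the conjugate
  half at \<open>- k\<close>; on a symmetric set the halves add up to the full coefficients.\<close>

lemma hermitian_pair_sum:
  fixes a :: "(nat \<Rightarrow>\<^sub>0 int) \<Rightarrow> complex"
  assumes herm: "\<And>k. a (- k) = cnj (a k)" and F: "finite F" "\<And>k. k \<in> F \<Longrightarrow> - k \<in> F"
  shows "(\<Sum>k\<in>F. (if k' = k then a k / 2 else 0) + (if k' = - k then cnj (a k) / 2 else 0))
       = (if k' \<in> F then a k' else (0::complex))"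
proof -
  have "(\<Sum>k\<in>F. if k' = - k then cnj (a k) / 2 else 0) = (\<Sum>k\<in>F. if k = - k' then a k' / 2 else 0)"
  proof (intro sum.cong refl)
    fix k
    have "k' = - k \<longleftrightarrow> k = - k'" by (rule equation_minus_iff)
    then show "(if k' = - k then cnj (a k) / 2 else 0) = (if k = - k' then a k' / 2 else 0)"
      by (simp add: herm)
  qed
  moreover have "- k' \<in> F \<longleftrightarrow> k' \<in> F" using F(2) by (metis minus_minus)
  ultimately show ?thesis using F(1) by (simp add: sum.distrib sum.delta)
qed

text \<open>A finite set with small tail is made symmetric and cleared of vanishing coefficients, so
  that every frequency drawn from it is admissible for the network. The zero frequency is left to
  the constant of the network.\<close>

lemma frequency_truncation:
  fixes a :: "(nat \<Rightarrow>\<^sub>0 int) \<Rightarrow> complex"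
  assumes herm: "\<And>k. a (- k) = cnj (a k)"
    and a: "sq_summable a" and \<delta>: "\<delta> > 0"
  shows "\<exists>F. finite F \<and> (\<forall>k\<in>F. k \<noteq> 0 \<and> a k \<noteq> 0 \<and> - k \<in> F) \<and>
           sq_summable (\<lambda>k. if k = 0 \<or> k \<in> F then 0 else a k) \<and>
           sq_norm (\<lambda>k. if k = 0 \<or> k \<in> F then 0 else a k) \<le> \<delta>"
proof -
  define g where "g k = weight k * (cmod (a k))\<^sup>2" for k
  have g: "(g has_sum sq_norm a) UNIV" using sq_summable_has_sum[OF a] by (simp add: g_def[abs_def])
  have g0: "g k \<ge> 0" for k using weight_ge_1[of k] by (simp add: g_def)
  have "\<forall>\<^sub>F X in finite_subsets_at_top UNIV. dist (sum g X) (sq_norm a) < \<delta>"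
    using g \<delta> unfolding has_sum_def by (rule tendstoD)
  then obtain X where X: "finite X" "dist (sum g X) (sq_norm a) < \<delta>"
    unfolding eventually_finite_subsets_at_top by blast
  define F where "F = {k \<in> X \<union> uminus ` X. k \<noteq> 0 \<and> a k \<noteq> 0}"
  have "(g has_sum (sq_norm a - sum g X)) (UNIV - X)"
    by (intro has_sum_Diff g has_sum_finite X) simp
  then have s: "((\<lambda>k. if k \<in> X then 0 else g k) has_sum (sq_norm a - sum g X)) UNIV"
    by (rule has_sum_cong_neutral[THEN iffD1, rotated -1]) auto
  have t: "weight k * (cmod (if k = 0 \<or> k \<in> F then 0 else a k))\<^sup>2 \<le> (if k \<in> X then 0 else g k)" for k
    using g0[of k] by (auto simp: F_def g_def)
  have "sq_norm a - sum g X \<le> \<delta>" using X(2) by (simp add: dist_real_def)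
  moreover have "finite F" using X(1) by (simp add: F_def)
  moreover have "\<forall>k\<in>F. k \<noteq> 0 \<and> a k \<noteq> 0 \<and> - k \<in> F" by (auto simp: F_def herm)
  ultimately show ?thesis using sq_norm_mono[OF s t] by (intro exI[of _ F]) auto
qed

text \<open>
  A wave of frequency \<open>k\<close> costs about \<open>norm1 k\<close> neurons. Sampling \<open>k\<close> with probability proportional
  to \<open>weight k * cmod (a k) / norm1 k\<close> balances this cost against the variance.
\<close>

lemma sampled_waves:
  fixes a :: "(nat \<Rightarrow>\<^sub>0 int) \<Rightarrow> complex"
  assumes herm: "\<And>k. a (- k) = cnj (a k)"
    and F: "finite F" "\<And>k. k \<in> F \<Longrightarrow> k \<noteq> 0 \<and> a k \<noteq> 0 \<and> - k \<in> F"
    and B: "(\<Sum>k\<in>F. weight k * cmod (a k)) \<le> B" "B > 0" and m: "m \<ge> 1" and \<delta>: "\<delta> > 0"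
  defines "Z \<equiv> \<Sum>k\<in>F. weight k * cmod (a k) / norm1 k"
  assumes Z: "9 * B \<le> Z * real m"
  shows "\<exists>(n::nat) \<mu> \<kappa> \<theta>. (\<forall>j<n. \<kappa> j \<in> F) \<and>
     (\<Sum>j<n. 2 * norm1 (\<kappa> j) + 1) \<le> real m \<and> (\<Sum>j<n. \<bar>\<mu> j\<bar> * (20 * (norm1 (\<kappa> j))\<^sup>2)) \<le> 4 * B \<and>
     sq_summable (\<lambda>k. (if k \<in> F then a k else 0) - (\<Sum>j<n. of_real (\<mu> j) * wave_coeff (\<kappa> j) (\<theta> j) k)) \<and>
     sq_norm (\<lambda>k. (if k \<in> F then a k else 0) - (\<Sum>j<n. of_real (\<mu> j) * wave_coeff (\<kappa> j) (\<theta> j) k))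
       \<le> 2 * (\<delta> + 10 * B\<^sup>2 / real m)"
proof -
  have Zpos: "Z > 0"
  proof (rule ccontr)
    assume "\<not> Z > 0"
    then have "Z * real m \<le> 0" by (intro mult_nonpos_nonneg) auto
    then show False using Z B(2) by linarith
  qed
  have Fne: "F \<noteq> {}" using Zpos by (auto simp: Z_def)
  define T where "T k k' = (if k' = k then a k / 2 else 0) + (if k' = - k then cnj (a k) / 2 else 0)" for k k'
  \<comment> \<open>One factor \<open>card F\<close> pays for the number of summands, the other for
    the constant in \<open>sq_norm_sum\<close>.\<close>
  define \<epsilon> where "\<epsilon> = \<delta> / (real (card F))\<^sup>2"
  have \<epsilon>: "\<epsilon> > 0" using Fne F(1) \<delta> by (simp add: \<epsilon>_def card_gt_0_iff)
  define D where "D k n \<mu> k' = T k k' - (\<Sum>x\<in>{-int n..int n}. of_real (\<mu> x) * wave_coeff k (of_int x / real (2 * n + 1)) k')"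
    for k and n :: nat and \<mu> k'
  define G where "G k p \<longleftrightarrow> (\<forall>x. \<bar>snd p x\<bar> \<le> pi\<^sup>2 * cmod (a k) / (4 * real (2 * fst p + 1))) \<and>
    sq_summable (D k (fst p) (snd p)) \<and> sq_norm (D k (fst p) (snd p)) \<le> \<epsilon>" for k and p :: "nat \<times> (int \<Rightarrow> real)"
  have "\<exists>p. G k p" if k: "k \<in> F" for k
  proof -
    have "k \<noteq> 0" using F(2)[OF k] by blast
    from wave_discretization[OF this \<epsilon>, of "a k"] obtain n \<mu> where "G k (n, \<mu>)"
      unfolding G_def D_def[abs_def] T_def fst_conv snd_conv by blast
    then show ?thesis by blast
  qed
  then have "\<forall>k\<in>F. \<exists>p. G k p" by blast
  from bchoice[OF this] obtain p where p: "\<And>k. k \<in> F \<Longrightarrow> G k (p k)" by blast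
  define \<nu> where "\<nu> k = fst (p k)" for k
  define \<mu> where "\<mu> k = snd (p k)" for k
  have \<mu>: "\<bar>\<mu> k x\<bar> \<le> pi\<^sup>2 * cmod (a k) / (4 * real (2 * \<nu> k + 1))"
    and d1: "sq_summable (D k (\<nu> k) (\<mu> k))" and d2: "sq_norm (D k (\<nu> k) (\<mu> k)) \<le> \<epsilon>" if "k \<in> F" for k x
    using p[OF that] by (simp_all add: G_def \<nu>_def \<mu>_def)
  define J where "J k = {-int (\<nu> k)..int (\<nu> k)}" for k
  define P where "P k = real (2 * \<nu> k + 1)" for k
  have P: "P k > 0" "real (card (J k)) = P k" and P0: "P k \<noteq> 0" for k by (simp_all add: P_def J_def)
  define I where "I = Sigma F J"
  have SI: "sum h I = (\<Sum>k\<in>F. \<Sum>x\<in>J k. h (k, x))" for h :: "_ \<Rightarrow> 'z::comm_monoid_add"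
    unfolding I_def using F(1) by (subst sum.Sigma) (auto simp: J_def)
  have w: "weight k \<ge> 1" for k by (rule weight_ge_1)
  have K1: "norm1 k \<ge> 1" if "k \<in> F" for k using F(2)[OF that] by (intro norm1_ge_1) auto
  define \<rho> where "\<rho> k = weight k * cmod (a k) / (norm1 k * Z)" for k
  have \<rho>: "\<rho> k > 0" if "k \<in> F" for k
    using F(2)[OF that] K1[OF that] w[of k] Zpos by (auto simp: \<rho>_def intro!: divide_pos_pos mult_pos_pos)
  have \<rho>sum: "(\<Sum>k\<in>F. \<rho> k) = 1"
    using Zpos unfolding \<rho>_def divide_divide_eq_left[symmetric] sum_divide_distrib[symmetric] Z_def by simp
  \<comment> \<open>Given the frequency, its \<open>P k\<close> shifts are equally likely.\<close>
  define Q where "Q p = \<rho> (fst p) / P (fst p)" for p :: "(nat \<Rightarrow>\<^sub>0 int) \<times> int"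
  have Qpos: "Q p > 0" if "p \<in> I" for p
    using that \<rho> P by (auto simp: Q_def I_def)
  have Qsum: "sum Q I = 1"
    using P \<rho>sum by (simp add: SI Q_def P0)
  define \<theta> where "\<theta> p = of_int (snd p) / P (fst p)" for p :: "(nat \<Rightarrow>\<^sub>0 int) \<times> int"
  \<comment> \<open>Dividing by the probability makes the mean of the samples equal to the full
    discretized sum.\<close>
  define c where "c p = \<mu> (fst p) (snd p) / Q p" for p
  define X where "X p k' = of_real (c p) * wave_coeff (fst p) (\<theta> p) k'" for p k'
  have ne0: "fst p \<noteq> 0" if "p \<in> I" for p using that F(2) by (auto simp: I_def)
  have wave: "sq_summable (wave_coeff (fst p) (\<theta> p))" "sq_norm (wave_coeff (fst p) (\<theta> p)) \<le> 4 / pi\<^sup>2 * weight (fst p)"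
    if "p \<in> I" for p using sq_norm_wave_coeff[OF ne0[OF that]] by auto
  have Xs: "sq_summable (X p)" if "p \<in> I" for p
    unfolding X_def by (rule sq_norm_scale(1)[OF wave(1)[OF that]])
  have c_le: "\<bar>c (k, x)\<bar> \<le> pi\<^sup>2 / 4 * cmod (a k) / \<rho> k" if k: "k \<in> F" for k x
  proof -
    have "\<bar>c (k, x)\<bar> = \<bar>\<mu> k x\<bar> * P k / \<rho> k" using \<rho>[OF k] P(1)[of k] by (simp add: c_def Q_def abs_divide abs_mult)
    also have "\<dots> \<le> (pi\<^sup>2 * cmod (a k) / (4 * P k)) * P k / \<rho> k"
      using \<mu>[OF k, of x] \<rho>[OF k] P(1)[of k] by (intro divide_right_mono mult_right_mono) (auto simp: P_def)
    also have "\<dots> = pi\<^sup>2 / 4 * cmod (a k) / \<rho> k" using P(1)[of k] by simp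
    finally show ?thesis .
  qed
  have QJ: "(\<Sum>x\<in>J k. Q (k, x) * h) = \<rho> k * h" for k h
    using P[of k] by (simp add: Q_def P0)
  \<comment> \<open>A frequency contributes at most
    \<open>pi\<^sup>2 / 4 * cmod (a k) * norm1 k * Z\<close> to the second moment, and
    \<open>norm1 k \<le> weight k / (4 * pi\<^sup>2)\<close> turns this into \<open>Z / 16\<close>
    times its term in the Barron norm.\<close>
  have V: "(\<Sum>p\<in>I. Q p * sq_norm (X p)) \<le> Z * B / 16"
  proof -
    have "(\<Sum>p\<in>I. Q p * sq_norm (X p)) \<le> (\<Sum>k\<in>F. \<Sum>x\<in>J k. Q (k, x) * ((pi\<^sup>2 / 4 * cmod (a k) / \<rho> k)\<^sup>2 * (4 / pi\<^sup>2 * weight k)))"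
      unfolding SI
    proof (intro sum_mono mult_left_mono)
      fix k x assume kx: "k \<in> F" "x \<in> J k"
      then have p: "(k, x) \<in> I" by (simp add: I_def)
      have "sq_norm (X (k, x)) = (c (k, x))\<^sup>2 * sq_norm (wave_coeff k (\<theta> (k, x)))"
        using sq_norm_scale(2)[OF wave(1)[OF p], of "of_real (c (k, x))"] by (simp add: X_def[abs_def])
      also have "\<dots> \<le> (pi\<^sup>2 / 4 * cmod (a k) / \<rho> k)\<^sup>2 * (4 / pi\<^sup>2 * weight k)"
        using wave(2)[OF p] c_le[OF kx(1), of x] \<rho>[OF kx(1)]
        by (intro mult_mono) (auto simp: sq_norm_nonneg abs_le_square_iff[symmetric])
      finally show "sq_norm (X (k, x)) \<le> (pi\<^sup>2 / 4 * cmod (a k) / \<rho> k)\<^sup>2 * (4 / pi\<^sup>2 * weight k)" .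
      show "0 \<le> Q (k, x)" using Qpos[OF p] by simp
    qed
    also have "\<dots> = (\<Sum>k\<in>F. \<rho> k * ((pi\<^sup>2 / 4 * cmod (a k) / \<rho> k)\<^sup>2 * (4 / pi\<^sup>2 * weight k)))"
      by (simp only: QJ)
    also have "\<dots> \<le> (\<Sum>k\<in>F. Z / 16 * (weight k * cmod (a k)))"
    proof (intro sum_mono)
      fix k assume k: "k \<in> F"
      have ak: "cmod (a k) > 0" using F(2)[OF k] by simp
      have K: "norm1 k > 0" using K1[OF k] by linarith
      have wk: "weight k > 0" using w[of k] by linarith
      have "\<rho> k * ((pi\<^sup>2 / 4 * cmod (a k) / \<rho> k)\<^sup>2 * (4 / pi\<^sup>2 * weight k)) = pi\<^sup>2 / 4 * (cmod (a k))\<^sup>2 * weight k / \<rho> k"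
        using \<rho>[OF k] by (simp add: power2_eq_square field_simps)
      also have "\<dots> = pi\<^sup>2 / 4 * cmod (a k) * norm1 k * Z"
        using ak K wk Zpos by (simp add: \<rho>_def power2_eq_square field_simps)
      also have "\<dots> \<le> pi\<^sup>2 / 4 * cmod (a k) * (weight k / (4 * pi\<^sup>2)) * Z"
      proof (intro mult_left_mono mult_right_mono)
        have "norm1 k \<le> (norm1 k)\<^sup>2" using K1[OF k] by (simp add: power2_eq_square)
        also have "\<dots> \<le> weight k / (4 * pi\<^sup>2)"
          using four_pi_sq_norm1_le_weight[of k] by (simp add: field_simps)
        finally show "norm1 k \<le> weight k / (4 * pi\<^sup>2)" .
      qed (use Zpos in auto)
      also have "\<dots> = Z / 16 * (weight k * cmod (a k))" by (simp add: field_simps)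
      finally show "\<rho> k * ((pi\<^sup>2 / 4 * cmod (a k) / \<rho> k)\<^sup>2 * (4 / pi\<^sup>2 * weight k)) \<le> Z / 16 * (weight k * cmod (a k))" .
    qed
    also have "\<dots> \<le> Z / 16 * B"
      unfolding sum_distrib_left[symmetric] using B Zpos by (intro mult_left_mono) auto
    finally show ?thesis by simp
  qed
  \<comment> \<open>The mean number of neurons per sample:
    \<open>2 * norm1 k + 1 \<le> 3 * norm1 k\<close>, and \<open>norm1 k\<close> cancels the
    denominator of \<open>\<rho> k\<close>.\<close>
  have cost: "(\<Sum>p\<in>I. Q p * (2 * norm1 (fst p) + 1)) \<le> 3 * B / Z"
  proof -
    have "(\<Sum>p\<in>I. Q p * (2 * norm1 (fst p) + 1)) = (\<Sum>k\<in>F. \<rho> k * (2 * norm1 k + 1))"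
      by (simp only: SI fst_conv QJ)
    also have "\<dots> \<le> (\<Sum>k\<in>F. 3 / Z * (weight k * cmod (a k)))"
    proof (intro sum_mono)
      fix k assume k: "k \<in> F"
      have "\<rho> k * (2 * norm1 k + 1) \<le> \<rho> k * (3 * norm1 k)"
        using \<rho>[OF k] K1[OF k] by (intro mult_left_mono) auto
      also have "\<dots> = 3 / Z * (weight k * cmod (a k))"
        using K1[OF k] Zpos by (simp add: \<rho>_def field_simps)
      finally show "\<rho> k * (2 * norm1 k + 1) \<le> 3 / Z * (weight k * cmod (a k))" .
    qed
    also have "\<dots> \<le> 3 / Z * B"
      unfolding sum_distrib_left[symmetric] using B Zpos by (intro mult_left_mono) auto
    finally show ?thesis by simp
  qed
  \<comment> \<open>\<open>20 * pi\<^sup>2 / 4\<close> is 5/4 times \<open>4 * pi\<^sup>2\<close>,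
    and \<open>4 * pi\<^sup>2 * (norm1 k)\<^sup>2\<close> is absorbed by the weight.\<close>
  have outer: "(\<Sum>p\<in>I. Q p * (\<bar>c p\<bar> * (20 * (norm1 (fst p))\<^sup>2))) \<le> 5 / 4 * B"
  proof -
    have "(\<Sum>p\<in>I. Q p * (\<bar>c p\<bar> * (20 * (norm1 (fst p))\<^sup>2)))
        \<le> (\<Sum>k\<in>F. \<Sum>x\<in>J k. Q (k, x) * (pi\<^sup>2 / 4 * cmod (a k) / \<rho> k * (20 * (norm1 k)\<^sup>2)))"
      unfolding SI fst_conv
      by (intro sum_mono mult_left_mono mult_right_mono c_le) (auto intro!: less_imp_le[OF Qpos] simp: I_def)
    also have "\<dots> = (\<Sum>k\<in>F. \<rho> k * (pi\<^sup>2 / 4 * cmod (a k) / \<rho> k * (20 * (norm1 k)\<^sup>2)))"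
      by (simp only: QJ)
    also have "\<dots> \<le> (\<Sum>k\<in>F. 5 / 4 * (weight k * cmod (a k)))"
    proof (intro sum_mono)
      fix k assume k: "k \<in> F"
      have "\<rho> k * (pi\<^sup>2 / 4 * cmod (a k) / \<rho> k * (20 * (norm1 k)\<^sup>2)) = 5 / 4 * ((4 * pi\<^sup>2 * (norm1 k)\<^sup>2) * cmod (a k))"
        using \<rho>[OF k] by (simp add: field_simps)
      also have "\<dots> \<le> 5 / 4 * (weight k * cmod (a k))"
        using four_pi_sq_norm1_le_weight[of k] by (intro mult_left_mono mult_right_mono) auto
      finally show "\<rho> k * (pi\<^sup>2 / 4 * cmod (a k) / \<rho> k * (20 * (norm1 k)\<^sup>2)) \<le> 5 / 4 * (weight k * cmod (a k))" .
    qed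
    also have "\<dots> \<le> 5 / 4 * B"
      unfolding sum_distrib_left[symmetric] using B by (intro mult_left_mono) auto
    finally show ?thesis .
  qed
  \<comment> \<open>Up to \<open>r\<close> samples need at most \<open>m / 3\<close> neurons in the
    mean.\<close>
  define r where "r = Z * real m / (9 * B)"
  have r1: "r \<ge> 1" using Z B(2) by (simp add: r_def field_simps)
  define N where "N = nat \<lfloor>r\<rfloor>"
  have N: "real N \<le> r" "r \<le> 2 * real N" "real N \<ge> 1"
  proof -
    have "\<lfloor>r\<rfloor> \<ge> 1" using r1 by simp
    then have "real N = of_int \<lfloor>r\<rfloor>" "real N \<ge> 1" by (simp_all add: N_def)
    then show "real N \<le> r" "r \<le> 2 * real N" "real N \<ge> 1" using of_int_floor_le[of r] real_of_int_floor_add_one_gt[of r] by linarith+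
  qed
  have mpos: "real m > 0" using m by simp
  \<comment> \<open>Both constraints are scaled to 1: the neurons by \<open>m\<close>, the outer
    weights by \<open>4 * B * N\<close>, because the samples are averaged afterwards.\<close>
  define pen where "pen p = (2 * norm1 (fst p) + 1) / real m + \<bar>c p\<bar> * (20 * (norm1 (fst p))\<^sup>2) / (4 * B * real N)" for p
  \<comment> \<open>With this factor, \<open>A * sq_norm U \<le> 1\<close> for the unnormalized
    error \<open>U\<close> means an averaged squared error of at most
    \<open>10 * B\<^sup>2 / m\<close>.\<close>
  define A where "A = real m / (10 * (real N)\<^sup>2 * B\<^sup>2)"
  have A: "A > 0" using mpos N(3) B(2) by (simp add: A_def)
  have "(\<Sum>p\<in>I. Q p * pen p) \<le> 3 * B / Z / real m + 5 / 4 * B / (4 * B * real N)"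
  proof -
    have "(\<Sum>p\<in>I. Q p * pen p) = (\<Sum>p\<in>I. Q p * (2 * norm1 (fst p) + 1)) / real m
        + (\<Sum>p\<in>I. Q p * (\<bar>c p\<bar> * (20 * (norm1 (fst p))\<^sup>2))) / (4 * B * real N)"
      unfolding sum_divide_distrib sum.distrib[symmetric]
      by (intro sum.cong refl) (simp add: pen_def distrib_left add_divide_distrib)
    then show ?thesis using cost outer mpos B(2) N(3)
      by (simp only:) (intro add_mono divide_right_mono; simp)
  qed
  from maurey_penalized[OF less_imp_le[OF Qpos] Qsum Xs V this less_imp_le[OF A], of N]
  obtain s where s: "\<And>n. n < N \<Longrightarrow> s n \<in> I" and
    opt: "A * sq_norm (\<lambda>k. (\<Sum>n<N. X (s n) k) - of_nat N * (\<Sum>p\<in>I. of_real (Q p) * X p k)) + (\<Sum>n<N. pen (s n))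
      \<le> real N * (A * (Z * B / 16) + (3 * B / Z / real m + 5 / 4 * B / (4 * B * real N)))"
    by auto
  have "real N * (A * (Z * B / 16) + (3 * B / Z / real m + 5 / 4 * B / (4 * B * real N)))
      = 9 * (r / real N) / 160 + real N / r / 3 + 5 / 16"
    using B(2) N(3) mpos Zpos by (simp add: A_def r_def power2_eq_square field_simps)
  \<comment> \<open>The summands belong to the error, the neurons and the outer weights.
    \<open>r \<le> 2 * N\<close> enters the first and \<open>N \<le> r\<close> the second; the total
    is below 1.\<close>
  also have "\<dots> \<le> 9 * 2 / 160 + 1 / 3 + 5 / 16"
    using N r1 by (intro add_mono divide_right_mono mult_left_mono) (auto simp: divide_le_eq)
  finally have bound: "real N * (A * (Z * B / 16) + (3 * B / Z / real m + 5 / 4 * B / (4 * B * real N)))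
      \<le> 9 * 2 / 160 + 1 / 3 + 5 / 16" .
  have le1: "A * sq_norm (\<lambda>k. (\<Sum>n<N. X (s n) k) - of_nat N * (\<Sum>p\<in>I. of_real (Q p) * X p k)) + (\<Sum>n<N. pen (s n)) \<le> 1"
    by (rule order_trans[OF opt order_trans[OF bound]]) simp
  have pen0: "(\<Sum>n<N. pen (s n)) \<ge> 0"
  proof (intro sum_nonneg)
    fix n assume "n \<in> {..<N}"
    then have "fst (s n) \<in> F" using s[of n] by (auto simp: I_def)
    then show "pen (s n) \<ge> 0" using K1[of "fst (s n)"] mpos B(2) by (auto simp: pen_def intro!: add_nonneg_nonneg divide_nonneg_nonneg)
  qed
  have pen_le: "(\<Sum>n<N. pen (s n)) \<le> 1"
    using le1 mult_nonneg_nonneg[OF less_imp_le[OF A] sq_norm_nonneg] by (meson add_increasing order_trans order_refl)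
  have pen_split: "(\<Sum>n<N. pen (s n)) = (\<Sum>n<N. 2 * norm1 (fst (s n)) + 1) / real m
      + (\<Sum>n<N. \<bar>c (s n)\<bar> * (20 * (norm1 (fst (s n)))\<^sup>2)) / (4 * B * real N)"
    unfolding sum_divide_distrib sum.distrib[symmetric] by (simp only: pen_def)
  have nn1: "(\<Sum>n<N. 2 * norm1 (fst (s n)) + 1) \<ge> 0" "(\<Sum>n<N. \<bar>c (s n)\<bar> * (20 * (norm1 (fst (s n)))\<^sup>2)) \<ge> 0"
    by (auto intro!: sum_nonneg simp: norm1_def)
  have c1: "(\<Sum>n<N. 2 * norm1 (fst (s n)) + 1) / real m \<le> 1"
    "(\<Sum>n<N. \<bar>c (s n)\<bar> * (20 * (norm1 (fst (s n)))\<^sup>2)) / (4 * B * real N) \<le> 1"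
  proof -
    have "4 * B * real N > 0" using B(2) N(3) by simp
    note nn2 = divide_nonneg_pos[OF nn1(1) mpos] divide_nonneg_pos[OF nn1(2) this]
    show "(\<Sum>n<N. 2 * norm1 (fst (s n)) + 1) / real m \<le> 1"
      "(\<Sum>n<N. \<bar>c (s n)\<bar> * (20 * (norm1 (fst (s n)))\<^sup>2)) / (4 * B * real N) \<le> 1"
      using pen_le pen_split nn2 by linarith+
  qed
  define \<mu>' where "\<mu>' n = c (s n) / real N" for n
  have "(\<Sum>n<N. 2 * norm1 (fst (s n)) + 1) \<le> real m" using c1(1) mpos by simp
  moreover have "(\<Sum>n<N. \<bar>\<mu>' n\<bar> * (20 * (norm1 (fst (s n)))\<^sup>2)) \<le> 4 * B"
  proof -
    have "(\<Sum>n<N. \<bar>\<mu>' n\<bar> * (20 * (norm1 (fst (s n)))\<^sup>2)) = (\<Sum>n<N. \<bar>c (s n)\<bar> * (20 * (norm1 (fst (s n)))\<^sup>2)) / real N"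
      using N(3) by (simp add: \<mu>'_def sum_divide_distrib)
    then show ?thesis using c1(2) B(2) N(3) by (simp add: divide_le_eq mult_ac)
  qed
  moreover
  define M where "M k' = (\<Sum>p\<in>I. of_real (Q p) * X p k')" for k'
  define U where "U k' = (\<Sum>n<N. X (s n) k') - of_nat N * M k'" for k'
  \<comment> \<open>The total error splits into the discretization error \<open>W\<close> and the
    sampling error \<open>U\<close>, the latter divided by \<open>N\<close>.\<close>
  define W where "W k' = (\<Sum>k\<in>F. D k (\<nu> k) (\<mu> k) k')" for k'
  have M: "M k' = (\<Sum>k\<in>F. \<Sum>x\<in>J k. of_real (\<mu> k x) * wave_coeff k (of_int x / P k) k')" for k'
  proof -
    have "of_real (Q p) * X p k' = of_real (\<mu> (fst p) (snd p)) * wave_coeff (fst p) (of_int (snd p) / P (fst p)) k'" if "p \<in> I" for p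
      using Qpos[OF that] by (simp add: X_def c_def \<theta>_def)
    then show ?thesis unfolding M_def by (subst sum.cong[OF refl]) (simp_all add: SI)
  qed
  have fI: "finite I" unfolding I_def using F(1) by (auto simp: J_def)
  have Us: "sq_summable U"
  proof -
    have "sq_summable M" unfolding M_def by (intro sq_norm_sum sq_norm_scale Xs fI)
    from sq_norm_scale(1)[OF this, of "- of_nat N"] have "sq_summable (\<lambda>k. - of_nat N * M k)" .
    moreover have "sq_summable (\<lambda>k'. \<Sum>n<N. X (s n) k')" using Xs s by (intro sq_norm_sum) auto
    ultimately show ?thesis using sq_norm_add by (fastforce simp: U_def[abs_def])
  qed
  have Un: "sq_norm U \<le> 10 * (real N)\<^sup>2 * B\<^sup>2 / real m"
  proof -
    have "A * sq_norm U \<le> 1" using le1 pen0 unfolding U_def M_def by linarith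
    then have "sq_norm U \<le> 1 / A" using A by (simp add: field_simps)
    then show ?thesis by (simp add: A_def)
  qed
  have Ws: "sq_summable W" and Wn: "sq_norm W \<le> \<delta>"
  proof -
    show "sq_summable W" unfolding W_def using d1 F(1) by (intro sq_norm_sum)
    have "sq_norm W \<le> card F * (\<Sum>k\<in>F. sq_norm (D k (\<nu> k) (\<mu> k)))"
      unfolding W_def using d1 F(1) by (intro sq_norm_sum(2))
    also have "\<dots> \<le> card F * (\<Sum>k\<in>F. \<epsilon>)"
      using d2 by (intro mult_left_mono sum_mono) auto
    also have "\<dots> = \<delta>" using Fne F(1) by (simp add: \<epsilon>_def power2_eq_square card_gt_0_iff)
    finally show "sq_norm W \<le> \<delta>" .
  qed
  have eq: "(if k \<in> F then a k else 0) - (\<Sum>n<N. of_real (\<mu>' n) * wave_coeff (fst (s n)) (\<theta> (s n)) k)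
      = W k + (- 1 / of_nat N) * U k" for k
  proof -
    have "(\<Sum>n<N. of_real (\<mu>' n) * wave_coeff (fst (s n)) (\<theta> (s n)) k) = (\<Sum>n<N. X (s n) k) / of_nat N"
      by (simp add: \<mu>'_def X_def sum_divide_distrib)
    moreover have "(if k \<in> F then a k else 0) = W k + M k"
      using hermitian_pair_sum[where a = a and F = F and k' = k, OF herm F(1)] F(2) unfolding W_def M D_def sum_subtractf T_def J_def P_def by simp
    moreover have "(- 1 / of_nat N) * U k = M k - (\<Sum>n<N. X (s n) k) / of_nat N"
      using N(3) by (simp add: U_def field_simps)
    ultimately show ?thesis by simp
  qed
  have U's: "sq_summable (\<lambda>k. (- 1 / of_nat N) * U k)" and "sq_norm (\<lambda>k. (- 1 / of_nat N) * U k) = sq_norm U / (real N)\<^sup>2"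
    using sq_norm_scale[OF Us, of "- 1 / of_nat N"] by (simp_all add: norm_divide power_divide)
  then have "sq_norm (\<lambda>k. (- 1 / of_nat N) * U k) \<le> 10 * B\<^sup>2 / real m"
    using Un N(3) by (simp add: divide_le_eq mult_ac)
  then have "sq_summable (\<lambda>k. W k + (- 1 / of_nat N) * U k)"
    "sq_norm (\<lambda>k. W k + (- 1 / of_nat N) * U k) \<le> 2 * (\<delta> + 10 * B\<^sup>2 / real m)"
    using sq_norm_add[OF Ws U's] sq_norm_add_le[OF Ws U's] Wn by auto
  then have "sq_summable (\<lambda>k. (if k \<in> F then a k else 0) - (\<Sum>n<N. of_real (\<mu>' n) * wave_coeff (fst (s n)) (\<theta> (s n)) k))"
    "sq_norm (\<lambda>k. (if k \<in> F then a k else 0) - (\<Sum>n<N. of_real (\<mu>' n) * wave_coeff (fst (s n)) (\<theta> (s n)) k))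
      \<le> 2 * (\<delta> + 10 * B\<^sup>2 / real m)"
    unfolding eq .
  moreover have "\<forall>n<N. fst (s n) \<in> F" using s unfolding I_def by (metis mem_Sigma_iff prod.collapse)
  ultimately have all: "(\<forall>n<N. fst (s n) \<in> F) \<and> (\<Sum>n<N. 2 * norm1 (fst (s n)) + 1) \<le> real m \<and>
      (\<Sum>n<N. \<bar>\<mu>' n\<bar> * (20 * (norm1 (fst (s n)))\<^sup>2)) \<le> 4 * B \<and>
      sq_summable (\<lambda>k. (if k \<in> F then a k else 0) - (\<Sum>n<N. of_real (\<mu>' n) * wave_coeff (fst (s n)) (\<theta> (s n)) k)) \<and>
      sq_norm (\<lambda>k. (if k \<in> F then a k else 0) - (\<Sum>n<N. of_real (\<mu>' n) * wave_coeff (fst (s n)) (\<theta> (s n)) k))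
        \<le> 2 * (\<delta> + 10 * B\<^sup>2 / real m)"
    by blast
  show ?thesis
    by (rule exI[of _ N], rule exI[of _ \<mu>'], rule exI[of _ "\<lambda>n. fst (s n)"], rule exI[of _ "\<lambda>n. \<theta> (s n)"], rule all)
qed

text \<open>If \<open>Z * m \<ge> 9 * B\<close>, the budget admits at least one sample and sampling
  applies. Otherwise no waves are used: a small \<open>Z\<close> forces the truncated family itself
  to have squared norm at most \<open>B * Z\<close>, hence at most
  \<open>9 * B\<^sup>2 / m\<close>.\<close>

lemma wave_approximation:
  fixes a :: "(nat \<Rightarrow>\<^sub>0 int) \<Rightarrow> complex"
  assumes herm: "\<And>k. a (- k) = cnj (a k)"
    and a: "((\<lambda>k. weight k * cmod (a k)) has_sum B) UNIV" and m: "m \<ge> 1"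
  shows "\<exists>(n::nat) \<mu> \<kappa> \<theta>. (\<forall>j<n. \<kappa> j \<noteq> 0 \<and> a (\<kappa> j) \<noteq> 0) \<and>
     (\<Sum>j<n. 2 * norm1 (\<kappa> j) + 1) \<le> real m \<and> (\<Sum>j<n. \<bar>\<mu> j\<bar> * (20 * (norm1 (\<kappa> j))\<^sup>2)) \<le> 4 * B \<and>
     sq_summable (\<lambda>k. (if k = 0 then 0 else a k) - (\<Sum>j<n. of_real (\<mu> j) * wave_coeff (\<kappa> j) (\<theta> j) k)) \<and>
     sq_norm (\<lambda>k. (if k = 0 then 0 else a k) - (\<Sum>j<n. of_real (\<mu> j) * wave_coeff (\<kappa> j) (\<theta> j) k))
       \<le> 80 * B\<^sup>2 / real m"
proof -
  have w1: "weight k \<ge> 1" for k by (rule weight_ge_1)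
  have w0: "weight k \<ge> 0" for k using w1[of k] by linarith
  have wa0: "weight k * cmod (a k) \<ge> 0" for k using w0[of k] by simp
  have fin_le: "(\<Sum>k\<in>F. weight k * cmod (a k)) \<le> B" if "finite F" for F
    using finite_sum_le_infsum[OF has_sum_imp_summable[OF a] that] wa0 infsumI[OF a] by auto
  have wa: "weight k * cmod (a k) \<le> B" for k using fin_le[of "{k}"] by simp
  have B0: "B \<ge> 0" using fin_le[of "{}"] by simp
  have ca: "cmod (a k) \<le> B" for k
    using wa[of k] mult_right_mono[OF w1[of k], of "cmod (a k)"] by simp
  have "((\<lambda>k. B * (weight k * cmod (a k))) has_sum (B * B)) UNIV" by (intro has_sum_cmult_right a)
  moreover have "weight k * (cmod (a k))\<^sup>2 \<le> B * (weight k * cmod (a k))" for k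
    using mult_right_mono[OF ca[of k] wa0[of k]] by (simp add: power2_eq_square mult_ac)
  ultimately have sa: "sq_summable a" by (rule sq_norm_mono(1))
  show ?thesis
  proof (cases "B = 0")
    case True
    have "a k = 0" for k using ca[of k] True by simp
    then have "(\<lambda>k. if k = 0 then 0 else a k) = (\<lambda>k. 0)" by auto
    then show ?thesis using True by (intro exI[of _ 0]) (simp add: sq_summable_def sq_norm_def)
  next
    case False
    then have Bpos: "B > 0" using B0 by simp
    define \<delta> where "\<delta> = B\<^sup>2 / real m"
    have \<delta>: "\<delta> > 0" using Bpos m by (simp add: \<delta>_def)
    obtain F where F: "finite F" "\<And>k. k \<in> F \<Longrightarrow> k \<noteq> 0 \<and> a k \<noteq> 0 \<and> - k \<in> F" and
      t: "sq_summable (\<lambda>k. if k = 0 \<or> k \<in> F then 0 else a k)" "sq_norm (\<lambda>k. if k = 0 \<or> k \<in> F then 0 else a k) \<le> \<delta>"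
      using frequency_truncation[where a = a, OF herm sa \<delta>] by blast
    define Z where "Z = (\<Sum>k\<in>F. weight k * cmod (a k) / norm1 k)"
    show ?thesis
    proof (cases "9 * B \<le> Z * real m")
      case True
      obtain n \<mu> \<kappa> \<theta> where n: "\<forall>j<(n::nat). \<kappa> j \<in> F" "(\<Sum>j<n. 2 * norm1 (\<kappa> j) + 1) \<le> real m"
        "(\<Sum>j<n. \<bar>\<mu> j\<bar> * (20 * (norm1 (\<kappa> j))\<^sup>2)) \<le> 4 * B" and
        s: "sq_summable (\<lambda>k. (if k \<in> F then a k else 0) - (\<Sum>j<n. of_real (\<mu> j) * wave_coeff (\<kappa> j) (\<theta> j) k))"
        "sq_norm (\<lambda>k. (if k \<in> F then a k else 0) - (\<Sum>j<n. of_real (\<mu> j) * wave_coeff (\<kappa> j) (\<theta> j) k)) \<le> 2 * (\<delta> + 10 * B\<^sup>2 / real m)"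
        using sampled_waves[where a = a, OF herm F fin_le[OF F(1)] Bpos m \<delta>] True unfolding Z_def by blast
      have eq: "(if k = 0 then 0 else a k) - (\<Sum>j<n. of_real (\<mu> j) * wave_coeff (\<kappa> j) (\<theta> j) k)
          = (if k = 0 \<or> k \<in> F then 0 else a k) + ((if k \<in> F then a k else 0) - (\<Sum>j<n. of_real (\<mu> j) * wave_coeff (\<kappa> j) (\<theta> j) k))" for k
        using F(2)[of k] by auto
      \<comment> \<open>In units of \<open>B\<^sup>2 / m\<close> the left side is 46. The outer 2
        splits off the truncated frequencies, the inner one separates discretization from
        sampling.\<close>
      have "2 * (\<delta> + 2 * (\<delta> + 10 * B\<^sup>2 / real m)) \<le> 80 * B\<^sup>2 / real m"
        using m by (simp add: \<delta>_def field_simps)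
      moreover have "sq_norm (\<lambda>k. (if k = 0 \<or> k \<in> F then 0 else a k) + ((if k \<in> F then a k else 0) - (\<Sum>j<n. of_real (\<mu> j) * wave_coeff (\<kappa> j) (\<theta> j) k)))
          \<le> 2 * (\<delta> + 2 * (\<delta> + 10 * B\<^sup>2 / real m))"
        by (rule order_trans[OF sq_norm_add_le[OF t(1) s(1)]]) (intro mult_left_mono add_mono t(2) s(2), simp)
      ultimately have "sq_norm (\<lambda>k. (if k = 0 \<or> k \<in> F then 0 else a k) + ((if k \<in> F then a k else 0) - (\<Sum>j<n. of_real (\<mu> j) * wave_coeff (\<kappa> j) (\<theta> j) k)))
          \<le> 80 * B\<^sup>2 / real m"
        by (rule order_trans[rotated])
      moreover have "\<forall>j<n. \<kappa> j \<noteq> 0 \<and> a (\<kappa> j) \<noteq> 0" using n(1) F(2) by blast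
      ultimately show ?thesis
        using n(2,3) sq_norm_add[OF t(1) s(1)] unfolding eq[symmetric] by blast
    next
      case False
      then have Zm: "Z * real m \<le> 9 * B" by simp
      define h where "h k = (if k \<in> F then weight k * (cmod (a k))\<^sup>2 else 0)" for k
      have h: "(h has_sum (\<Sum>k\<in>F. weight k * (cmod (a k))\<^sup>2)) UNIV"
        by (rule has_sum_finite_neutralI[of F]) (auto simp: h_def F(1))
      have hs: "((\<lambda>k. weight k * (cmod (if k = 0 \<or> k \<in> F then 0 else a k))\<^sup>2 + h k) has_sum
          (sq_norm (\<lambda>k. if k = 0 \<or> k \<in> F then 0 else a k) + (\<Sum>k\<in>F. weight k * (cmod (a k))\<^sup>2))) UNIV"
        by (intro has_sum_add sq_summable_has_sum t h)
      have "weight k * (cmod (if k = 0 then 0 else a k))\<^sup>2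
          \<le> weight k * (cmod (if k = 0 \<or> k \<in> F then 0 else a k))\<^sup>2 + h k" for k
        using w0[of k] by (auto simp: h_def)
      note res = sq_norm_mono[OF hs this]
      \<comment> \<open>\<open>norm1 k * cmod (a k) \<le> weight k * cmod (a k) \<le> B\<close>
        trades one factor of the square for \<open>B / norm1 k\<close>, which produces the terms of
        \<open>Z\<close>.\<close>
      have "(\<Sum>k\<in>F. weight k * (cmod (a k))\<^sup>2) \<le> (\<Sum>k\<in>F. B * (weight k * cmod (a k) / norm1 k))"
      proof (intro sum_mono)
        fix k assume "k \<in> F"
        then have K: "norm1 k \<ge> 1" using F(2) by (intro norm1_ge_1) blast
        have "norm1 k \<le> (norm1 k)\<^sup>2" using K by (simp add: power2_eq_square)
        also have "\<dots> \<le> 4 * pi\<^sup>2 * (norm1 k)\<^sup>2"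
        proof -
          have "1 \<le> pi\<^sup>2" using pi_ge_two by (intro one_le_power) linarith
          then have "1 * (norm1 k)\<^sup>2 \<le> 4 * pi\<^sup>2 * (norm1 k)\<^sup>2" by (intro mult_right_mono) auto
          then show ?thesis by simp
        qed
        also have "\<dots> \<le> weight k" by (rule four_pi_sq_norm1_le_weight)
        finally have "norm1 k * cmod (a k) \<le> weight k * cmod (a k)" by (intro mult_right_mono) auto
        then have "norm1 k * cmod (a k) \<le> B" using wa[of k] by linarith
        then have "cmod (a k) \<le> B / norm1 k" using K by (simp add: field_simps)
        from mult_left_mono[OF this wa0[of k]]
        show "weight k * (cmod (a k))\<^sup>2 \<le> B * (weight k * cmod (a k) / norm1 k)"
          by (simp add: power2_eq_square mult_ac)
      qed
      also have "\<dots> = B * Z" by (simp add: Z_def sum_distrib_left)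
      also have "\<dots> \<le> 9 * B\<^sup>2 / real m"
        using mult_left_mono[OF Zm B0] m by (simp add: field_simps power2_eq_square)
      finally have "sq_norm (\<lambda>k. if k = 0 then 0 else a k) \<le> \<delta> + 9 * B\<^sup>2 / real m"
        using res(2) t(2) by linarith
      also have "\<dots> \<le> 80 * B\<^sup>2 / real m" using m by (simp add: \<delta>_def field_simps)
      finally show ?thesis using res(1) B0 by (intro exI[of _ 0]) simp
    qed
  qed
qed

section \<open>Assembly of the network and its error\<close>

lemma wave_sum_network:
  fixes n :: nat and \<kappa> :: "nat \<Rightarrow> nat \<Rightarrow>\<^sub>0 int"
  assumes "\<And>j. j < n \<Longrightarrow> \<kappa> j \<noteq> 0"
  shows "\<exists>c L. real (length L) = (\<Sum>j<n. 2 * norm1 (\<kappa> j) + 1) \<and> \<bar>c\<bar> \<le> (\<Sum>j<n. \<bar>\<mu> j\<bar>) \<and>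
           (\<Sum>x\<leftarrow>L. \<bar>fst x\<bar>) \<le> (\<Sum>j<n. \<bar>\<mu> j\<bar> * (20 * (norm1 (\<kappa> j))\<^sup>2)) \<and>
           (\<forall>(\<gamma>, k, t)\<in>set L. k \<in> \<kappa> ` {..<n} \<and> \<bar>t\<bar> \<le> 1) \<and>
           (\<forall>v\<in>L_bound \<Phi>. (\<Sum>j<n. \<mu> j * tri (ridge \<Phi> (\<kappa> j) v - \<theta> j)) = c + (\<Sum>x\<leftarrow>L. neuron \<Phi> v x))"
  using assms
proof (induction n)
  case 0
  show ?case by (intro exI[of _ 0] exI[of _ "[]"]) simp
next
  case (Suc n)
  have "\<And>j. j < n \<Longrightarrow> \<kappa> j \<noteq> 0" using Suc.prems by simp
  from Suc.IH[OF this] obtain c L where IH: "real (length L) = (\<Sum>j<n. 2 * norm1 (\<kappa> j) + 1)" "\<bar>c\<bar> \<le> (\<Sum>j<n. \<bar>\<mu> j\<bar>)"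
    "(\<Sum>x\<leftarrow>L. \<bar>fst x\<bar>) \<le> (\<Sum>j<n. \<bar>\<mu> j\<bar> * (20 * (norm1 (\<kappa> j))\<^sup>2))"
    "\<forall>(\<gamma>, k, t)\<in>set L. k \<in> \<kappa> ` {..<n} \<and> \<bar>t\<bar> \<le> 1"
    "\<forall>v\<in>L_bound \<Phi>. (\<Sum>j<n. \<mu> j * tri (ridge \<Phi> (\<kappa> j) v - \<theta> j)) = c + (\<Sum>x\<leftarrow>L. neuron \<Phi> v x)"
    by blast
  obtain c' L' where L': "real (length L') = 2 * norm1 (\<kappa> n) + 1" "\<bar>c'\<bar> \<le> 1"
    "(\<Sum>x\<leftarrow>L'. \<bar>fst x\<bar>) \<le> 20 * (norm1 (\<kappa> n))\<^sup>2"
    "\<forall>(\<gamma>, k', t)\<in>set L'. k' = \<kappa> n \<and> \<bar>t\<bar> \<le> 1"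
    "\<forall>v\<in>L_bound \<Phi>. tri (ridge \<Phi> (\<kappa> n) v - \<theta> n) = c' + (\<Sum>x\<leftarrow>L'. neuron \<Phi> v x)"
    using triangle_wave_network[of "\<kappa> n" \<Phi> "\<theta> n"] Suc.prems[of n] by auto
  \<comment> \<open>Only outer weights are rescaled; the frequencies and the bounds on the
    thresholds are kept.\<close>
  define M where "M = map (\<lambda>(\<gamma>, k, t). (\<mu> n * \<gamma>, k, t)) L'"
  have "(\<Sum>x\<leftarrow>M. neuron \<Phi> v x) = \<mu> n * (\<Sum>x\<leftarrow>L'. neuron \<Phi> v x)" for v
    unfolding M_def sum_list_const_mult[symmetric] map_map
    by (intro arg_cong[where f = sum_list] map_cong) (auto simp: neuron_def)
  moreover have "(\<Sum>x\<leftarrow>M. \<bar>fst x\<bar>) = \<bar>\<mu> n\<bar> * (\<Sum>x\<leftarrow>L'. \<bar>fst x\<bar>)"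
    unfolding M_def sum_list_const_mult[symmetric] map_map
    by (intro arg_cong[where f = sum_list] map_cong) (auto simp: abs_mult)
  moreover have "\<bar>\<mu> n\<bar> * (\<Sum>x\<leftarrow>L'. \<bar>fst x\<bar>) \<le> \<bar>\<mu> n\<bar> * (20 * (norm1 (\<kappa> n))\<^sup>2)"
    by (intro mult_left_mono L'(3)) simp
  moreover have "\<bar>c + \<mu> n * c'\<bar> \<le> (\<Sum>j<n. \<bar>\<mu> j\<bar>) + \<bar>\<mu> n\<bar>"
    using IH(2) mult_left_mono[OF L'(2), of "\<bar>\<mu> n\<bar>"] abs_triangle_ineq[of c "\<mu> n * c'"]
    by (simp add: abs_mult)
  moreover have "\<forall>(\<gamma>, k, t)\<in>set (L @ M). k \<in> \<kappa> ` {..<Suc n} \<and> \<bar>t\<bar> \<le> 1"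
    using IH(4) L'(4) by (fastforce simp: M_def)
  moreover have "length M = length L'" by (simp add: M_def)
  ultimately show ?case
    using IH(1,3,5) L'(1,5)
    by (intro exI[of _ "c + \<mu> n * c'"] exI[of _ "L @ M"]) (simp add: distrib_left)
qed

theorem theorem2:
  fixes \<Phi> :: "nat \<Rightarrow> 'a::banach" and m :: nat and f :: "'a \<Rightarrow> real"
  assumes "schauder_basis \<Phi>"
    and "m \<ge> 1"
    and "f \<in> barron_space \<Phi>"
  shows "\<exists>f\<^sub>m \<in> relu_nets \<Phi> m f.
           (\<lambda>v. f v - f\<^sub>m v) \<in> hilbert_space \<Phi> \<and>
           hilbert_norm \<Phi> (\<lambda>v. f v - f\<^sub>m v) \<le> 4 * sqrt 5 * barron_norm \<Phi> f / sqrt (real m)"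
proof -
  note \<Phi> = assms(1)
  obtain a where exp: "fourier_expansion \<Phi> f a" using assms(3) by (auto simp: barron_space_def)
  have a: "fourier_coeff \<Phi> f = a" by (rule fourier_coeff_eq[OF \<Phi> exp])
  have rep: "fourier_rep \<Phi> f a" using exp by (simp add: fourier_expansion_def fourier_rep_def)
  have herm: "a (- k) = cnj (a k)" for k by (rule fourier_expansion_uminus[OF exp])
  have dom: "dominated a" by (rule fourier_expansion_dominated[OF \<Phi> exp])
  define B where "B = barron_norm \<Phi> f"
  have B: "((\<lambda>k. weight k * cmod (a k)) has_sum B) UNIV"
    using assms(3) by (simp add: barron_space_def B_def barron_norm_def a)
  obtain n \<mu> \<kappa> \<theta> where \<kappa>: "\<And>j. j < (n::nat) \<Longrightarrow> \<kappa> j \<noteq> 0" "\<And>j. j < n \<Longrightarrow> a (\<kappa> j) \<noteq> 0" and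
    cost: "(\<Sum>j<n. 2 * norm1 (\<kappa> j) + 1) \<le> real m" and
    outer: "(\<Sum>j<n. \<bar>\<mu> j\<bar> * (20 * (norm1 (\<kappa> j))\<^sup>2)) \<le> 4 * B" and
    err: "sq_summable (\<lambda>k. (if k = 0 then 0 else a k) - (\<Sum>j<n. of_real (\<mu> j) * wave_coeff (\<kappa> j) (\<theta> j) k))"
      "sq_norm (\<lambda>k. (if k = 0 then 0 else a k) - (\<Sum>j<n. of_real (\<mu> j) * wave_coeff (\<kappa> j) (\<theta> j) k)) \<le> 80 * B\<^sup>2 / real m"
    using wave_approximation[where a = a, OF herm B assms(2)] by blast
  \<comment> \<open>The coefficient at 0 is removed because the network takes over the constant term
    exactly.\<close>
  define b where "b k = (if k = 0 then 0 else a k) - (\<Sum>j<n. of_real (\<mu> j) * wave_coeff (\<kappa> j) (\<theta> j) k)" for k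
  obtain c0 L where L: "real (length L) = (\<Sum>j<n. 2 * norm1 (\<kappa> j) + 1)" "\<bar>c0\<bar> \<le> (\<Sum>j<n. \<bar>\<mu> j\<bar>)"
    "(\<Sum>x\<leftarrow>L. \<bar>fst x\<bar>) \<le> (\<Sum>j<n. \<bar>\<mu> j\<bar> * (20 * (norm1 (\<kappa> j))\<^sup>2))"
    "\<forall>(\<gamma>, k, t)\<in>set L. k \<in> \<kappa> ` {..<n} \<and> \<bar>t\<bar> \<le> 1"
    "\<forall>v\<in>L_bound \<Phi>. (\<Sum>j<n. \<mu> j * tri (ridge \<Phi> (\<kappa> j) v - \<theta> j)) = c0 + (\<Sum>x\<leftarrow>L. neuron \<Phi> v x)"
    using wave_sum_network[of n \<kappa> \<mu> \<Phi> \<theta>] \<kappa>(1) by blast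
  define fm where "fm v = Re (a 0) + c0 + (\<Sum>x\<leftarrow>L. neuron \<Phi> v x)" for v
  have net: "fm \<in> relu_nets \<Phi> m f"
  proof -
    have len: "length L \<le> m" using L(1) cost by linarith
    have a0: "\<bar>Re (a 0)\<bar> \<le> B"
    proof -
      have "(\<Sum>k\<in>{0}. weight k * cmod (a k)) \<le> B"
      proof -
        have "weight k * cmod (a k) \<ge> 0" for k using weight_ge_1[of k] by simp
        then show ?thesis
          using finite_sum_le_infsum[OF has_sum_imp_summable[OF B], of "{0}"] infsumI[OF B] by simp
      qed
      then have "cmod (a 0) \<le> B" by (simp add: weight_def norm1_def)
      then show ?thesis using abs_Re_le_cmod[of "a 0"] by linarith
    qed
    \<comment> \<open>As \<open>norm1\<close> is at least 1 here, the bound \<open>4 * B\<close> on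
      the outer weights leaves at most \<open>B / 5\<close> for the sum of the
      \<open>\<bar>\<mu> j\<bar>\<close>, and the constant is at most \<open>B + B / 5\<close> in
      size.\<close>
    have "(\<Sum>j<n. \<bar>\<mu> j\<bar> * 20) \<le> (\<Sum>j<n. \<bar>\<mu> j\<bar> * (20 * (norm1 (\<kappa> j))\<^sup>2))"
      using norm1_ge_1[OF \<kappa>(1)] by (intro sum_mono mult_left_mono) (auto simp: one_le_power)
    then have c0: "\<bar>Re (a 0) + c0\<bar> \<le> 2 * B"
      using a0 L(2) outer abs_triangle_ineq[of "Re (a 0)" c0] by (simp add: sum_distrib_right[symmetric])
    \<comment> \<open>The places from \<open>length L\<close> up to \<open>m\<close> are padded with
      outer weight 0.\<close>
    define \<gamma> where "\<gamma> j = (if j < length L then fst (L ! j) else 0)" for j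
    define k where "k j = fst (snd (L ! j))" for j
    define t where "t j = snd (snd (L ! j))" for j
    define w where "w j i = of_int (Poly_Mapping.lookup (k j) i) / norm1 (k j)" for j i
    have pad: "(\<Sum>j<m. h j) = (\<Sum>j<length L. h j)" if "\<And>j. j \<ge> length L \<Longrightarrow> h j = 0" for h :: "nat \<Rightarrow> real"
      using len that by (intro sum.mono_neutral_right) auto
    have "(\<Sum>j<m. \<bar>\<gamma> j\<bar>) = (\<Sum>j<length L. \<bar>fst (L ! j)\<bar>)"
      by (subst pad) (auto simp: \<gamma>_def)
    also have "\<dots> = (\<Sum>x\<leftarrow>L. \<bar>fst x\<bar>)"
      by (simp add: sum_list_sum_nth atLeast0LessThan)
    finally have \<gamma>: "(\<Sum>j<m. \<bar>\<gamma> j\<bar>) \<le> 4 * B" using L(3) outer by linarith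
    have in_L: "k j \<in> \<kappa> ` {..<n} \<and> \<bar>t j\<bar> \<le> 1" if "\<gamma> j \<noteq> 0" for j
    proof -
      have "L ! j \<in> set L" using that by (auto simp: \<gamma>_def split: if_splits)
      then show ?thesis using L(4) unfolding k_def t_def by (auto split: prod.splits simp: case_prod_beta)
    qed
    have wsum: "(\<Sum>i\<in>Poly_Mapping.keys (k j). \<bar>w j i\<bar>) = 1" if "k j \<noteq> 0" for j
      using norm1_ge_1[OF that] by (simp add: w_def abs_divide sum_divide_distrib[symmetric]) (simp add: norm1_def)
    have ridge_w: "ridge \<Phi> (k j) v / norm1 (k j) = (\<Sum>i\<in>Poly_Mapping.keys (k j). w j i * coord \<Phi> v i)" for j v
      by (simp add: ridge_def w_def sum_divide_distrib)
    have fm: "fm v = (Re (a 0) + c0) + (\<Sum>j<m. \<gamma> j * relu ((\<Sum>i\<in>Poly_Mapping.keys (k j). w j i * coord \<Phi> v i) - t j))" for v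
    proof -
      have "(\<Sum>j<m. \<gamma> j * relu ((\<Sum>i\<in>Poly_Mapping.keys (k j). w j i * coord \<Phi> v i) - t j)) = (\<Sum>j<length L. neuron \<Phi> v (L ! j))"
        unfolding ridge_w[symmetric] by (subst pad) (auto simp: \<gamma>_def k_def t_def neuron_def case_prod_beta)
      then show ?thesis by (simp add: fm_def sum_list_sum_nth atLeast0LessThan)
    qed
    show ?thesis
      unfolding relu_nets_def mem_Collect_eq K_f_def a B_def[symmetric]
    proof (rule exI[of _ "Re (a 0) + c0"], rule exI[of _ \<gamma>], rule exI[of _ k], rule exI[of _ w], rule exI[of _ t],
        intro conjI ballI allI impI)
      show "\<bar>Re (a 0) + c0\<bar> \<le> 2 * B" by (rule c0)
      show "(\<Sum>j<m. \<bar>\<gamma> j\<bar>) \<le> 4 * B" by (rule \<gamma>)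
      show "a (k j) \<noteq> 0" "(\<Sum>i\<in>Poly_Mapping.keys (k j). \<bar>w j i\<bar>) = 1" "\<bar>t j\<bar> \<le> 1"
        if "j < m" "\<gamma> j \<noteq> 0" for j
      proof -
        have k: "k j \<noteq> 0" "a (k j) \<noteq> 0" using in_L[OF that(2)] \<kappa> by auto
        show "a (k j) \<noteq> 0" "(\<Sum>i\<in>Poly_Mapping.keys (k j). \<bar>w j i\<bar>) = 1" "\<bar>t j\<bar> \<le> 1"
          using k(2) wsum[OF k(1)] in_L[OF that(2)] by auto
      qed
    qed (rule fm)
  qed
  have rep_b: "fourier_rep \<Phi> (\<lambda>v. f v - fm v) b"
    unfolding fourier_rep_def
  proof
    fix v assume v: "v \<in> L_bound \<Phi>"
    have "((\<lambda>k. \<Sum>j<n. of_real (\<mu> j) * (wave_coeff (\<kappa> j) (\<theta> j) k * fourier_basis \<Phi> k v)) has_sum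
        (\<Sum>j<n. of_real (\<mu> j) * of_real (tri (ridge \<Phi> (\<kappa> j) v - \<theta> j)))) UNIV"
      by (intro has_sum_finite_sum has_sum_cmult_right wave_coeff_has_sum) (auto simp: \<kappa>(1))
    moreover have "((\<lambda>k. if k = 0 then a 0 else 0) has_sum a 0) UNIV"
      by (rule has_sum_finite_neutralI[of "{0}"]) auto
    moreover have "((\<lambda>k. a k * fourier_basis \<Phi> k v) has_sum of_real (f v)) UNIV"
      using rep v by (simp add: fourier_rep_def)
    ultimately have "((\<lambda>k. a k * fourier_basis \<Phi> k v - (if k = 0 then a 0 else 0)
        - (\<Sum>j<n. of_real (\<mu> j) * (wave_coeff (\<kappa> j) (\<theta> j) k * fourier_basis \<Phi> k v))) has_sum
        (of_real (f v) - a 0 - (\<Sum>j<n. of_real (\<mu> j) * of_real (tri (ridge \<Phi> (\<kappa> j) v - \<theta> j))))) UNIV"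
      by (intro has_sum_diff)
    moreover have "a k * fourier_basis \<Phi> k v - (if k = 0 then a 0 else 0)
        - (\<Sum>j<n. of_real (\<mu> j) * (wave_coeff (\<kappa> j) (\<theta> j) k * fourier_basis \<Phi> k v)) = b k * fourier_basis \<Phi> k v" for k
      by (cases "k = 0") (simp_all add: b_def fourier_basis_cis ridge_def left_diff_distrib sum_distrib_right mult_ac)
    moreover have "of_real (f v) - a 0 - (\<Sum>j<n. of_real (\<mu> j) * of_real (tri (ridge \<Phi> (\<kappa> j) v - \<theta> j)))
        = of_real (f v - fm v)"
    proof -
      have "a 0 = of_real (Re (a 0))" using herm[of 0] by (simp add: complex_eq_iff)
      moreover have "(\<Sum>j<n. complex_of_real (\<mu> j) * of_real (tri (ridge \<Phi> (\<kappa> j) v - \<theta> j))) = of_real (c0 + (\<Sum>x\<leftarrow>L. neuron \<Phi> v x))"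
        using L(5) v by (simp flip: of_real_mult of_real_sum)
      ultimately show ?thesis unfolding fm_def by (metis (no_types, lifting) diff_diff_eq of_real_add of_real_diff add.assoc)
    qed
    ultimately show "((\<lambda>k. b k * fourier_basis \<Phi> k v) has_sum of_real (f v - fm v)) UNIV" by simp
  qed
  have herm_b: "b (- k) = cnj (b k)" for k
    by (simp add: b_def herm wave_coeff_uminus[OF \<kappa>(1)])
  have dom_b: "dominated b"
  proof (rule dominated_finite_modification[OF dom])
    \<comment> \<open>The empty support is among the exceptions because the coefficient at 0 is
      removed; the others are the supports of the sampled waves.\<close>
    show "finite (insert {} ((\<lambda>j. Poly_Mapping.keys (\<kappa> j)) ` {..<n}))" by simp
    show "finite S" if "S \<in> insert {} ((\<lambda>j. Poly_Mapping.keys (\<kappa> j)) ` {..<n})" for S using that by auto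
    show "\<exists>k'. a k' \<noteq> 0 \<and> Poly_Mapping.keys k' = Poly_Mapping.keys k" if "b k \<noteq> 0" "k \<noteq> 0" for k
    proof (cases "a k = 0")
      case True
      \<comment> \<open>A coefficient created by a wave sits at a nonzero multiple of some
        \<open>\<kappa> j\<close>, whose support is already a support of \<open>a\<close>; no new
        supports arise.\<close>
      then have "(\<Sum>j<n. of_real (\<mu> j) * wave_coeff (\<kappa> j) (\<theta> j) k) \<noteq> 0" using that by (simp add: b_def)
      then obtain j where "j < n" "wave_coeff (\<kappa> j) (\<theta> j) k \<noteq> 0"
        by (metis (no_types, lifting) lessThan_iff mult_zero_right sum.neutral)
      then show ?thesis using \<kappa> wave_coeff_keys by metis
    qed auto
    show "b k \<noteq> 0" if "a k \<noteq> 0" "Poly_Mapping.keys k \<notin> insert {} ((\<lambda>j. Poly_Mapping.keys (\<kappa> j)) ` {..<n})" for k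
    proof -
      have "wave_coeff (\<kappa> j) (\<theta> j) k = 0" if "j < n" for j
        using wave_coeff_keys[OF \<kappa>(1)[OF that], of "\<theta> j" k] \<open>Poly_Mapping.keys k \<notin> _\<close> that by auto
      then have "b k = (if k = 0 then 0 else a k)" by (simp add: b_def)
      then show ?thesis using that by auto
    qed
  qed
  have exp_b: "fourier_expansion \<Phi> (\<lambda>v. f v - fm v) b"
    by (rule fourier_expansion_if_dominated[OF \<Phi> rep_b herm_b dom_b])
  have b: "fourier_coeff \<Phi> (\<lambda>v. f v - fm v) = b" by (rule fourier_coeff_eq[OF \<Phi> exp_b])
  have sb: "sq_summable b" "sq_norm b \<le> 80 * B\<^sup>2 / real m" using err by (simp_all add: b_def[abs_def])
  have "(\<lambda>v. f v - fm v) \<in> hilbert_space \<Phi>"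
    using exp_b sb(1) by (auto simp: hilbert_space_def b sq_summable_def)
  moreover have "hilbert_norm \<Phi> (\<lambda>v. f v - fm v) \<le> 4 * sqrt 5 * B / sqrt (real m)"
  proof -
    have "hilbert_inner \<Phi> (\<lambda>v. f v - fm v) (\<lambda>v. f v - fm v) = (\<Sum>\<^sub>\<infinity>k. of_real (weight k * (cmod (b k))\<^sup>2))"
      unfolding hilbert_inner_def b
      by (intro infsum_cong) (simp add: complex_norm_square mult_ac del: of_real_power)
    also have "\<dots> = of_real (sq_norm b)"
      using has_sum_of_real[OF sq_summable_has_sum[OF sb(1)]] by (rule infsumI)
    finally have "hilbert_norm \<Phi> (\<lambda>v. f v - fm v) = sqrt (sq_norm b)" by (simp add: hilbert_norm_def)
    also have "\<dots> \<le> sqrt (80 * B\<^sup>2 / real m)" using sb(2) by simp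
    also have "\<dots> = 4 * sqrt 5 * B / sqrt (real m)"
    proof -
      have "B \<ge> 0" using has_sum_nonneg[OF B] weight_ge_1 by (meson mult_nonneg_nonneg norm_ge_zero order_trans zero_le_one)
      moreover have "sqrt 80 = 4 * sqrt (5::real)" using real_sqrt_mult[of 16 5] by simp
      ultimately show ?thesis by (simp add: real_sqrt_divide real_sqrt_mult)
    qed
    finally show ?thesis .
  qed
  ultimately show ?thesis using net unfolding B_def by blast
qed

end
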